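(* Let $H$ be the Hopf algebra associated to a group datum $(G,\chi,g,1)$ of non-nilpotent type, as in the context. For any $i,j\in\Omega_1$ the following hold. (1) If $\lambda_i\lambda_j=1$, then as $\Bbbk G$-modules $V_i\otimes V_j\cong\bigoplus_sV_s$, where $s$ runs over a finite family (with multiplicity) of indices in $\Omega_0$, and in this case, as $H$-modules, $$P_i\otimes P_j\cong\bigoplus_{t=0}^{n-1}\bigoplus_sM(n,\tau^t(s)).$$ (2) If $\lambda_i\lambda_j\ne1$, then as $\Bbbk G$-modules $V_i\otimes V_j\cong\bigoplus_sV_s$, where $s$ runs over a finite family (with multiplicity) of indices in $\Omega_1$, and in this case, as $H$-modules, $$P_i\otimes P_j\cong\bigoplus_{t=0}^{n-1}\bigoplus_sP_{\tau^t(s)}.$$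
   Context: $\Bbbk$ is an algebraically closed field of characteristic zero; modules are finite-dimensional left modules; $\otimes=\otimes_\Bbbk$. Fix a finite group $G$, a $\Bbbk$-linear character $\chi$ of $G$ and a central element $g\in G$; let $n\ge 2$ be the order of $q=\chi(g)$, and assume $\chi^n=1$ and $g^n\neq 1$. $H$ is the Hopf algebra generated as an algebra by $y$ and $G$, with $\Bbbk G$ as a subalgebra and relations $y^n=g^n-1$, $yh=\chi(h)hy$ for $h\in G$; $\Delta(y)=y\otimes g+1\otimes y$, $\varepsilon(y)=0$, $S(y)=-yg^{-1}$, and the elements of $G$ are group-like. It has $\Bbbk$-basis $\{y^ih\mid h\in G,\ 0\le i\le n-1\}$. Tensor products of $H$-modules are $H$-modules via $\Delta$. Let $\{V_i\mid i\in\Omega\}$ be a complete set of simple $\Bbbk G$-modules up to isomorphism; $g^n$ acts on $V_i$ by a nonzero scalar $\lambda_i$; $\Omega_0=\{i\in\Omega\mid\lambda_i=1\}$, $\Omega_1=\{i\in\Omega\mid\lambda_i\ne1\}$. For $k\ge0$, $x^kV_i=\{x^kv\mid v\in V_i\}$ is a copy of the vector space $V_i$ ($x$ a formal variable) with $G$-action $h(x^kv)=\chi^{-k}(h)x^k(hv)$. For $i\in\Omega_0$, $1\le k\le n$, $M(k,i)=V_i\oplus xV_i\oplus\cdots\oplus x^{k-1}V_i$ is the $H$-module with this $G$-action and $y(x^sv)=x^{s+1}v$ for $0\le s\le k-2$, $y(x^{k-1}v)=0$. For $j\in\Omega_1$, $P_j=V_j\oplus xV_j\oplus\cdots\oplus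 x^{n-1}V_j$ is the $H$-module with this $G$-action and $y(x^sv)=x^{s+1}v$ for $0\le s\le n-2$, $y(x^{n-1}v)=(\lambda_j-1)v$. Let $V_{\chi^{-1}}$ be the one-dimensional $\Bbbk G$-module with character $\chi^{-1}$; $\tau$ is the permutation of $\Omega$ with $V_{\chi^{-1}}\otimes V_s\cong V_{\tau(s)}$; it preserves $\Omega_0$ and $\Omega_1$. *)

theory Defs
  imports
    "HOL-Algebra.Group"
    "HOL-Library.Function_Algebras"
    "HOL-Computational_Algebra.Polynomial"
begin

section \<open>Vector spaces\<close>

text \<open>
  All vector spaces are linear subspaces of function spaces \<open>'a \<Rightarrow> 'k\<close> with pointwise operations;
  choosing a basis \<open>'a\<close> shows that every vector space has this form up to isomorphism.
  Only the values of a map on the subspace in question are relevant.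
\<close>

definition fscale :: "'k::field \<Rightarrow> ('a \<Rightarrow> 'k) \<Rightarrow> ('a \<Rightarrow> 'k)"  (infixr \<open>\<cdot>\<close> 75)
  where "c \<cdot> f = (\<lambda>x. c * f x)"

global_interpretation fs: vector_space "fscale :: 'k::field \<Rightarrow> ('a \<Rightarrow> 'k) \<Rightarrow> ('a \<Rightarrow> 'k)"
  by unfold_locales (auto simp: fscale_def algebra_simps)

definition findim :: "('a \<Rightarrow> 'k::field) set \<Rightarrow> bool"
  where "findim V \<longleftrightarrow> fs.subspace V \<and> (\<exists>B. finite B \<and> fs.span B = V)"

definition linear_on :: "('a \<Rightarrow> 'k::field) set \<Rightarrow> ('b \<Rightarrow> 'k) set \<Rightarrow> (('a \<Rightarrow> 'k) \<Rightarrow> ('b \<Rightarrow> 'k)) \<Rightarrow> bool"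
  where "linear_on V W f \<longleftrightarrow>
    (\<forall>v\<in>V. f v \<in> W) \<and>
    (\<forall>u\<in>V. \<forall>v\<in>V. f (u + v) = f u + f v) \<and>
    (\<forall>c. \<forall>v\<in>V. f (c \<cdot> v) = c \<cdot> f v)"

definition bilinear_on ::
    "('a \<Rightarrow> 'k::field) set \<Rightarrow> ('b \<Rightarrow> 'k) set \<Rightarrow> ('c \<Rightarrow> 'k) set \<Rightarrow>
     (('a \<Rightarrow> 'k) \<Rightarrow> ('b \<Rightarrow> 'k) \<Rightarrow> ('c \<Rightarrow> 'k)) \<Rightarrow> bool"
  where "bilinear_on U V W b \<longleftrightarrow>
    (\<forall>u\<in>U. linear_on V W (b u)) \<and> (\<forall>v\<in>V. linear_on U W (\<lambda>u. b u v))"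


section \<open>Tensor products\<close>

definition vtensor :: "('a \<Rightarrow> 'k::field) \<Rightarrow> ('b \<Rightarrow> 'k) \<Rightarrow> ('a \<times> 'b \<Rightarrow> 'k)"  (infixr \<open>\<boxtimes>\<close> 72)
  where "u \<boxtimes> v = (\<lambda>(x, y). u x * v y)"

definition tensor_space :: "('a \<Rightarrow> 'k::field) set \<Rightarrow> ('b \<Rightarrow> 'k) set \<Rightarrow> ('a \<times> 'b \<Rightarrow> 'k) set"
  where "tensor_space U V = fs.span {u \<boxtimes> v |u v. u \<in> U \<and> v \<in> V}"

text \<open>
  The linear map \<open>U \<otimes> V \<rightarrow> W\<close> with \<open>u \<otimes> v \<mapsto> b u v\<close> induced by a bilinear map \<open>b\<close>.
  It exists and is unique on \<open>tensor_space U V\<close> by the universal property proved below.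
\<close>

definition tlift ::
    "('a \<Rightarrow> 'k::field) set \<Rightarrow> ('b \<Rightarrow> 'k) set \<Rightarrow> (('a \<Rightarrow> 'k) \<Rightarrow> ('b \<Rightarrow> 'k) \<Rightarrow> ('c \<Rightarrow> 'k)) \<Rightarrow>
     ('a \<times> 'b \<Rightarrow> 'k) \<Rightarrow> ('c \<Rightarrow> 'k)"
  where "tlift U V b = (SOME T. linear_on (tensor_space U V) UNIV T \<and>
    (\<forall>u\<in>U. \<forall>v\<in>V. T (u \<boxtimes> v) = b u v))"

definition tmap ::
    "('a \<Rightarrow> 'k::field) set \<Rightarrow> ('b \<Rightarrow> 'k) set \<Rightarrow> (('a \<Rightarrow> 'k) \<Rightarrow> ('c \<Rightarrow> 'k)) \<Rightarrow>
     (('b \<Rightarrow> 'k) \<Rightarrow> ('d \<Rightarrow> 'k)) \<Rightarrow> ('a \<times> 'b \<Rightarrow> 'k) \<Rightarrow> ('c \<times> 'd \<Rightarrow> 'k)"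
  where "tmap U V A B = tlift U V (\<lambda>u v. A u \<boxtimes> B v)"

lemma vtensor_add_left: "(u + u') \<boxtimes> v = u \<boxtimes> v + u' \<boxtimes> v"
  and vtensor_add_right: "u \<boxtimes> (v + v') = u \<boxtimes> v + u \<boxtimes> v'"
  and vtensor_scale_left: "(c \<cdot> u) \<boxtimes> v = c \<cdot> (u \<boxtimes> v)"
  and vtensor_scale_right: "u \<boxtimes> (c \<cdot> v) = c \<cdot> (u \<boxtimes> v)"
  by (auto simp: vtensor_def fscale_def fun_eq_iff algebra_simps)

lemma sum_fun_apply: "(\<Sum>i\<in>I. (f i :: 'a \<Rightarrow> 'k::field)) x = (\<Sum>i\<in>I. f i x)"
  by (induction I rule: infinite_finite_induct) auto

text \<open>Tensors of independent families are independent.\<close>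

lemma vtensor_independent:
  fixes B :: "('a \<Rightarrow> 'k::field) set" and C :: "('b \<Rightarrow> 'k) set"
  assumes B: "fs.independent B" and C: "fs.independent C"
    and fin: "finite S" "finite T" and ST: "S \<subseteq> B" "T \<subseteq> C"
    and zero: "(\<Sum>p\<in>S \<times> T. k p \<cdot> (fst p \<boxtimes> snd p)) = 0"
    and bc: "b \<in> S" "c \<in> T"
  shows "k (b, c) = 0"
proof -
  have row: "(\<Sum>c\<in>T. k (b, c) \<cdot> c) = 0" if "b \<in> S" for b
  proof
    fix y
    have "(\<Sum>b\<in>S. (\<Sum>c\<in>T. k (b, c) * c y) \<cdot> b) = 0"
    proof
      fix x
      have "0 = (\<Sum>p\<in>S \<times> T. k p \<cdot> (fst p \<boxtimes> snd p)) (x, y)"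
        by (simp add: zero)
      also have "\<dots> = (\<Sum>b\<in>S. \<Sum>c\<in>T. k (b, c) * (b x * c y))"
        by (simp add: sum_fun_apply sum.cartesian_product fscale_def vtensor_def case_prod_unfold)
      finally show "(\<Sum>b\<in>S. (\<Sum>c\<in>T. k (b, c) * c y) \<cdot> b) x = 0 x"
        by (simp add: sum_fun_apply fscale_def sum_distrib_right sum_distrib_left mult_ac)
    qed
    from fs.independentD[OF B fin(1) ST(1) this \<open>b \<in> S\<close>]
    show "(\<Sum>c\<in>T. k (b, c) \<cdot> c) y = 0 y"
      by (simp add: sum_fun_apply fscale_def)
  qed
  from fs.independentD[OF C fin(2) ST(2) row[OF bc(1)] bc(2)] show ?thesis .
qed

lemma linear_on_sum:
  assumes "linear_on V W f" "fs.subspace V" "\<And>i. i \<in> I \<Longrightarrow> v i \<in> V"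
  shows "f (\<Sum>i\<in>I. k i \<cdot> v i) = (\<Sum>i\<in>I. k i \<cdot> f (v i))"
proof -
  have f0: "f 0 = 0"
  proof -
    have "f (0 \<cdot> 0) = 0 \<cdot> f 0"
      using assms(1,2) fs.subspace_0 unfolding linear_on_def by blast
    then show ?thesis by simp
  qed
  show ?thesis
    using assms(3)
  proof (induction I rule: infinite_finite_induct)
    case (insert i I)
    have "k i \<cdot> v i \<in> V" "(\<Sum>i\<in>I. k i \<cdot> v i) \<in> V"
      using insert assms(2) by (auto intro!: fs.subspace_sum fs.subspace_scale)
    then have "f (k i \<cdot> v i + (\<Sum>i\<in>I. k i \<cdot> v i)) = k i \<cdot> f (v i) + f (\<Sum>i\<in>I. k i \<cdot> v i)"
      using assms(1) insert.prems unfolding linear_on_def by simp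
    moreover have "f (\<Sum>i\<in>I. k i \<cdot> v i) = (\<Sum>i\<in>I. k i \<cdot> f (v i))"
      using insert by simp
    ultimately show ?case by (simp only: sum.insert[OF insert.hyps])
  qed (auto simp: f0)
qed

theorem tensor_universal:
  fixes U :: "('a \<Rightarrow> 'k::field) set" and V :: "('b \<Rightarrow> 'k) set"
    and b :: "('a \<Rightarrow> 'k) \<Rightarrow> ('b \<Rightarrow> 'k) \<Rightarrow> ('c \<Rightarrow> 'k)"
  assumes U: "fs.subspace U" and V: "fs.subspace V" and b: "bilinear_on U V UNIV b"
  shows "\<exists>T. linear_on (tensor_space U V) UNIV T \<and> (\<forall>u\<in>U. \<forall>v\<in>V. T (u \<boxtimes> v) = b u v)"
proof -
  obtain B where B: "B \<subseteq> U" "fs.independent B" "U \<subseteq> fs.span B"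
    using fs.maximal_independent_subset by blast
  obtain C where C: "C \<subseteq> V" "fs.independent C" "V \<subseteq> fs.span C"
    using fs.maximal_independent_subset by blast
  let ?t = "\<lambda>p. fst p \<boxtimes> snd p"
  have inj: "inj_on ?t (B \<times> C)"
  proof (rule inj_onI)
    fix p q assume pq: "p \<in> B \<times> C" "q \<in> B \<times> C" "?t p = ?t q"
    show "p = q"
    proof (rule ccontr)
      assume ne: "p \<noteq> q"
      let ?S = "{fst p, fst q}" and ?T = "{snd p, snd q}"
      let ?k = "\<lambda>r. if r = p then 1 :: 'k else if r = q then - 1 else 0"
      have "(\<Sum>r\<in>?S \<times> ?T. ?k r \<cdot> ?t r) = (\<Sum>r\<in>{p, q}. ?k r \<cdot> ?t r)"
        by (rule sum.mono_neutral_right) (auto simp: mem_Times_iff)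
      also have "\<dots> = 0" using ne pq(3) by simp
      finally have zero: "(\<Sum>r\<in>?S \<times> ?T. ?k r \<cdot> ?t r) = 0" .
      have "?k (fst p, snd p) = 0"
        by (rule vtensor_independent[OF B(2) C(2) _ _ _ _ zero]) (use pq in auto)
      then show False by simp
    qed
  qed
  have ind: "fs.independent (?t ` (B \<times> C))"
    unfolding fs.independent_explicit_module
  proof (intro allI impI)
    fix t u w
    assume t: "finite t" "t \<subseteq> ?t ` (B \<times> C)" "(\<Sum>v\<in>t. u v \<cdot> v) = 0" "w \<in> t"
    then obtain R where R: "R \<subseteq> B \<times> C" "finite R" "t = ?t ` R"
      by (meson finite_subset_image)
    obtain p where p: "p \<in> R" "w = ?t p" using t R by auto
    let ?k = "\<lambda>r. if r \<in> R then u (?t r) else 0"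
    have "(\<Sum>r\<in>fst ` R \<times> snd ` R. ?k r \<cdot> ?t r) = (\<Sum>r\<in>R. ?k r \<cdot> ?t r)"
      using R by (intro sum.mono_neutral_right) (use subset_fst_snd[of R] in auto)
    also have "\<dots> = (\<Sum>v\<in>t. u v \<cdot> v)"
      unfolding R(3) using inj_on_subset[OF inj R(1)] by (subst sum.reindex) auto
    finally have zero: "(\<Sum>r\<in>fst ` R \<times> snd ` R. ?k r \<cdot> ?t r) = 0"
      using t(3) by simp
    have "fst ` R \<subseteq> B" "snd ` R \<subseteq> C" using R(1) by auto
    then have "?k (fst p, snd p) = 0"
      by (intro vtensor_independent[OF B(2) C(2) _ _ _ _ zero]) (use R(2) p(1) in auto)
    then show "u w = 0" using p by simp
  qed
  interpret pr: vector_space_pair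
    "fscale :: 'k \<Rightarrow> ('a \<times> 'b \<Rightarrow> 'k) \<Rightarrow> ('a \<times> 'b \<Rightarrow> 'k)"
    "fscale :: 'k \<Rightarrow> ('c \<Rightarrow> 'k) \<Rightarrow> ('c \<Rightarrow> 'k)" ..
  obtain T where T: "Vector_Spaces.linear fscale fscale T"
    "\<forall>x\<in>?t ` (B \<times> C). T x = (\<lambda>p. b (fst p) (snd p)) (inv_into (B \<times> C) ?t x)"
    using pr.linear_independent_extend[OF ind,
        of "\<lambda>x. (\<lambda>p. b (fst p) (snd p)) (inv_into (B \<times> C) ?t x)"] by auto
  interpret T: Vector_Spaces.linear fscale fscale T by fact
  have Tbc: "T (u \<boxtimes> v) = b u v" if "u \<in> B" "v \<in> C" for u v
  proof -
    have m: "(u, v) \<in> B \<times> C" using that by simp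
    have "T (?t (u, v)) = (\<lambda>p. b (fst p) (snd p)) (inv_into (B \<times> C) ?t (?t (u, v)))"
      using T(2) m by blast
    then show ?thesis by (simp add: inv_into_f_f[OF inj m, simplified])
  qed
  have "T (u \<boxtimes> v) = b u v" if u: "u \<in> U" and v: "v \<in> V" for u v
  proof -
    have blin: "linear_on V UNIV (b u)" if "u \<in> U" for u
      using b that by (auto simp: bilinear_on_def)
    have blin': "linear_on U UNIV (\<lambda>u. b u v)" using b v by (auto simp: bilinear_on_def)
    have st1: "T (u \<boxtimes> v) = b u v" if "u \<in> B" for u
    proof -
      have "v \<in> fs.span C" using v C by blast
      then obtain S r where S: "finite S" "S \<subseteq> C" "v = (\<Sum>a\<in>S. r a \<cdot> a)"
        by (auto simp: fs.span_explicit)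
      have "u \<boxtimes> v = (\<Sum>a\<in>S. r a \<cdot> (u \<boxtimes> a))"
        unfolding S(3) by (auto simp: vtensor_def fscale_def sum_fun_apply fun_eq_iff
            sum_distrib_left mult_ac)
      then have "T (u \<boxtimes> v) = (\<Sum>a\<in>S. r a \<cdot> b u a)"
        using S Tbc[OF that] by (auto simp: T.sum T.scale intro!: sum.cong)
      also have "\<dots> = b u v"
        unfolding S(3)
        by (rule linear_on_sum[OF blin V, symmetric]) (use that B(1) S(2) C(1) in blast)+
      finally show ?thesis .
    qed
    have "u \<in> fs.span B" using u B by blast
    then obtain S r where S: "finite S" "S \<subseteq> B" "u = (\<Sum>a\<in>S. r a \<cdot> a)"
      by (auto simp: fs.span_explicit)
    have "u \<boxtimes> v = (\<Sum>a\<in>S. r a \<cdot> (a \<boxtimes> v))"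
      unfolding S(3) by (auto simp: vtensor_def fscale_def sum_fun_apply fun_eq_iff
          sum_distrib_right sum_distrib_left mult_ac)
    then have "T (u \<boxtimes> v) = (\<Sum>a\<in>S. r a \<cdot> b a v)"
      using S st1 by (auto simp: T.sum T.scale intro!: sum.cong)
    also have "\<dots> = b u v"
      unfolding S(3)
      by (rule linear_on_sum[OF blin' U, symmetric]) (use B(1) S(2) in blast)
    finally show ?thesis .
  qed
  moreover have "linear_on (tensor_space U V) UNIV T"
    by (auto simp: linear_on_def T.add T.scale)
  ultimately show ?thesis by blast
qed


section \<open>Modules given by families of operators\<close>

text \<open>
  A vector space together with operators indexed by \<open>'x\<close>. It is used for \<open>\<Bbbk>G\<close>-modules, with
  operators indexed by the elements of \<open>G\<close>, and for \<open>H\<close>-modules, with operators indexed by the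
  elements of \<open>H\<close>.
\<close>

record ('x, 'a, 'k) opmod =
  mcar :: "('a \<Rightarrow> 'k) set"
  mact :: "'x \<Rightarrow> ('a \<Rightarrow> 'k) \<Rightarrow> ('a \<Rightarrow> 'k)"

definition mod_iso :: "'x set \<Rightarrow> ('x, 'a, 'k::field) opmod \<Rightarrow> ('x, 'b, 'k) opmod \<Rightarrow> bool"
  where "mod_iso X M N \<longleftrightarrow> (\<exists>f. linear_on (mcar M) (mcar N) f \<and> bij_betw f (mcar M) (mcar N) \<and>
    (\<forall>x\<in>X. \<forall>v\<in>mcar M. f (mact M x v) = mact N x (f v)))"

text \<open>The direct sum of the \<open>M r\<close> over a finite index set \<open>I\<close>; \<open>curry f r\<close> is the component at \<open>r\<close>.\<close>

definition dsum :: "'r set \<Rightarrow> ('r \<Rightarrow> ('x, 'a, 'k::field) opmod) \<Rightarrow> ('x, 'r \<times> 'a, 'k) opmod"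
  where "dsum I M = \<lparr>
    mcar = {f. \<forall>r. curry f r \<in> (if r \<in> I then mcar (M r) else {0})},
    mact = (\<lambda>x f (r, a). if r \<in> I then mact (M r) x (curry f r) a else 0)\<rparr>"


section \<open>Representations of \<open>G\<close>\<close>

definition G_module :: "('g, 'z) monoid_scheme \<Rightarrow> ('g, 'a, 'k::field) opmod \<Rightarrow> bool"
  where "G_module G M \<longleftrightarrow> findim (mcar M) \<and>
    (\<forall>h\<in>carrier G. linear_on (mcar M) (mcar M) (mact M h)) \<and>
    (\<forall>v\<in>mcar M. mact M \<one>\<^bsub>G\<^esub> v = v) \<and>
    (\<forall>h\<in>carrier G. \<forall>h'\<in>carrier G. \<forall>v\<in>mcar M. mact M (h \<otimes>\<^bsub>G\<^esub> h') v = mact M h (mact M h' v))"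

definition simple_G_module :: "('g, 'z) monoid_scheme \<Rightarrow> ('g, 'a, 'k::field) opmod \<Rightarrow> bool"
  where "simple_G_module G M \<longleftrightarrow> G_module G M \<and> mcar M \<noteq> {0} \<and>
    (\<forall>U. fs.subspace U \<and> U \<subseteq> mcar M \<and> (\<forall>h\<in>carrier G. \<forall>u\<in>U. mact M h u \<in> U) \<longrightarrow>
      U = {0} \<or> U = mcar M)"

definition G_tensor :: "('g, 'a, 'k::field) opmod \<Rightarrow> ('g, 'b, 'k) opmod \<Rightarrow> ('g, 'a \<times> 'b, 'k) opmod"
  where "G_tensor M N = \<lparr>
    mcar = tensor_space (mcar M) (mcar N),
    mact = (\<lambda>h. tmap (mcar M) (mcar N) (mact M h) (mact N h))\<rparr>"

text \<open>
  In the completeness clause, the simple modules are taken on subspaces of \<open>nat \<Rightarrow> 'k\<close>, which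
  contains a copy of every finite-dimensional space.
\<close>

definition complete_simples ::
    "('g, 'z) monoid_scheme \<Rightarrow> 'i set \<Rightarrow> ('i \<Rightarrow> ('g, 'a, 'k::field) opmod) \<Rightarrow> bool"
  where "complete_simples G \<Omega> V \<longleftrightarrow>
    (\<forall>i\<in>\<Omega>. simple_G_module G (V i)) \<and>
    (\<forall>i\<in>\<Omega>. \<forall>j\<in>\<Omega>. mod_iso (carrier G) (V i) (V j) \<longrightarrow> i = j) \<and>
    (\<forall>W :: ('g, nat, 'k) opmod. simple_G_module G W \<longrightarrow> (\<exists>i\<in>\<Omega>. mod_iso (carrier G) W (V i)))"


section \<open>Hopf algebras\<close>

record ('b, 'k) hopf =
  hcar :: "('b \<Rightarrow> 'k) set"
  hmul :: "('b \<Rightarrow> 'k) \<Rightarrow> ('b \<Rightarrow> 'k) \<Rightarrow> ('b \<Rightarrow> 'k)"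
  hone :: "'b \<Rightarrow> 'k"
  comul :: "('b \<Rightarrow> 'k) \<Rightarrow> ('b \<times> 'b \<Rightarrow> 'k)"
  counit :: "('b \<Rightarrow> 'k) \<Rightarrow> 'k"
  antipode :: "('b \<Rightarrow> 'k) \<Rightarrow> ('b \<Rightarrow> 'k)"

definition hpow :: "('b, 'k) hopf \<Rightarrow> ('b \<Rightarrow> 'k) \<Rightarrow> nat \<Rightarrow> ('b \<Rightarrow> 'k)"
  where "hpow H a m = (hmul H a ^^ m) (hone H)"

definition algebra_axioms :: "('b, 'k::field) hopf \<Rightarrow> bool"
  where "algebra_axioms H \<longleftrightarrow> fs.subspace (hcar H) \<and> hone H \<in> hcar H \<and>
    bilinear_on (hcar H) (hcar H) (hcar H) (hmul H) \<and>
    (\<forall>a\<in>hcar H. hmul H (hone H) a = a \<and> hmul H a (hone H) = a) \<and>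
    (\<forall>a\<in>hcar H. \<forall>b\<in>hcar H. \<forall>c\<in>hcar H. hmul H (hmul H a b) c = hmul H a (hmul H b c))"

text \<open>The multiplication of the algebra \<open>H \<otimes> H\<close>, i.e. \<open>(a \<otimes> b) (a' \<otimes> b') = a a' \<otimes> b b'\<close>.\<close>

definition tensor_mul :: "('b, 'k::field) hopf \<Rightarrow> ('b \<times> 'b \<Rightarrow> 'k) \<Rightarrow> ('b \<times> 'b \<Rightarrow> 'k) \<Rightarrow> ('b \<times> 'b \<Rightarrow> 'k)"
  where "tensor_mul H s t =
    tlift (hcar H) (hcar H) (\<lambda>a b. tmap (hcar H) (hcar H) (hmul H a) (hmul H b) t) s"

definition coalgebra_axioms :: "('b, 'k::field) hopf \<Rightarrow> bool"
  where "coalgebra_axioms H \<longleftrightarrow>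
    linear_on (hcar H) (tensor_space (hcar H) (hcar H)) (comul H) \<and>
    (\<forall>a\<in>hcar H. \<forall>b\<in>hcar H. counit H (a + b) = counit H a + counit H b) \<and>
    (\<forall>c. \<forall>a\<in>hcar H. counit H (c \<cdot> a) = c * counit H a) \<and>
    (\<forall>a\<in>hcar H.
      tmap (hcar H) (hcar H) (\<lambda>b. b) (comul H) (comul H a) =
        (\<lambda>(x, y, z). tmap (hcar H) (hcar H) (comul H) (\<lambda>b. b) (comul H a) ((x, y), z)) \<and>
      tlift (hcar H) (hcar H) (\<lambda>b c. counit H b \<cdot> c) (comul H a) = a \<and>
      tlift (hcar H) (hcar H) (\<lambda>b c. counit H c \<cdot> b) (comul H a) = a)"

definition hopf_algebra :: "('b, 'k::field) hopf \<Rightarrow> bool"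
  where "hopf_algebra H \<longleftrightarrow> algebra_axioms H \<and> coalgebra_axioms H \<and>
    comul H (hone H) = hone H \<boxtimes> hone H \<and>
    (\<forall>a\<in>hcar H. \<forall>b\<in>hcar H. comul H (hmul H a b) = tensor_mul H (comul H a) (comul H b)) \<and>
    counit H (hone H) = 1 \<and>
    (\<forall>a\<in>hcar H. \<forall>b\<in>hcar H. counit H (hmul H a b) = counit H a * counit H b) \<and>
    linear_on (hcar H) (hcar H) (antipode H) \<and>
    (\<forall>a\<in>hcar H.
      tlift (hcar H) (hcar H) (\<lambda>b c. hmul H (antipode H b) c) (comul H a) = counit H a \<cdot> hone H \<and>
      tlift (hcar H) (hcar H) (\<lambda>b c. hmul H b (antipode H c)) (comul H a) = counit H a \<cdot> hone H)"

definition H_module :: "('b, 'k::field) hopf \<Rightarrow> ('b \<Rightarrow> 'k, 'a, 'k) opmod \<Rightarrow> bool"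
  where "H_module H M \<longleftrightarrow> findim (mcar M) \<and>
    bilinear_on (hcar H) (mcar M) (mcar M) (mact M) \<and>
    (\<forall>v\<in>mcar M. mact M (hone H) v = v) \<and>
    (\<forall>a\<in>hcar H. \<forall>b\<in>hcar H. \<forall>v\<in>mcar M. mact M (hmul H a b) v = mact M a (mact M b v))"

text \<open>On \<open>M \<otimes> N\<close>, an element \<open>a\<close> with \<open>\<Delta>(a) = \<Sum> b \<otimes> c\<close> acts by \<open>u \<otimes> v \<mapsto> \<Sum> b u \<otimes> c v\<close>.\<close>

definition H_tensor ::
    "('b, 'k::field) hopf \<Rightarrow> ('b \<Rightarrow> 'k, 'a, 'k) opmod \<Rightarrow> ('b \<Rightarrow> 'k, 'c, 'k) opmod \<Rightarrow>
     ('b \<Rightarrow> 'k, 'a \<times> 'c, 'k) opmod"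
  where "H_tensor H M N = \<lparr>
    mcar = tensor_space (mcar M) (mcar N),
    mact = (\<lambda>a w. tlift (hcar H) (hcar H)
      (\<lambda>b c. tmap (mcar M) (mcar N) (mact M b) (mact N c) w) (comul H a))\<rparr>"


section \<open>The Hopf algebra of a group datum of non-nilpotent type\<close>

definition nonnilpotent_datum :: "('g, 'z) monoid_scheme \<Rightarrow> ('g \<Rightarrow> 'k::field) \<Rightarrow> 'g \<Rightarrow> nat \<Rightarrow> bool"
  where "nonnilpotent_datum G \<chi> g n \<longleftrightarrow>
    group G \<and> finite (carrier G) \<and>
    \<chi> \<one>\<^bsub>G\<^esub> = 1 \<and> (\<forall>h\<in>carrier G. \<forall>h'\<in>carrier G. \<chi> (h \<otimes>\<^bsub>G\<^esub> h') = \<chi> h * \<chi> h') \<and>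
    g \<in> carrier G \<and> (\<forall>h\<in>carrier G. g \<otimes>\<^bsub>G\<^esub> h = h \<otimes>\<^bsub>G\<^esub> g) \<and>
    n \<ge> 2 \<and> \<chi> g ^ n = 1 \<and> (\<forall>m. 0 < m \<and> m < n \<longrightarrow> \<chi> g ^ m \<noteq> 1) \<and>
    (\<forall>h\<in>carrier G. \<chi> h ^ n = 1) \<and> g [^]\<^bsub>G\<^esub> n \<noteq> \<one>\<^bsub>G\<^esub>"

text \<open>
  \<open>H\<close> is the Hopf algebra of the datum, with \<open>\<iota>\<close> the inclusion of \<open>G\<close> into \<open>H\<close>. That \<open>y\<close> and \<open>G\<close>
  generate \<open>H\<close> and that the listed relations are defining ones is expressed by the
  \<open>y\<^sup>i h\<close> with \<open>i < n\<close>, \<open>h \<in> G\<close> being a basis, since the relations allow every word in \<open>y\<close> and \<open>G\<close>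
  to be rewritten into a combination of these.
\<close>

definition datum_hopf_algebra ::
    "('g, 'z) monoid_scheme \<Rightarrow> ('g \<Rightarrow> 'k::field) \<Rightarrow> 'g \<Rightarrow> nat \<Rightarrow>
     ('b, 'k) hopf \<Rightarrow> ('g \<Rightarrow> 'b \<Rightarrow> 'k) \<Rightarrow> ('b \<Rightarrow> 'k) \<Rightarrow> bool"
  where "datum_hopf_algebra G \<chi> g n H \<iota> y \<longleftrightarrow> hopf_algebra H \<and>
    y \<in> hcar H \<and> (\<forall>h\<in>carrier G. \<iota> h \<in> hcar H) \<and>
    \<iota> \<one>\<^bsub>G\<^esub> = hone H \<and>
    (\<forall>h\<in>carrier G. \<forall>h'\<in>carrier G. \<iota> (h \<otimes>\<^bsub>G\<^esub> h') = hmul H (\<iota> h) (\<iota> h')) \<and>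
    hpow H y n = \<iota> (g [^]\<^bsub>G\<^esub> n) - hone H \<and>
    (\<forall>h\<in>carrier G. hmul H y (\<iota> h) = \<chi> h \<cdot> hmul H (\<iota> h) y) \<and>
    (let e = (\<lambda>(i, h). hmul H (hpow H y i) (\<iota> h)); I = {..<n} \<times> carrier G in
      inj_on e I \<and> fs.independent (e ` I) \<and> fs.span (e ` I) = hcar H) \<and>
    comul H y = y \<boxtimes> \<iota> g + hone H \<boxtimes> y \<and>
    counit H y = 0 \<and>
    antipode H y = - hmul H y (\<iota> (inv\<^bsub>G\<^esub> g)) \<and>
    (\<forall>h\<in>carrier G. comul H (\<iota> h) = \<iota> h \<boxtimes> \<iota> h \<and> counit H (\<iota> h) = 1)"

definition g_scalar :: "('g, 'z) monoid_scheme \<Rightarrow> 'g \<Rightarrow> nat \<Rightarrow> ('g, 'a, 'k::field) opmod \<Rightarrow> 'k"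
  where "g_scalar G g n V = (THE c. \<forall>v\<in>mcar V. mact V (g [^]\<^bsub>G\<^esub> n) v = c \<cdot> v)"

definition Omega0 ::
    "('g, 'z) monoid_scheme \<Rightarrow> 'g \<Rightarrow> nat \<Rightarrow> 'i set \<Rightarrow> ('i \<Rightarrow> ('g, 'a, 'k::field) opmod) \<Rightarrow> 'i set"
  where "Omega0 G g n \<Omega> V = {i \<in> \<Omega>. g_scalar G g n (V i) = 1}"

definition Omega1 ::
    "('g, 'z) monoid_scheme \<Rightarrow> 'g \<Rightarrow> nat \<Rightarrow> 'i set \<Rightarrow> ('i \<Rightarrow> ('g, 'a, 'k::field) opmod) \<Rightarrow> 'i set"
  where "Omega1 G g n \<Omega> V = {i \<in> \<Omega>. g_scalar G g n (V i) \<noteq> 1}"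

definition chi_inv_module :: "('g \<Rightarrow> 'k::field) \<Rightarrow> ('g, unit, 'k) opmod"
  where "chi_inv_module \<chi> = \<lparr>mcar = UNIV, mact = (\<lambda>h v. inverse (\<chi> h) \<cdot> v)\<rparr>"

definition tau ::
    "('g, 'z) monoid_scheme \<Rightarrow> ('g \<Rightarrow> 'k::field) \<Rightarrow> 'i set \<Rightarrow> ('i \<Rightarrow> ('g, 'a, 'k) opmod) \<Rightarrow> 'i \<Rightarrow> 'i"
  where "tau G \<chi> \<Omega> V s =
    (THE t. t \<in> \<Omega> \<and> mod_iso (carrier G) (G_tensor (chi_inv_module \<chi>) (V s)) (V t))"

text \<open>\<open>x\<^sup>kV\<close>, with \<open>x\<^sup>kv\<close> represented by \<open>v\<close>.\<close>

definition x_twist :: "('g \<Rightarrow> 'k::field) \<Rightarrow> ('g, 'a, 'k) opmod \<Rightarrow> nat \<Rightarrow> ('g, 'a, 'k) opmod"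
  where "x_twist \<chi> V k = \<lparr>mcar = mcar V, mact = (\<lambda>h v. inverse (\<chi> h) ^ k \<cdot> mact V h v)\<rparr>"

text \<open>
  The operator on \<open>V \<oplus> xV \<oplus> \<dots> \<oplus> x\<^sup>k\<^sup>-\<^sup>1V\<close> with \<open>x\<^sup>sv \<mapsto> x\<^sup>s\<^sup>+\<^sup>1v\<close> for \<open>s + 2 \<le> k\<close> and \<open>x\<^sup>k\<^sup>-\<^sup>1v \<mapsto> c v\<close>.
\<close>

definition x_shift :: "nat \<Rightarrow> 'k::field \<Rightarrow> (nat \<times> 'a \<Rightarrow> 'k) \<Rightarrow> (nat \<times> 'a \<Rightarrow> 'k)"
  where "x_shift k c f = (\<lambda>(s, a).
    if s = 0 then c * f (k - 1, a) else if s < k then f (s - 1, a) else 0)"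

text \<open>
  The \<open>H\<close>-module on the \<open>G\<close>-module \<open>N\<close> in which \<open>y\<close> acts by \<open>Y\<close>; it is unique since \<open>G\<close> and \<open>y\<close>
  generate \<open>H\<close>.
\<close>

definition H_module_of ::
    "('g, 'z) monoid_scheme \<Rightarrow> ('b, 'k::field) hopf \<Rightarrow> ('g \<Rightarrow> 'b \<Rightarrow> 'k) \<Rightarrow> ('b \<Rightarrow> 'k) \<Rightarrow>
     ('g, 'a, 'k) opmod \<Rightarrow> (('a \<Rightarrow> 'k) \<Rightarrow> ('a \<Rightarrow> 'k)) \<Rightarrow> ('b \<Rightarrow> 'k, 'a, 'k) opmod"
  where "H_module_of G H \<iota> y N Y = (SOME M. H_module H M \<and> mcar M = mcar N \<and>
    (\<forall>h\<in>carrier G. \<forall>v\<in>mcar N. mact M (\<iota> h) v = mact N h v) \<and>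
    (\<forall>v\<in>mcar N. mact M y v = Y v))"

definition M_module ::
    "('g, 'z) monoid_scheme \<Rightarrow> ('g \<Rightarrow> 'k::field) \<Rightarrow> ('b, 'k) hopf \<Rightarrow> ('g \<Rightarrow> 'b \<Rightarrow> 'k) \<Rightarrow>
     ('b \<Rightarrow> 'k) \<Rightarrow> nat \<Rightarrow> ('g, 'a, 'k) opmod \<Rightarrow> ('b \<Rightarrow> 'k, nat \<times> 'a, 'k) opmod"
  where "M_module G \<chi> H \<iota> y k V = H_module_of G H \<iota> y (dsum {..<k} (x_twist \<chi> V)) (x_shift k 0)"

definition P_module ::
    "('g, 'z) monoid_scheme \<Rightarrow> ('g \<Rightarrow> 'k::field) \<Rightarrow> 'g \<Rightarrow> nat \<Rightarrow> ('b, 'k) hopf \<Rightarrow> ('g \<Rightarrow> 'b \<Rightarrow> 'k) \<Rightarrow>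
     ('b \<Rightarrow> 'k) \<Rightarrow> ('g, 'a, 'k) opmod \<Rightarrow> ('b \<Rightarrow> 'k, nat \<times> 'a, 'k) opmod"
  where "P_module G \<chi> g n H \<iota> y V = H_module_of G H \<iota> y (dsum {..<n} (x_twist \<chi> V))
    (x_shift n (g_scalar G g n V - 1))"

end

theory Submission
  imports Defs
begin

text \<open>
  Let \<open>W = P\<^sub>i \<otimes> P\<^sub>j\<close> and let \<open>U = P\<^sub>i \<otimes> x\<^sup>0V\<^sub>j\<close>, a \<open>G\<close>-submodule of \<open>W\<close>. By \<open>\<Delta>(y) = y \<otimes> g + 1 \<otimes> y\<close>, the
  action of \<open>y\<close> raises the power of \<open>x\<close> in the second factor by one, up to terms in which this power
  does not change. Hence the component of \<open>y\<^sup>k u\<close> in \<open>P\<^sub>i \<otimes> x\<^sup>kV\<^sub>j\<close> is a copy of \<open>u\<close> and the higher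
  components vanish, so that \<open>W = U \<oplus> yU \<oplus> \<dots> \<oplus> y\<^sup>n\<^sup>-\<^sup>1U\<close> with \<open>y\<close> injective on \<open>y\<^sup>kU\<close> for \<open>k < n - 1\<close>.
  As \<open>g\<^sup>n\<close> acts on \<open>W\<close> by \<open>\<mu> = \<lambda>\<^sub>i\<lambda>\<^sub>j\<close>, on \<open>W\<close> we have \<open>y\<^sup>n = \<mu> - 1\<close>. A decomposition of the
  \<open>G\<close>-module \<open>U \<cong> \<Oplus>\<^sub>t \<chi>\<^sup>-\<^sup>t \<otimes> V\<^sub>i \<otimes> V\<^sub>j\<close> into simple modules therefore determines \<open>W\<close>; both cases of
  the proposition are instances of this, since \<open>M(n,s)\<close> has the same definition as \<open>P\<^sub>s\<close>,
  with \<open>1\<close> in place of \<open>\<lambda>\<^sub>s\<close>.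
\<close>

section \<open>Linear maps on subspaces and tensor spaces\<close>

text \<open>The value \<mu> - 1 of y^n on W is read off from the relation y^n = g^n - 1 of H, once W
  is known to be an H-module, instead of from an expansion of (y \<otimes> g + 1 \<otimes> y)^n.
  What remains is a block triangularity that is the same for every \<mu>. The powers of x in the two
  factors play different roles: those in P_i become the twists by \<chi>^{-t}, hence the indices
  \<tau>^t(s), while those in P_j become the y-chains of the summands. Since \<chi>(g^n) =
  \<chi>(g)^n = 1, a twist leaves the scalar of g^n unchanged, so \<lambda> is constant along
  \<tau>-orbits and all summands close up with the same factor. The condition \<chi>^n = 1 makes the
  wrap from x^{n-1}V to V compatible with G. The modules and the tensor product action are specified
  by choice operators, so nothing can be computed before existence is shown: by the universal
  property of the tensor space, and by letting the basis y^i h act through given operators for y and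
  G. Characteristic zero enters through averaging over G, algebraic closure through the existence of
  the scalars \<lambda>_s.\<close>

lemma linear_onD:
  assumes "linear_on V W f"
  shows "v \<in> V \<Longrightarrow> f v \<in> W" "u \<in> V \<Longrightarrow> v \<in> V \<Longrightarrow> f (u + v) = f u + f v"
    "v \<in> V \<Longrightarrow> f (c \<cdot> v) = c \<cdot> f v"
  using assms by (auto simp: linear_on_def)

lemma linear_on_zero:
  assumes "linear_on V W f" "fs.subspace V"
  shows "f 0 = 0"
  using linear_on_sum[OF assms, of "{}"] by simp

lemma linear_on_minus:
  assumes "linear_on V W f" "v \<in> V"
  shows "f (- v) = - f v"
  using linear_onD(3)[OF assms, of "- 1"] by simp

lemma linear_on_diff:
  assumes "linear_on V W f" "fs.subspace V" "u \<in> V" "v \<in> V"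
  shows "f (u - v) = f u - f v"
  using linear_onD(2)[OF assms(1,3), of "- v"] linear_on_minus[OF assms(1,4)]
    fs.subspace_neg[OF assms(2,4)] by simp

lemma linear_on_sum':
  assumes "linear_on V W f" "fs.subspace V" "\<And>i. i \<in> I \<Longrightarrow> v i \<in> V"
  shows "f (\<Sum>i\<in>I. v i) = (\<Sum>i\<in>I. f (v i))"
  using linear_on_sum[OF assms, where k = "\<lambda>_. 1"] by simp

lemma linear_on_compose:
  "linear_on U V f \<Longrightarrow> linear_on V W g \<Longrightarrow> linear_on U W (\<lambda>u. g (f u))"
  by (simp add: linear_on_def)

lemma linear_on_mono:
  "linear_on V W f \<Longrightarrow> V' \<subseteq> V \<Longrightarrow> W \<subseteq> W' \<Longrightarrow> linear_on V' W' f"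
  by (auto simp: linear_on_def subset_iff)

lemma linear_on_id: "linear_on V V (\<lambda>v. v)"
  by (simp add: linear_on_def)

lemma linear_on_add:
  assumes "linear_on V W f" "linear_on V W g" "fs.subspace W"
  shows "linear_on V W (\<lambda>v. f v + g v)"
  using assms by (auto simp: linear_on_def fs.subspace_add fs.scale_right_distrib)

lemma linear_on_scale:
  assumes "linear_on V W f" "fs.subspace W"
  shows "linear_on V W (\<lambda>v. c \<cdot> f v)"
  using assms
  by (auto simp: linear_on_def fs.subspace_scale fs.scale_right_distrib fs.scale_left_commute)

lemma linear_on_minus_fun:
  assumes "linear_on V W f" "linear_on V W g" "fs.subspace W"
  shows "linear_on V W (\<lambda>v. f v - g v)"
  using assms by (auto simp: linear_on_def fs.subspace_diff fs.scale_right_diff_distrib)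

lemma linear_on_sum_fun:
  assumes "\<And>i. i \<in> I \<Longrightarrow> linear_on V W (f i)" "fs.subspace W"
  shows "linear_on V W (\<lambda>v. \<Sum>i\<in>I. f i v)"
  using assms
  by (auto simp: linear_on_def fs.subspace_sum fs.scale_sum_right sum.distrib[symmetric]
      intro!: sum.cong)

lemma linear_on_funpow:
  assumes "linear_on V V f"
  shows "linear_on V V (f ^^ k)"
proof (induction k)
  case 0
  then show ?case by (simp add: linear_on_def)
next
  case (Suc k)
  then show ?case using assms by (simp add: linear_on_def)
qed

lemma linear_on_inv_into:
  assumes f: "linear_on V W f" "bij_betw f V W" and V: "fs.subspace V"
  shows "linear_on W V (inv_into V f)"
proof -
  have i: "inv_into V f w \<in> V" "f (inv_into V f w) = w" if "w \<in> W" for w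
    using that f(2) by (auto simp: bij_betw_def inv_into_into f_inv_into_f)
  have e: "inv_into V f w = v" if "v \<in> V" "f v = w" for v w
    using that f(2) by (auto simp: bij_betw_def)
  show ?thesis
    unfolding linear_on_def
    by (auto simp: i linear_onD[OF f(1)] intro!: e fs.subspace_add[OF V] fs.subspace_scale[OF V])
qed

lemma subspace_kernel_on:
  assumes "linear_on V W f" "fs.subspace V"
  shows "fs.subspace {v \<in> V. f v = 0}"
  using assms linear_on_zero[OF assms]
  by (auto simp: fs.subspace_def linear_onD[OF assms(1)])

lemma subspace_image_on:
  assumes "linear_on V W f" "fs.subspace V"
  shows "fs.subspace (f ` V)"
  unfolding fs.subspace_def
proof (intro conjI ballI allI)
  show "0 \<in> f ` V" using linear_on_zero[OF assms] fs.subspace_0[OF assms(2)] by (metis imageI)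
next
  fix x z assume "x \<in> f ` V" "z \<in> f ` V"
  then show "x + z \<in> f ` V"
    using linear_onD(2)[OF assms(1)] fs.subspace_add[OF assms(2)] by (auto simp: image_iff) metis
next
  fix c x assume "x \<in> f ` V"
  then show "c \<cdot> x \<in> f ` V"
    using linear_onD(3)[OF assms(1)] fs.subspace_scale[OF assms(2)] by (auto simp: image_iff) metis
qed

lemma subspace_vimage_on:
  assumes "linear_on V W f" "fs.subspace V" "fs.subspace U"
  shows "fs.subspace {v \<in> V. f v \<in> U}"
  using assms(2,3) linear_on_zero[OF assms(1,2)]
  by (auto simp: fs.subspace_def linear_onD[OF assms(1)])

lemma span_image_on:
  assumes f: "linear_on V W f" and V: "fs.subspace V" and B: "fs.span B = V"
  shows "fs.span (f ` B) = f ` V"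
proof
  have BV: "B \<subseteq> V" using B fs.span_superset by blast
  show "fs.span (f ` B) \<subseteq> f ` V"
    using BV by (intro fs.span_minimal subspace_image_on[OF f V] image_mono)
  have "V \<subseteq> {v \<in> V. f v \<in> fs.span (f ` B)}"
    unfolding B[symmetric]
    by (rule fs.span_minimal) (use subspace_vimage_on[OF f V, of "fs.span (f ` B)"] BV B
        in \<open>auto intro: fs.span_base\<close>)
  then show "f ` V \<subseteq> fs.span (f ` B)" by auto
qed

lemma findim_image:
  assumes f: "linear_on V W f" and V: "findim V"
  shows "findim (f ` V)"
proof -
  obtain B where "finite B" "fs.span B = V" "fs.subspace V" using V by (auto simp: findim_def)
  then show ?thesis
    unfolding findim_def using span_image_on[OF f] subspace_image_on[OF f] by blast
qed

lemma inj_on_linear_on: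
  assumes f: "linear_on V W f" and V: "fs.subspace V"
    and ker: "\<And>v. v \<in> V \<Longrightarrow> f v = 0 \<Longrightarrow> v = 0"
  shows "inj_on f V"
proof (rule inj_onI)
  fix u v assume "u \<in> V" "v \<in> V" "f u = f v"
  then have "u - v = 0"
    by (intro ker) (simp_all add: linear_on_diff[OF f V] fs.subspace_diff[OF V])
  then show "u = v" by simp
qed

section \<open>Maps out of tensor spaces and their reduction to pure tensors\<close>

lemma subspace_tensor_space: "fs.subspace (tensor_space U V)"
  by (simp add: tensor_space_def)

lemma vtensor_in: "u \<in> U \<Longrightarrow> v \<in> V \<Longrightarrow> u \<boxtimes> v \<in> tensor_space U V"
  unfolding tensor_space_def by (rule fs.span_base) blast

lemma tensor_space_subset:
  assumes "fs.subspace W" "\<And>u v. u \<in> U \<Longrightarrow> v \<in> V \<Longrightarrow> u \<boxtimes> v \<in> W"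
  shows "tensor_space U V \<subseteq> W"
  unfolding tensor_space_def using assms by (intro fs.span_minimal) auto

text \<open>The elements sent into \<open>W\<close> form a subspace, so pure tensors decide. This
  narrows the codomain \<open>UNIV\<close> that the universal property delivers.\<close>

lemma tensor_map_in:
  assumes f: "linear_on (tensor_space U V) UNIV f" and W: "fs.subspace W"
    and p: "\<And>u v. u \<in> U \<Longrightarrow> v \<in> V \<Longrightarrow> f (u \<boxtimes> v) \<in> W"
  shows "linear_on (tensor_space U V) W f"
proof -
  have "tensor_space U V \<subseteq> {w \<in> tensor_space U V. f w \<in> W}"
    by (rule tensor_space_subset)
      (use subspace_vimage_on[OF f subspace_tensor_space W] p in \<open>auto simp: vtensor_in\<close>)
  then show ?thesis using f by (auto simp: linear_on_def)
qed

text \<open>The difference of the two maps sends pure tensors to 0 and therefore vanishes. The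
  codomains may differ, so that a map with a known range can be compared with a formula into
  \<open>UNIV\<close>.\<close>

lemma tensor_ext:
  assumes f: "linear_on (tensor_space U V) W f" and g: "linear_on (tensor_space U V) W' g"
    and p: "\<And>u v. u \<in> U \<Longrightarrow> v \<in> V \<Longrightarrow> f (u \<boxtimes> v) = g (u \<boxtimes> v)"
    and w: "w \<in> tensor_space U V"
  shows "f w = g w"
proof -
  have fg: "linear_on (tensor_space U V) UNIV (\<lambda>w. f w - g w)"
    by (intro linear_on_minus_fun linear_on_mono[OF f] linear_on_mono[OF g]) auto
  have "linear_on (tensor_space U V) {0} (\<lambda>w. f w - g w)"
    by (rule tensor_map_in[OF fg]) (auto simp: p)
  then show ?thesis using w by (auto simp: linear_on_def)
qed

text \<open>\<open>tlift\<close> is a choice, and the universal property makes it meaningful; the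
  codomain \<open>W\<close> then follows from the values on pure tensors.\<close>

lemma tlift_props:
  assumes U: "fs.subspace U" and V: "fs.subspace V" and b: "bilinear_on U V W b"
    and W: "fs.subspace W"
  shows linear_on_tlift: "linear_on (tensor_space U V) W (tlift U V b)"
    and tlift_vtensor: "u \<in> U \<Longrightarrow> v \<in> V \<Longrightarrow> tlift U V b (u \<boxtimes> v) = b u v"
proof -
  have b': "bilinear_on U V UNIV b"
    using b by (auto simp: bilinear_on_def linear_on_def)
  have s: "linear_on (tensor_space U V) UNIV (tlift U V b) \<and>
    (\<forall>u\<in>U. \<forall>v\<in>V. tlift U V b (u \<boxtimes> v) = b u v)"
    unfolding tlift_def by (rule someI_ex[OF tensor_universal[OF U V b']])
  then show "u \<in> U \<Longrightarrow> v \<in> V \<Longrightarrow> tlift U V b (u \<boxtimes> v) = b u v" by blast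
  show "linear_on (tensor_space U V) W (tlift U V b)"
    by (rule tensor_map_in) (use s b W in \<open>auto simp: bilinear_on_def linear_on_def\<close>)
qed

lemma bilinear_on_vtensor:
  assumes "linear_on U U' A" "linear_on V V' B"
  shows "bilinear_on U V (tensor_space U' V') (\<lambda>u v. A u \<boxtimes> B v)"
  using assms
  by (auto simp: bilinear_on_def linear_on_def vtensor_in vtensor_add_left vtensor_add_right
      vtensor_scale_left vtensor_scale_right)

lemma tmap_props:
  assumes U: "fs.subspace U" and V: "fs.subspace V"
    and A: "linear_on U U' A" and B: "linear_on V V' B"
  shows linear_on_tmap: "linear_on (tensor_space U V) (tensor_space U' V') (tmap U V A B)"
    and tmap_vtensor: "u \<in> U \<Longrightarrow> v \<in> V \<Longrightarrow> tmap U V A B (u \<boxtimes> v) = A u \<boxtimes> B v"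
  unfolding tmap_def
  using tlift_props[OF U V bilinear_on_vtensor[OF A B] subspace_tensor_space] by auto

text \<open>The tensors of two finite spanning sets span: membership is extended linearly in the
  right slot for a fixed spanning vector on the left, and then in the left slot.\<close>

lemma findim_tensor_space:
  assumes "findim U" "findim V"
  shows "findim (tensor_space U V)"
proof -
  obtain B C where B: "finite B" "fs.span B = U" "fs.subspace U"
    and C: "finite C" "fs.span C = V" "fs.subspace V"
    using assms by (auto simp: findim_def)
  let ?X = "(\<lambda>(b, c). b \<boxtimes> c) ` (B \<times> C)"
  have l: "linear_on V UNIV (\<lambda>v. u \<boxtimes> v)" for u :: "'a \<Rightarrow> 'b" and V :: "('c \<Rightarrow> 'b) set"
    by (simp add: linear_on_def vtensor_add_right vtensor_scale_right)
  have r: "linear_on U UNIV (\<lambda>u. u \<boxtimes> v)" for v :: "'c \<Rightarrow> 'b" and U :: "('a \<Rightarrow> 'b) set"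
    by (simp add: linear_on_def vtensor_add_left vtensor_scale_left)
  have "V \<subseteq> {v \<in> UNIV. b \<boxtimes> v \<in> fs.span ?X}" if "b \<in> B" for b
    unfolding C(2)[symmetric]
    by (rule fs.span_minimal[OF _ subspace_vimage_on[OF l]])
      (use that in \<open>auto intro!: fs.span_base\<close>)
  then have "U \<subseteq> {u \<in> UNIV. u \<boxtimes> v \<in> fs.span ?X}" if "v \<in> V" for v
    unfolding B(2)[symmetric]
    by (intro fs.span_minimal[OF _ subspace_vimage_on[OF r]])
      (use that in auto)
  then have "tensor_space U V \<subseteq> fs.span ?X"
    by (intro tensor_space_subset) auto
  moreover have "fs.span ?X \<subseteq> tensor_space U V"
    using fs.span_superset[of B] fs.span_superset[of C] B C
    by (intro fs.span_minimal subspace_tensor_space) (auto intro!: vtensor_in)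
  ultimately show ?thesis
    unfolding findim_def using B(1) C(1) subspace_tensor_space
    by (metis finite_SigmaI finite_imageI subset_antisym)
qed

section \<open>Modules over a Hopf algebra\<close>

text \<open>Modules without the finiteness condition.\<close>

definition alg_module :: "('b, 'k::field) hopf \<Rightarrow> ('b \<Rightarrow> 'k, 'a, 'k) opmod \<Rightarrow> bool"
  where "alg_module H M \<longleftrightarrow> fs.subspace (mcar M) \<and>
    bilinear_on (hcar H) (mcar M) (mcar M) (mact M) \<and>
    (\<forall>v\<in>mcar M. mact M (hone H) v = v) \<and>
    (\<forall>a\<in>hcar H. \<forall>b\<in>hcar H. \<forall>v\<in>mcar M. mact M (hmul H a b) v = mact M a (mact M b v))"

lemma H_module_iff: "H_module H M \<longleftrightarrow> findim (mcar M) \<and> alg_module H M"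
  by (auto simp: H_module_def alg_module_def findim_def)

lemma alg_moduleD:
  assumes "alg_module H M"
  shows "fs.subspace (mcar M)"
    "a \<in> hcar H \<Longrightarrow> linear_on (mcar M) (mcar M) (mact M a)"
    "v \<in> mcar M \<Longrightarrow> linear_on (hcar H) (mcar M) (\<lambda>a. mact M a v)"
    "v \<in> mcar M \<Longrightarrow> mact M (hone H) v = v"
    "a \<in> hcar H \<Longrightarrow> b \<in> hcar H \<Longrightarrow> v \<in> mcar M \<Longrightarrow>
      mact M (hmul H a b) v = mact M a (mact M b v)"
    "a \<in> hcar H \<Longrightarrow> v \<in> mcar M \<Longrightarrow> mact M a v \<in> mcar M"
  using assms by (auto simp: alg_module_def bilinear_on_def linear_on_def)

lemma algebraD:
  assumes "algebra_axioms H"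
  shows "fs.subspace (hcar H)" "hone H \<in> hcar H"
    "a \<in> hcar H \<Longrightarrow> linear_on (hcar H) (hcar H) (hmul H a)"
    "b \<in> hcar H \<Longrightarrow> linear_on (hcar H) (hcar H) (\<lambda>a. hmul H a b)"
    "a \<in> hcar H \<Longrightarrow> b \<in> hcar H \<Longrightarrow> hmul H a b \<in> hcar H"
    "a \<in> hcar H \<Longrightarrow> hmul H (hone H) a = a" "a \<in> hcar H \<Longrightarrow> hmul H a (hone H) = a"
    "a \<in> hcar H \<Longrightarrow> b \<in> hcar H \<Longrightarrow> c \<in> hcar H \<Longrightarrow>
      hmul H (hmul H a b) c = hmul H a (hmul H b c)"
  using assms by (auto simp: algebra_axioms_def bilinear_on_def linear_on_def)

text \<open>The action of the algebra H \<otimes> H on M \<otimes> N. Separating it from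
  \<open>comul\<close> allows the module axioms to be proved for arbitrary tensors \<open>s\<close>
  and then pulled back to H.\<close>

definition tensor_act ::
    "('b, 'k::field) hopf \<Rightarrow> ('b \<Rightarrow> 'k, 'a, 'k) opmod \<Rightarrow> ('b \<Rightarrow> 'k, 'c, 'k) opmod \<Rightarrow>
     ('b \<times> 'b \<Rightarrow> 'k) \<Rightarrow> ('a \<times> 'c \<Rightarrow> 'k) \<Rightarrow> ('a \<times> 'c \<Rightarrow> 'k)"
  where "tensor_act H M N s w =
    tlift (hcar H) (hcar H) (\<lambda>b c. tmap (mcar M) (mcar N) (mact M b) (mact N c) w) s"

context
  fixes H :: "('b, 'k::field) hopf"
    and M :: "('b \<Rightarrow> 'k, 'a, 'k) opmod" and N :: "('b \<Rightarrow> 'k, 'c, 'k) opmod"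
  assumes H: "algebra_axioms H" and M: "alg_module H M" and N: "alg_module H N"
begin

private abbreviation "MN \<equiv> tensor_space (mcar M) (mcar N)"
private abbreviation "HH \<equiv> tensor_space (hcar H) (hcar H)"

lemma module_tmap_props:
  assumes "b \<in> hcar H" "c \<in> hcar H"
  shows linear_on_module_tmap: "linear_on MN MN (tmap (mcar M) (mcar N) (mact M b) (mact N c))"
    and module_tmap_vtensor: "u \<in> mcar M \<Longrightarrow> v \<in> mcar N \<Longrightarrow>
      tmap (mcar M) (mcar N) (mact M b) (mact N c) (u \<boxtimes> v) = mact M b u \<boxtimes> mact N c v"
  using tmap_props[of "mcar M" "mcar N" "mcar M" "mact M b" "mcar N" "mact N c"]
    alg_moduleD[OF M] alg_moduleD[OF N] assms by auto

text \<open>This licenses the \<open>tlift\<close> in \<open>tensor_act\<close>. Linearity in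
  \<open>b\<close> and in \<open>c\<close> is an identity between linear maps in \<open>w\<close>,
  hence can be checked on pure tensors, where it is linearity of the actions on M and N.\<close>

lemma bilinear_on_module_tmap:
  assumes w: "w \<in> MN"
  shows "bilinear_on (hcar H) (hcar H) MN (\<lambda>b c. tmap (mcar M) (mcar N) (mact M b) (mact N c) w)"
proof -
  let ?t = "\<lambda>b c. tmap (mcar M) (mcar N) (mact M b) (mact N c)"
  note sub = algebraD(1)[OF H]
  note lin = linear_on_module_tmap and app = module_tmap_vtensor
  note st = subspace_tensor_space[of "mcar M" "mcar N"]
  have 1: "?t b (c + c') w = ?t b c w + ?t b c' w"
    if "b \<in> hcar H" "c \<in> hcar H" "c' \<in> hcar H" for b c c'
    by (rule tensor_ext[OF lin linear_on_add[OF lin lin] _ w])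
      (use that sub in \<open>auto simp: app fs.subspace_add vtensor_add_right st
        linear_onD(2)[OF alg_moduleD(3)[OF N]]\<close>)
  have 2: "?t (b + b') c w = ?t b c w + ?t b' c w"
    if "b \<in> hcar H" "b' \<in> hcar H" "c \<in> hcar H" for b b' c
    by (rule tensor_ext[OF lin linear_on_add[OF lin lin] _ w])
      (use that sub in \<open>auto simp: app fs.subspace_add vtensor_add_left st
        linear_onD(2)[OF alg_moduleD(3)[OF M]]\<close>)
  have 3: "?t b (x \<cdot> c) w = x \<cdot> ?t b c w"
    if "b \<in> hcar H" "c \<in> hcar H" for b c x
    by (rule tensor_ext[OF lin linear_on_scale[OF lin] _ w])
      (use that sub in \<open>auto simp: app fs.subspace_scale vtensor_scale_right st
        linear_onD(3)[OF alg_moduleD(3)[OF N]]\<close>)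
  have 4: "?t (x \<cdot> b) c w = x \<cdot> ?t b c w"
    if "b \<in> hcar H" "c \<in> hcar H" for b c x
    by (rule tensor_ext[OF lin linear_on_scale[OF lin] _ w])
      (use that sub in \<open>auto simp: app fs.subspace_scale vtensor_scale_left st
        linear_onD(3)[OF alg_moduleD(3)[OF M]]\<close>)
  show ?thesis
    unfolding bilinear_on_def linear_on_def
    by (auto simp: 1 2 3 4 linear_onD(1)[OF lin w])
qed

lemma linear_on_tensor_act: "w \<in> MN \<Longrightarrow> linear_on HH MN (\<lambda>s. tensor_act H M N s w)"
  unfolding tensor_act_def
  by (intro linear_on_tlift algebraD(1)[OF H] bilinear_on_module_tmap subspace_tensor_space)

lemma tensor_act_vtensor:
  assumes "b \<in> hcar H" "c \<in> hcar H" "w \<in> MN"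
  shows "tensor_act H M N (b \<boxtimes> c) w = tmap (mcar M) (mcar N) (mact M b) (mact N c) w"
  unfolding tensor_act_def
  by (rule tlift_vtensor[OF algebraD(1)[OF H] algebraD(1)[OF H]
        bilinear_on_module_tmap[OF assms(3)] subspace_tensor_space assms(1,2)])

lemma linear_on_tensor_act_right:
  assumes s: "s \<in> HH"
  shows "linear_on MN MN (tensor_act H M N s)"
proof -
  note la = linear_on_tensor_act and st = subspace_tensor_space[of "mcar M" "mcar N"]
  have 1: "tensor_act H M N s (w + w') = tensor_act H M N s w + tensor_act H M N s w'"
    if "w \<in> MN" "w' \<in> MN" for w w'
    by (rule tensor_ext[OF la linear_on_add[OF la la] _ s])
      (use that in \<open>auto simp: tensor_act_vtensor fs.subspace_add st
        linear_onD(2)[OF linear_on_module_tmap]\<close>)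
  have 2: "tensor_act H M N s (x \<cdot> w) = x \<cdot> tensor_act H M N s w" if "w \<in> MN" for w x
    by (rule tensor_ext[OF la linear_on_scale[OF la] _ s])
      (use that in \<open>auto simp: tensor_act_vtensor fs.subspace_scale st
        linear_onD(3)[OF linear_on_module_tmap]\<close>)
  show ?thesis
    using linear_onD(1)[OF la s] by (auto simp: linear_on_def 1 2)
qed

end

lemma alg_module_regular:
  assumes "algebra_axioms H"
  shows "alg_module H \<lparr>mcar = hcar H, mact = hmul H\<rparr>"
  using assms by (auto simp: algebra_axioms_def alg_module_def)

text \<open>The product of H \<otimes> H is its action on itself through the regular module, so
  linearity and values on pure tensors are inherited from \<open>tensor_act\<close>.\<close>

lemma tensor_mul_eq_tensor_act:
  "tensor_mul H s =
    tensor_act H \<lparr>mcar = hcar H, mact = hmul H\<rparr> \<lparr>mcar = hcar H, mact = hmul H\<rparr> s"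
  by (simp add: tensor_mul_def tensor_act_def fun_eq_iff)

text \<open>Both sides are linear in each of \<open>w\<close>, \<open>t\<close> and
  \<open>s\<close>. Passing to pure tensors in this order leaves the multiplicativity of the actions
  on M and N.\<close>

lemma tensor_act_mul:
  assumes H: "algebra_axioms H" and M: "alg_module H M" and N: "alg_module H N"
    and s: "s \<in> tensor_space (hcar H) (hcar H)" and t: "t \<in> tensor_space (hcar H) (hcar H)"
    and w: "w \<in> tensor_space (mcar M) (mcar N)"
  shows "tensor_act H M N (tensor_mul H s t) w = tensor_act H M N s (tensor_act H M N t w)"
proof -
  let ?R = "\<lparr>mcar = hcar H, mact = hmul H\<rparr>"
  let ?HH = "tensor_space (hcar H) (hcar H)" and ?MN = "tensor_space (mcar M) (mcar N)"
  note R = alg_module_regular[OF H]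
  note lR = linear_on_tensor_act[OF H R R, simplified, folded tensor_mul_eq_tensor_act]
  note lR' = linear_on_tensor_act_right[OF H R R, simplified, folded tensor_mul_eq_tensor_act]
  note aR = tensor_act_vtensor[OF H R R, simplified, folded tensor_mul_eq_tensor_act]
  note l = linear_on_tensor_act[OF H M N] and l' = linear_on_tensor_act_right[OF H M N]
  note a = tensor_act_vtensor[OF H M N]
  note tv = module_tmap_vtensor[OF H M N] and tvH = module_tmap_vtensor[OF H R R, simplified]
  note tw = linear_onD(1)[OF l'] and D = algebraD[OF H]
  have pure: "tensor_act H M N (tensor_mul H (b \<boxtimes> c) (d \<boxtimes> e)) w =
      tensor_act H M N (b \<boxtimes> c) (tensor_act H M N (d \<boxtimes> e) w)"
    if bc: "b \<in> hcar H" "c \<in> hcar H" "d \<in> hcar H" "e \<in> hcar H" for b c d e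
  proof -
    have "tensor_mul H (b \<boxtimes> c) (d \<boxtimes> e) = hmul H b d \<boxtimes> hmul H c e"
      using bc by (simp add: aR vtensor_in tvH)
    moreover have "tensor_act H M N (hmul H b d \<boxtimes> hmul H c e) w =
        tensor_act H M N (b \<boxtimes> c) (tensor_act H M N (d \<boxtimes> e) w)"
      by (rule tensor_ext[OF l' linear_on_compose[OF l' l'] _ w])
        (use bc in \<open>auto simp: vtensor_in D a tv alg_moduleD[OF M] alg_moduleD[OF N]\<close>)
    ultimately show ?thesis by simp
  qed
  have pure': "tensor_act H M N (tensor_mul H (b \<boxtimes> c) t) w =
      tensor_act H M N (b \<boxtimes> c) (tensor_act H M N t w)"
    if "b \<in> hcar H" "c \<in> hcar H" for b c
  proof -
    have bc: "b \<boxtimes> c \<in> ?HH" using that by (simp add: vtensor_in)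
    show ?thesis
      by (rule tensor_ext[OF linear_on_compose[OF lR'[OF bc] l[OF w]]
            linear_on_compose[OF l[OF w] l'[OF bc]] _ t])
        (use that pure in auto)
  qed
  show ?thesis
    by (rule tensor_ext[OF linear_on_compose[OF lR[OF t] l[OF w]] l[OF tw[OF t w]] _ s])
      (use pure' in auto)
qed

lemma mcar_H_tensor: "mcar (H_tensor H M N) = tensor_space (mcar M) (mcar N)"
  and mact_H_tensor: "mact (H_tensor H M N) a = tensor_act H M N (comul H a)"
  by (auto simp: H_tensor_def tensor_act_def fun_eq_iff)

text \<open>M \<otimes> N is the H \<otimes> H-module above pulled back along \<open>comul\<close>,
  which respects the unit and products.\<close>

lemma alg_module_H_tensor:
  assumes H: "hopf_algebra H" and M: "alg_module H M" and N: "alg_module H N"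
  shows "alg_module H (H_tensor H M N)"
proof -
  have A: "algebra_axioms H" using H by (simp add: hopf_algebra_def)
  have D: "linear_on (hcar H) (tensor_space (hcar H) (hcar H)) (comul H)"
    using H by (simp add: hopf_algebra_def coalgebra_axioms_def)
  have one: "tensor_act H M N (comul H (hone H)) w = w" if w: "w \<in> tensor_space (mcar M) (mcar N)" for w
  proof -
    have "tmap (mcar M) (mcar N) (mact M (hone H)) (mact N (hone H)) w = w"
      by (rule tensor_ext[OF linear_on_module_tmap[OF A M N] linear_on_id _ w])
        (auto simp: algebraD[OF A] module_tmap_vtensor[OF A M N] alg_moduleD[OF M] alg_moduleD[OF N])
    moreover have "comul H (hone H) = hone H \<boxtimes> hone H" using H by (simp add: hopf_algebra_def)
    ultimately show ?thesis
      by (simp add: tensor_act_vtensor[OF A M N] algebraD[OF A] w)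
  qed
  have mul: "comul H (hmul H a b) = tensor_mul H (comul H a) (comul H b)"
    if "a \<in> hcar H" "b \<in> hcar H" for a b
    using H that by (simp add: hopf_algebra_def)
  show ?thesis
    unfolding alg_module_def bilinear_on_def mcar_H_tensor mact_H_tensor
    using linear_on_tensor_act_right[OF A M N] linear_onD(1)[OF D]
      linear_on_compose[OF D linear_on_tensor_act[OF A M N]]
    by (auto simp: subspace_tensor_space one mul tensor_act_mul[OF A M N])
qed

section \<open>The algebra of a group datum\<close>

lemma G_moduleD:
  assumes "G_module G M"
  shows "findim (mcar M)" "fs.subspace (mcar M)"
    "h \<in> carrier G \<Longrightarrow> linear_on (mcar M) (mcar M) (mact M h)"
    "v \<in> mcar M \<Longrightarrow> mact M \<one>\<^bsub>G\<^esub> v = v"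
    "h \<in> carrier G \<Longrightarrow> h' \<in> carrier G \<Longrightarrow> v \<in> mcar M \<Longrightarrow>
      mact M (h \<otimes>\<^bsub>G\<^esub> h') v = mact M h (mact M h' v)"
    "h \<in> carrier G \<Longrightarrow> v \<in> mcar M \<Longrightarrow> mact M h v \<in> mcar M"
  using assms by (auto simp: G_module_def linear_on_def findim_def)

locale datum =
  fixes G :: "('g, 'z) monoid_scheme" (structure)
    and \<chi> :: "'g \<Rightarrow> 'k::field" and g :: 'g and n :: nat
    and H :: "('b, 'k) hopf" and \<iota> :: "'g \<Rightarrow> 'b \<Rightarrow> 'k" and y :: "'b \<Rightarrow> 'k"
  assumes datum: "nonnilpotent_datum G \<chi> g n"
    and hopf_datum: "datum_hopf_algebra G \<chi> g n H \<iota> y"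
begin

sublocale group G
  using datum by (simp add: nonnilpotent_datum_def)

lemma datum_simps:
  shows fin: "finite (carrier G)" and \<chi>_one: "\<chi> \<one> = 1"
    and \<chi>_mult: "h \<in> carrier G \<Longrightarrow> h' \<in> carrier G \<Longrightarrow> \<chi> (h \<otimes> h') = \<chi> h * \<chi> h'"
    and g_in [simp]: "g \<in> carrier G"
    and g_central: "h \<in> carrier G \<Longrightarrow> g \<otimes> h = h \<otimes> g"
    and n_gt_1: "1 < n" and \<chi>_pow_n: "h \<in> carrier G \<Longrightarrow> \<chi> h ^ n = 1"
  using datum by (auto simp: nonnilpotent_datum_def)

lemma hopf_datum_simps:
  shows hopf: "hopf_algebra H" and alg: "algebra_axioms H"
    and y_in [simp]: "y \<in> hcar H" and \<iota>_in [simp]: "h \<in> carrier G \<Longrightarrow> \<iota> h \<in> hcar H"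
    and \<iota>_one: "\<iota> \<one> = hone H"
    and \<iota>_mult: "h \<in> carrier G \<Longrightarrow> h' \<in> carrier G \<Longrightarrow> \<iota> (h \<otimes> h') = hmul H (\<iota> h) (\<iota> h')"
    and y_pow_n: "hpow H y n = \<iota> (g [^] n) - hone H"
    and y_\<iota>: "h \<in> carrier G \<Longrightarrow> hmul H y (\<iota> h) = \<chi> h \<cdot> hmul H (\<iota> h) y"
    and comul_y: "comul H y = y \<boxtimes> \<iota> g + hone H \<boxtimes> y"
    and comul_\<iota>: "h \<in> carrier G \<Longrightarrow> comul H (\<iota> h) = \<iota> h \<boxtimes> \<iota> h"
  using hopf_datum by (auto simp: datum_hopf_algebra_def hopf_algebra_def)

lemma \<chi>_nonzero: "h \<in> carrier G \<Longrightarrow> \<chi> h \<noteq> 0"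
  using \<chi>_pow_n[of h] n_gt_1 by (metis not_one_less_zero power_0_left zero_neq_one)

text \<open>Defined for every exponent although only exponents below n belong to the basis:
  multiplication by y is then always a shift of the index, and the relation for y^n is applied
  separately when exponent n is reached.\<close>

definition pbw :: "nat \<times> 'g \<Rightarrow> 'b \<Rightarrow> 'k"
  where "pbw = (\<lambda>(i, h). hmul H (hpow H y i) (\<iota> h))"

definition pbw_index :: "(nat \<times> 'g) set"
  where "pbw_index = {..<n} \<times> carrier G"

lemma pbw_basis:
  shows inj_pbw: "inj_on pbw pbw_index" and independent_pbw: "fs.independent (pbw ` pbw_index)"
    and span_pbw: "fs.span (pbw ` pbw_index) = hcar H"
  using hopf_datum by (auto simp: datum_hopf_algebra_def pbw_def pbw_index_def Let_def)

lemma finite_pbw_index: "finite pbw_index"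
  by (simp add: pbw_index_def fin)

lemma hpow_0: "hpow H a 0 = hone H" and hpow_Suc: "hpow H a (Suc i) = hmul H a (hpow H a i)"
  by (simp_all add: hpow_def)

lemma hpow_in [simp]: "a \<in> hcar H \<Longrightarrow> hpow H a i \<in> hcar H"
  by (induction i) (auto simp: hpow_0 hpow_Suc algebraD[OF alg])

lemma pbw_in: "p \<in> pbw_index \<Longrightarrow> pbw p \<in> hcar H"
  by (auto simp: pbw_def pbw_index_def algebraD[OF alg])

text \<open>The form in which y and G are used as generators of H: each basis element is a product
  of them, and closure under sums and multiples carries \<open>P\<close> to the span.\<close>

lemma hcar_induct:
  assumes "a \<in> hcar H"
    and "\<And>a b. a \<in> hcar H \<Longrightarrow> b \<in> hcar H \<Longrightarrow> P a \<Longrightarrow> P b \<Longrightarrow> P (a + b)"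
    and scale: "\<And>c a. a \<in> hcar H \<Longrightarrow> P a \<Longrightarrow> P (c \<cdot> a)"
    and mul: "\<And>a b. a \<in> hcar H \<Longrightarrow> b \<in> hcar H \<Longrightarrow> P a \<Longrightarrow> P b \<Longrightarrow> P (hmul H a b)"
    and "P y" and \<iota>: "\<And>h. h \<in> carrier G \<Longrightarrow> P (\<iota> h)"
  shows "P a"
proof -
  have "P 0" using scale[of y 0] \<open>P y\<close> by simp
  then have "fs.subspace {a \<in> hcar H. P a}"
    using assms algebraD(1)[OF alg] by (auto simp: fs.subspace_def)
  moreover have "P (hpow H y i)" for i
    using \<iota>[of \<one>] by (induction i) (auto simp: hpow_0 hpow_Suc \<iota>_one assms)
  then have "pbw ` pbw_index \<subseteq> {a \<in> hcar H. P a}"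
    by (auto simp: pbw_in) (auto simp: pbw_def pbw_index_def intro!: mul \<iota>)
  ultimately have "hcar H \<subseteq> {a \<in> hcar H. P a}"
    unfolding span_pbw[symmetric] by (intro fs.span_minimal)
  with assms(1) show ?thesis by blast
qed

lemma pbw_ext:
  assumes f: "linear_on (hcar H) W f" and f': "linear_on (hcar H) W' f'"
    and eq: "\<And>p. p \<in> pbw_index \<Longrightarrow> f (pbw p) = f' (pbw p)"
    and a: "a \<in> hcar H"
  shows "f a = f' a"
proof -
  have "fs.subspace {a \<in> hcar H. f a = f' a}"
    using algebraD(1)[OF alg] linear_on_zero[OF f] linear_on_zero[OF f']
    by (auto simp: fs.subspace_def linear_onD[OF f] linear_onD[OF f'])
  then have "hcar H \<subseteq> {a \<in> hcar H. f a = f' a}"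
    by (subst span_pbw[symmetric], intro fs.span_minimal) (auto simp: pbw_in eq)
  with a show ?thesis by blast
qed

text \<open>The elements of H whose action \<open>f\<close> intertwines are closed under the algebra
  operations, so the generators suffice.\<close>

lemma mod_iso_generators:
  assumes M: "alg_module H M" and N: "alg_module H N"
    and f: "linear_on (mcar M) (mcar N) f" "bij_betw f (mcar M) (mcar N)"
    and fh: "\<And>h v. h \<in> carrier G \<Longrightarrow> v \<in> mcar M \<Longrightarrow> f (mact M (\<iota> h) v) = mact N (\<iota> h) (f v)"
    and fy: "\<And>v. v \<in> mcar M \<Longrightarrow> f (mact M y v) = mact N y (f v)"
  shows "mod_iso (hcar H) M N"
proof -
  have "\<forall>v\<in>mcar M. f (mact M a v) = mact N a (f v)" if "a \<in> hcar H" for a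
    using that
    by (rule hcar_induct[where P = "\<lambda>a. \<forall>v\<in>mcar M. f (mact M a v) = mact N a (f v)"])
      (use linear_onD[OF f(1)] linear_onD[OF alg_moduleD(3)[OF M]] linear_onD[OF alg_moduleD(3)[OF N]]
       in \<open>auto simp: fh fy alg_moduleD[OF M] alg_moduleD[OF N]\<close>)
  then show ?thesis using f by (auto simp: mod_iso_def)
qed

text \<open>Each passage of h across a y costs a factor \<chi>(h)^{-1}. This is the origin of the
  twist on x^kV and on y^kU.\<close>

lemma \<iota>_hpow_y:
  assumes h: "h \<in> carrier G"
  shows "hmul H (\<iota> h) (hpow H y i) = inverse (\<chi> h) ^ i \<cdot> hmul H (hpow H y i) (\<iota> h)"
proof (induction i)
  case 0
  then show ?case using h by (simp add: hpow_0 algebraD[OF alg])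
next
  case (Suc i)
  note mh = linear_onD[OF algebraD(3)[OF alg]] and mh' = linear_onD[OF algebraD(4)[OF alg]]
  have c: "hmul H (\<iota> h) y = inverse (\<chi> h) \<cdot> hmul H y (\<iota> h)"
    using \<chi>_nonzero[OF h] by (simp add: y_\<iota>[OF h])
  have "hmul H (\<iota> h) (hpow H y (Suc i)) = hmul H (hmul H (\<iota> h) y) (hpow H y i)"
    using h by (simp add: hpow_Suc algebraD[OF alg])
  also have "\<dots> = inverse (\<chi> h) \<cdot> hmul H y (hmul H (\<iota> h) (hpow H y i))"
    using h by (simp add: c mh' algebraD[OF alg])
  also have "\<dots> = inverse (\<chi> h) ^ Suc i \<cdot> hmul H (hpow H y (Suc i)) (\<iota> h)"
    using h by (simp add: Suc mh hpow_Suc algebraD[OF alg])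
  finally show ?case .
qed

lemma \<iota>_pbw:
  assumes "h \<in> carrier G" "h' \<in> carrier G"
  shows "hmul H (\<iota> h) (pbw (i, h')) = inverse (\<chi> h) ^ i \<cdot> pbw (i, h \<otimes> h')"
proof -
  have "hmul H (\<iota> h) (pbw (i, h')) = hmul H (hmul H (\<iota> h) (hpow H y i)) (\<iota> h')"
    using assms by (simp add: pbw_def algebraD[OF alg])
  then show ?thesis
    using assms
    by (simp add: \<iota>_hpow_y pbw_def \<iota>_mult algebraD[OF alg] linear_onD[OF algebraD(4)[OF alg]])
qed

lemma y_pbw:
  assumes "h \<in> carrier G"
  shows "hmul H y (pbw (i, h)) = pbw (Suc i, h)"
  using assms by (simp add: pbw_def algebraD[OF alg] hpow_Suc)

lemma pbw_n:
  assumes "h \<in> carrier G"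
  shows "pbw (n, h) = pbw (0, g [^] n \<otimes> h) - pbw (0, h)"
  using assms
  by (simp add: pbw_def y_pow_n hpow_0 algebraD[OF alg] \<iota>_mult
      linear_on_diff[OF algebraD(4)[OF alg] algebraD(1)[OF alg]])

text \<open>The hypotheses on \<open>Y\<close> are the relations of H, read as identities of
  operators on N. The basis element y^i h acts by h followed by \<open>Y ^^ i\<close>, extended
  linearly through coordinates. Multiplicativity is checked on basis elements for left factors y and
  h; all other left factors follow because these generate H.\<close>

lemma ex_H_module:
  fixes N :: "('g, 'a, 'k) opmod"
  assumes N: "G_module G N" and Y: "linear_on (mcar N) (mcar N) Y"
    and Yh: "\<And>h v. h \<in> carrier G \<Longrightarrow> v \<in> mcar N \<Longrightarrow> Y (mact N h v) = \<chi> h \<cdot> mact N h (Y v)"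
    and Yn: "\<And>v. v \<in> mcar N \<Longrightarrow> (Y ^^ n) v = mact N (g [^] n) v - v"
  shows "\<exists>M. H_module H M \<and> mcar M = mcar N \<and>
    (\<forall>h\<in>carrier G. \<forall>v\<in>mcar N. mact M (\<iota> h) v = mact N h v) \<and>
    (\<forall>v\<in>mcar N. mact M y v = Y v)"
proof -
  let ?R = "fs.representation (pbw ` pbw_index)"
  define act where "act a v = (\<Sum>p\<in>pbw_index. ?R a (pbw p) \<cdot> (Y ^^ fst p) (mact N (snd p) v))"
    for a v
  note ND = G_moduleD[OF N]
  have Yi: "linear_on (mcar N) (mcar N) (Y ^^ i)" for i by (rule linear_on_funpow[OF Y])
  have Yih: "(Y ^^ i) (mact N h v) = \<chi> h ^ i \<cdot> mact N h ((Y ^^ i) v)"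
    if "h \<in> carrier G" "v \<in> mcar N" for h v i
  proof (induction i)
    case (Suc i)
    then show ?case
      using that ND(6) linear_onD[OF Y] linear_onD[OF Yi[of i]] by (simp add: Yh)
  qed simp
  have lv: "linear_on (mcar N) (mcar N) (act a)" for a
    unfolding act_def[abs_def]
    by (intro linear_on_sum_fun linear_on_scale linear_on_compose[OF _ Yi] ND)
      (auto simp: pbw_index_def)
  have la: "linear_on (hcar H) (mcar N) (\<lambda>a. act a v)" if "v \<in> mcar N" for v
    unfolding linear_on_def using linear_onD(1)[OF lv that]
    by (auto simp: act_def fs.representation_add[OF independent_pbw] span_pbw
        fs.representation_scale[OF independent_pbw] fs.scale_left_distrib sum.distrib
        fs.scale_sum_right)
  have av: "act a v \<in> mcar N" if "v \<in> mcar N" for a v using linear_onD(1)[OF lv that] .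
  have ap: "act (pbw p) v = (Y ^^ fst p) (mact N (snd p) v)" if "p \<in> pbw_index" for p v
  proof -
    have "act (pbw p) v = (\<Sum>q\<in>pbw_index. (if q = p then 1 else 0) \<cdot> (Y ^^ fst q) (mact N (snd q) v))"
      unfolding act_def
      using fs.representation_basis[OF independent_pbw, of "pbw p"] that inj_onD[OF inj_pbw]
      by (intro sum.cong refl arg_cong2[where f = fscale]) auto
    also have "\<dots> = (\<Sum>q\<in>{p}. (if q = p then 1 else 0) \<cdot> (Y ^^ fst q) (mact N (snd q) v))"
      using that finite_pbw_index by (intro sum.mono_neutral_right) auto
    finally show ?thesis by simp
  qed
  have n0: "0 < n" using n_gt_1 by simp
  have ay: "act (hmul H y b) v = Y (act b v)" if b: "b \<in> hcar H" and v: "v \<in> mcar N" for b v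
  proof (rule pbw_ext[OF linear_on_compose[OF algebraD(3)[OF alg] la] linear_on_compose[OF la Y] _ b])
    fix p assume "p \<in> pbw_index"
    then obtain i h where p: "p = (i, h)" "i < n" "h \<in> carrier G" by (auto simp: pbw_index_def)
    show "act (hmul H y (pbw p)) v = Y (act (pbw p) v)"
    proof (cases "Suc i < n")
      case True
      then show ?thesis using p by (simp add: y_pbw ap pbw_index_def)
    next
      \<comment> \<open>Here i = n - 1, so multiplication by y leaves the basis. The relation y^n =
        g^n - 1 brings it back, and \<open>Yn\<close> says that the operators satisfy the same
        relation.\<close>
      case False
      then have i: "n = Suc i" using p by simp
      have "act (pbw (n, h)) v = mact N (g [^] n \<otimes> h) v - mact N h v"
        using p n0 v by (simp add: pbw_n linear_on_diff[OF la algebraD(1)[OF alg]] pbw_in pbw_index_def ap)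
      also have "\<dots> = (Y ^^ n) (mact N h v)"
        using p v by (simp add: Yn ND)
      also have "\<dots> = Y (act (pbw p) v)"
        using p by (simp add: ap pbw_index_def) (simp add: i)
      finally show ?thesis using p i by (simp add: y_pbw)
    qed
  qed (use v in auto)
  have ah: "act (hmul H (\<iota> h) b) v = mact N h (act b v)"
    if b: "b \<in> hcar H" and v: "v \<in> mcar N" and h: "h \<in> carrier G" for b v h
  proof (rule pbw_ext[OF linear_on_compose[OF algebraD(3)[OF alg] la] linear_on_compose[OF la ND(3)] _ b])
    fix p assume "p \<in> pbw_index"
    then obtain i h' where p: "p = (i, h')" "i < n" "h' \<in> carrier G" by (auto simp: pbw_index_def)
    have "act (hmul H (\<iota> h) (pbw p)) v = inverse (\<chi> h) ^ i \<cdot> (Y ^^ i) (mact N (h \<otimes> h') v)"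
      using p h v by (simp add: \<iota>_pbw linear_onD(3)[OF la] pbw_in ap pbw_index_def)
    \<comment> \<open>The factor \<chi>(h)^{-i} from moving h across y^i cancels the factor
      \<chi>(h)^i from moving \<open>Y ^^ i\<close> across the action of h.\<close>
    also have "\<dots> = mact N h ((Y ^^ i) (mact N h' v))"
      using p h v \<chi>_nonzero[OF h] by (simp add: ND Yih power_inverse)
    finally show "act (hmul H (\<iota> h) (pbw p)) v = mact N h (act (pbw p) v)"
      using p by (simp add: ap pbw_index_def)
  qed (use v h in auto)
  have a1: "act (hone H) v = v" if "v \<in> mcar N" for v
  proof -
    have "hone H = pbw (0, \<one>)" by (simp add: pbw_def hpow_0 \<iota>_one algebraD[OF alg])
    then show ?thesis using that n0 by (simp add: ap pbw_index_def ND)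
  qed
  have ay': "act y v = Y v" if "v \<in> mcar N" for v
    using ay[OF algebraD(2)[OF alg] that] by (simp add: a1 that algebraD[OF alg])
  have ah': "act (\<iota> h) v = mact N h v" if "v \<in> mcar N" "h \<in> carrier G" for v h
    using ah[OF algebraD(2)[OF alg] that] by (simp add: a1 that algebraD[OF alg])
  have mul: "\<forall>b\<in>hcar H. \<forall>v\<in>mcar N. act (hmul H a b) v = act a (act b v)" if "a \<in> hcar H" for a
    using that
    by (rule hcar_induct[where P = "\<lambda>a. \<forall>b\<in>hcar H. \<forall>v\<in>mcar N. act (hmul H a b) v = act a (act b v)"])
      (auto simp: linear_onD[OF la] av linear_onD[OF algebraD(4)[OF alg]] algebraD[OF alg]
      ay ay' ah ah')
  show ?thesis
    by (rule exI[of _ "\<lparr>mcar = mcar N, mact = act\<rparr>"])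
      (simp add: H_module_iff alg_module_def bilinear_on_def ND la lv mul a1 ay' ah')
qed

text \<open>\<open>H_module_of\<close> is a choice, so its intended properties are available only
  after the existence proof above.\<close>

lemma H_module_of_props:
  fixes N :: "('g, 'a, 'k) opmod"
  assumes "G_module G N" and "linear_on (mcar N) (mcar N) Y"
    and "\<And>h v. h \<in> carrier G \<Longrightarrow> v \<in> mcar N \<Longrightarrow> Y (mact N h v) = \<chi> h \<cdot> mact N h (Y v)"
    and "\<And>v. v \<in> mcar N \<Longrightarrow> (Y ^^ n) v = mact N (g [^] n) v - v"
  defines "M \<equiv> H_module_of G H \<iota> y N Y"
  shows H_module_H_module_of: "H_module H M"
    and mcar_H_module_of: "mcar M = mcar N"
    and \<iota>_H_module_of: "\<And>h v. h \<in> carrier G \<Longrightarrow> v \<in> mcar N \<Longrightarrow> mact M (\<iota> h) v = mact N h v"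
    and y_H_module_of: "\<And>v. v \<in> mcar N \<Longrightarrow> mact M y v = Y v"
  using someI_ex[OF ex_H_module[OF assms(1-4)]] unfolding M_def H_module_of_def by auto

end

section \<open>Direct sums and isomorphisms\<close>

lemma curry_simps:
  "curry (f + f') r = curry f r + curry f' r" "curry (c \<cdot> f) r = c \<cdot> curry f r"
  "curry 0 r = 0"
  by (auto simp: fun_eq_iff fscale_def)

lemma mcar_dsum_iff:
  "f \<in> mcar (dsum I M) \<longleftrightarrow> (\<forall>r\<in>I. curry f r \<in> mcar (M r)) \<and> (\<forall>r. r \<notin> I \<longrightarrow> curry f r = 0)"
  by (auto simp: dsum_def split: if_splits)

lemma curry_mact_dsum:
  "curry (mact (dsum I M) x f) r = (if r \<in> I then mact (M r) x (curry f r) else 0)"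
  by (auto simp: dsum_def fun_eq_iff)

lemma mcar_dsum_curry: "f \<in> mcar (dsum I M) \<Longrightarrow> r \<in> I \<Longrightarrow> curry f r \<in> mcar (M r)"
  by (simp add: mcar_dsum_iff)

definition dinj :: "'r \<Rightarrow> ('a \<Rightarrow> 'k::field) \<Rightarrow> ('r \<times> 'a \<Rightarrow> 'k)"
  where "dinj r v = (\<lambda>(r', a). if r' = r then v a else 0)"

lemma curry_dinj: "curry (dinj r v) r' = (if r' = r then v else 0)"
  by (auto simp: dinj_def fun_eq_iff)

lemma curry_eqI: "(\<And>r. curry f r = curry f' r) \<Longrightarrow> f = f'"
  by (metis curry_def ext surj_pair)

lemma dinj_simps: "dinj r (u + v) = dinj r u + dinj r v" "dinj r (c \<cdot> v) = c \<cdot> dinj r v"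
  by (auto simp: dinj_def fun_eq_iff fscale_def)

lemma subspace_dsum:
  "(\<And>r. r \<in> I \<Longrightarrow> fs.subspace (mcar (M r))) \<Longrightarrow> fs.subspace (mcar (dsum I M))"
  by (auto simp: fs.subspace_def mcar_dsum_iff curry_simps)

lemma dinj_in:
  "r \<in> I \<Longrightarrow> v \<in> mcar (M r) \<Longrightarrow> (\<And>r. r \<in> I \<Longrightarrow> fs.subspace (mcar (M r))) \<Longrightarrow>
    dinj r v \<in> mcar (dsum I M)"
  by (auto simp: mcar_dsum_iff curry_dinj fs.subspace_0)

lemma curry_sum: "curry (\<Sum>i\<in>I. f i :: _ \<Rightarrow> 'k::field) r = (\<Sum>i\<in>I. curry (f i) r)"
  by (auto simp: fun_eq_iff sum_fun_apply)

lemma dsum_decompose: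
  assumes "finite I" "f \<in> mcar (dsum I M)"
  shows "f = (\<Sum>r\<in>I. dinj r (curry f r))"
proof (rule curry_eqI)
  fix r
  have "(\<Sum>r'\<in>I. curry (dinj r' (curry f r')) r) = (\<Sum>r'\<in>I. if r' = r then curry f r' else 0)"
    by (intro sum.cong refl) (auto simp: curry_dinj)
  also have "\<dots> = curry f r" using assms by (auto simp: sum.delta mcar_dsum_iff)
  finally show "curry f r = curry (\<Sum>r\<in>I. dinj r (curry f r)) r" by (simp add: curry_sum)
qed

lemma findim_dsum:
  assumes I: "finite I" and M: "\<And>r. r \<in> I \<Longrightarrow> findim (mcar (M r))"
  shows "findim (mcar (dsum I M))"
proof -
  from M have sub: "fs.subspace (mcar (M r))" if "r \<in> I" for r
    using that by (simp add: findim_def)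
  obtain B where B: "finite (B r)" "fs.span (B r) = mcar (M r)" if "r \<in> I" for r
    using M unfolding findim_def by metis
  let ?X = "\<Union>r\<in>I. dinj r ` B r"
  have "dinj r v \<in> fs.span ?X" if r: "r \<in> I" and v: "v \<in> mcar (M r)" for r v
  proof -
    have "linear_on (mcar (M r)) UNIV (dinj r)" by (simp add: linear_on_def dinj_simps)
    from span_image_on[OF this sub[OF r] B(2)[OF r]] v have "dinj r v \<in> fs.span (dinj r ` B r)"
      by blast
    moreover have "fs.span (dinj r ` B r) \<subseteq> fs.span ?X" using r by (intro fs.span_mono) blast
    ultimately show ?thesis by blast
  qed
  then have "f \<in> fs.span ?X" if "f \<in> mcar (dsum I M)" for f
    using that by (subst dsum_decompose[OF I that]) (auto intro!: fs.span_sum simp: mcar_dsum_iff)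
  moreover have "?X \<subseteq> mcar (dsum I M)"
  proof (clarsimp)
    fix r b assume "r \<in> I" "b \<in> B r"
    moreover have "b \<in> mcar (M r)" using calculation B(2) fs.span_base by blast
    ultimately show "dinj r b \<in> mcar (dsum I M)" by (intro dinj_in sub)
  qed
  then have "fs.span ?X \<subseteq> mcar (dsum I M)"
    by (intro fs.span_minimal subspace_dsum sub)
  ultimately have "fs.span ?X = mcar (dsum I M)" by blast
  then show ?thesis
    unfolding findim_def using I B(1) by (intro conjI exI[of _ ?X] subspace_dsum sub) auto
qed

lemma linear_on_mact_dsum:
  assumes "\<And>r. r \<in> I \<Longrightarrow> linear_on (mcar (M r)) (mcar (M r)) (mact (M r) x)"
  shows "linear_on (mcar (dsum I M)) (mcar (dsum I M)) (mact (dsum I M) x)"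
  unfolding linear_on_def
  using linear_onD[OF assms]
  by (auto simp: mcar_dsum_iff curry_mact_dsum curry_simps intro!: curry_eqI)

lemma G_module_dsum:
  assumes "finite I" "\<And>r. r \<in> I \<Longrightarrow> G_module G (M r)"
  shows "G_module G (dsum I M)"
  unfolding G_module_def
proof (intro conjI ballI)
  note D = G_moduleD[OF assms(2)]
  show "findim (mcar (dsum I M))" by (rule findim_dsum[OF assms(1) D(1)])
  show "linear_on (mcar (dsum I M)) (mcar (dsum I M)) (mact (dsum I M) h)" if "h \<in> carrier G" for h
    using that by (intro linear_on_mact_dsum D)
qed (auto simp: mcar_dsum_iff curry_mact_dsum G_moduleD[OF assms(2)] intro!: curry_eqI)

lemma alg_module_dsum:
  assumes "algebra_axioms H" "\<And>r. r \<in> I \<Longrightarrow> alg_module H (M r)"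
  shows "alg_module H (dsum I M)"
  unfolding alg_module_def bilinear_on_def
proof (intro conjI ballI)
  note D = alg_moduleD[OF assms(2)]
  show "fs.subspace (mcar (dsum I M))" by (rule subspace_dsum[OF D(1)])
  show "linear_on (mcar (dsum I M)) (mcar (dsum I M)) (mact (dsum I M) a)" if "a \<in> hcar H" for a
    using that by (intro linear_on_mact_dsum D)
  show "linear_on (hcar H) (mcar (dsum I M)) (\<lambda>a. mact (dsum I M) a v)"
    if "v \<in> mcar (dsum I M)" for v
    using that linear_onD[OF D(3)] unfolding linear_on_def
    by (auto simp: mcar_dsum_iff curry_mact_dsum curry_simps intro!: curry_eqI)
qed (auto simp: mcar_dsum_iff curry_mact_dsum alg_moduleD[OF assms(2)] intro!: curry_eqI)

section \<open>Isomorphisms of modules and transport of structure\<close>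

lemma mod_isoI:
  assumes "linear_on (mcar M) (mcar N) f" "bij_betw f (mcar M) (mcar N)"
    "\<And>x v. x \<in> X \<Longrightarrow> v \<in> mcar M \<Longrightarrow> f (mact M x v) = mact N x (f v)"
  shows "mod_iso X M N"
  using assms by (auto simp: mod_iso_def)

lemma mod_iso_trans: "mod_iso X L M \<Longrightarrow> mod_iso X M N \<Longrightarrow> mod_iso X L N"
  unfolding mod_iso_def
proof (elim exE conjE)
  fix f f'
  assume "linear_on (mcar L) (mcar M) f" "bij_betw f (mcar L) (mcar M)"
    "\<forall>x\<in>X. \<forall>v\<in>mcar L. f (mact L x v) = mact M x (f v)"
    "linear_on (mcar M) (mcar N) f'" "bij_betw f' (mcar M) (mcar N)"
    "\<forall>x\<in>X. \<forall>v\<in>mcar M. f' (mact M x v) = mact N x (f' v)"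
  then show "\<exists>f. linear_on (mcar L) (mcar N) f \<and> bij_betw f (mcar L) (mcar N) \<and>
      (\<forall>x\<in>X. \<forall>v\<in>mcar L. f (mact L x v) = mact N x (f v))"
    by (intro exI[of _ "f' \<circ> f"]) (auto simp: linear_on_def intro: bij_betw_trans)
qed

text \<open>An \<open>opmod\<close> carries no closure condition, hence the hypothesis
  \<open>act\<close>: \<open>inv_into\<close> undoes \<open>f\<close> at
  \<open>f (mact M x v)\<close> because \<open>mact M x v\<close> lies in the carrier.\<close>

lemma mod_iso_sym:
  assumes iso: "mod_iso X M N" and M: "fs.subspace (mcar M)"
    and act: "\<And>x v. x \<in> X \<Longrightarrow> v \<in> mcar M \<Longrightarrow> mact M x v \<in> mcar M"
  shows "mod_iso X N M"
proof -
  obtain f where f: "linear_on (mcar M) (mcar N) f" "bij_betw f (mcar M) (mcar N)"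
    "\<And>x v. x \<in> X \<Longrightarrow> v \<in> mcar M \<Longrightarrow> f (mact M x v) = mact N x (f v)"
    using iso by (auto simp: mod_iso_def)
  show ?thesis
  proof (rule mod_isoI[OF linear_on_inv_into[OF f(1,2) M] bij_betw_inv_into[OF f(2)]])
    fix x w assume x: "x \<in> X" and "w \<in> mcar N"
    then obtain v where v: "v \<in> mcar M" "w = f v" using f(2) by (auto simp: bij_betw_def)
    then show "inv_into (mcar M) f (mact N x w) = mact M x (inv_into (mcar M) f w)"
      using f(2) act[OF x] by (simp add: f(3)[OF x, symmetric] bij_betw_inv_into_left)
  qed
qed

lemma G_module_mod_iso_sym:
  "mod_iso (carrier G) M N \<Longrightarrow> G_module G M \<Longrightarrow> mod_iso (carrier G) N M"
  by (erule mod_iso_sym) (auto dest: G_moduleD)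

lemma G_module_mod_iso:
  assumes M: "G_module G M" and iso: "mod_iso (carrier G) M N" and G: "group G"
  shows "G_module G N"
proof -
  interpret group G by fact
  note D = G_moduleD[OF M]
  obtain f where f: "linear_on (mcar M) (mcar N) f" "bij_betw f (mcar M) (mcar N)"
    and fh: "\<And>h v. h \<in> carrier G \<Longrightarrow> v \<in> mcar M \<Longrightarrow> f (mact M h v) = mact N h (f v)"
    using iso by (auto simp: mod_iso_def)
  have N: "mcar N = f ` mcar M" using f(2) by (simp add: bij_betw_def)
  note lf = linear_onD[OF f(1)] and lM = linear_onD[OF D(3)]
  have add: "mact N h (f u + f v) = mact N h (f u) + mact N h (f v)"
    if "h \<in> carrier G" "u \<in> mcar M" "v \<in> mcar M" for h u v
    using that by (simp add: fh[symmetric] lf(2,3)[symmetric] lM D fs.subspace_add)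
  have scale: "mact N h (c \<cdot> f v) = c \<cdot> mact N h (f v)"
    if "h \<in> carrier G" "v \<in> mcar M" for h c v
    using that by (simp add: fh[symmetric] lf(2,3)[symmetric] lM D fs.subspace_scale)
  show ?thesis
    unfolding G_module_def linear_on_def N
    using findim_image[OF f(1) D(1)]
    by (auto simp: add scale fh[symmetric] D)
qed

text \<open>A submodule of N is the image of its preimage in M, and that preimage is a submodule of
  the simple module M.\<close>

lemma simple_G_module_mod_iso:
  assumes M: "simple_G_module G M" and iso: "mod_iso (carrier G) M N" and G: "group G"
  shows "simple_G_module G N"
proof -
  have GM: "G_module G M" using M by (simp add: simple_G_module_def)
  note D = G_moduleD[OF GM]
  have GN: "G_module G N" by (rule G_module_mod_iso[OF GM iso G])
  obtain f where f: "linear_on (mcar M) (mcar N) f" "bij_betw f (mcar M) (mcar N)"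
    and fh: "\<And>h v. h \<in> carrier G \<Longrightarrow> v \<in> mcar M \<Longrightarrow> f (mact M h v) = mact N h (f v)"
    using iso by (auto simp: mod_iso_def)
  have N: "mcar N = f ` mcar M" and inj: "inj_on f (mcar M)"
    using f(2) by (simp_all add: bij_betw_def)
  have f0: "f 0 = 0" by (rule linear_on_zero[OF f(1) D(2)])
  have "mcar N \<noteq> {0}"
  proof
    assume "mcar N = {0}"
    then have "f v = f 0" if "v \<in> mcar M" for v
      using that f0 by (auto simp: N)
    then have "mcar M \<subseteq> {0}"
      using inj_onD[OF inj] fs.subspace_0[OF D(2)] by blast
    then show False using M fs.subspace_0[OF D(2)] by (auto simp: simple_G_module_def)
  qed
  moreover have "U = {0} \<or> U = mcar N"
    if U: "fs.subspace U" "U \<subseteq> mcar N" "\<forall>h\<in>carrier G. \<forall>u\<in>U. mact N h u \<in> U" for U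
  proof -
    let ?U = "{v \<in> mcar M. f v \<in> U}"
    have fU: "f ` ?U = U" using U(2) by (auto simp: N)
    have "?U = {0} \<or> ?U = mcar M"
      using M subspace_vimage_on[OF f(1) D(2) U(1)] U(3)
      by (auto simp: simple_G_module_def D fh)
    then show ?thesis
      using fU f0 N by auto
  qed
  ultimately show ?thesis using GN by (auto simp: simple_G_module_def)
qed

section \<open>Schur's lemma and complete reducibility\<close>

text \<open>The value p(T) v of a polynomial in an operator. The explicit sum suits operators that
  are linear on a subspace only.\<close>

definition op_eval :: "(('a \<Rightarrow> 'k::field) \<Rightarrow> ('a \<Rightarrow> 'k)) \<Rightarrow> 'k poly \<Rightarrow> ('a \<Rightarrow> 'k) \<Rightarrow> ('a \<Rightarrow> 'k)"
  where "op_eval T p v = (\<Sum>i\<le>degree p. coeff p i \<cdot> (T ^^ i) v)"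

lemma op_eval_eq:
  assumes "degree p \<le> d"
  shows "op_eval T p v = (\<Sum>i\<le>d. coeff p i \<cdot> (T ^^ i) v)"
  unfolding op_eval_def using assms
  by (intro sum.mono_neutral_left) (auto simp: coeff_eq_0)

text \<open>The coefficients of (X - c) r are the shifted coefficients of r minus c times the
  unshifted ones; the shifted ones assemble to T applied to r(T) v.\<close>

lemma op_eval_linear_factor:
  assumes T: "linear_on V V T" and V: "fs.subspace V" and v: "v \<in> V"
  shows "op_eval T ([:- c, 1:] * r) v = T (op_eval T r v) - c \<cdot> op_eval T r v"
proof -
  let ?p = "[:- c, 1:] * r"
  have p: "coeff ?p 0 = - c * coeff r 0" "\<And>i. coeff ?p (Suc i) = coeff r i - c * coeff r (Suc i)"
    by (simp_all add: coeff_pCons)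
  have Tv: "(T ^^ i) v \<in> V" for i by (rule linear_onD(1)[OF linear_on_funpow[OF T] v])
  have "degree ?p \<le> Suc (degree r)"
    by (rule degree_le) (auto simp: coeff_pCons coeff_eq_0 split: nat.split)
  then have "op_eval T ?p v = (\<Sum>i\<le>Suc (degree r). coeff ?p i \<cdot> (T ^^ i) v)"
    by (rule op_eval_eq)
  also have "\<dots> = (\<Sum>i\<le>degree r. coeff r i \<cdot> T ((T ^^ i) v)) -
      c \<cdot> (\<Sum>i\<le>Suc (degree r). coeff r i \<cdot> (T ^^ i) v)"
    by (simp only: sum.atMost_Suc_shift p)
      (simp add: fs.scale_left_diff_distrib sum_subtractf fs.scale_sum_right fs.scale_right_distrib
        del: sum.atMost_Suc)
  also have "(\<Sum>i\<le>degree r. coeff r i \<cdot> T ((T ^^ i) v)) = T (op_eval T r v)"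
    unfolding op_eval_def by (rule linear_on_sum[OF T V Tv, symmetric])
  also have "(\<Sum>i\<le>Suc (degree r). coeff r i \<cdot> (T ^^ i) v) = op_eval T r v"
    by (rule op_eval_eq[symmetric]) simp
  finally show ?thesis .
qed

text \<open>Split off a root c, p = (X - c) r. Either r(T) v is nonzero and is an eigenvector for c,
  or r annihilates v and has smaller degree. A constant p \<noteq> 0 cannot annihilate v \<noteq>
  0.\<close>

lemma eigenvector_of_annihilator:
  fixes T :: "('a \<Rightarrow> 'k::alg_closed_field) \<Rightarrow> ('a \<Rightarrow> 'k)"
  assumes T: "linear_on V V T" and V: "fs.subspace V" and v: "v \<in> V" "v \<noteq> 0"
    and p: "p \<noteq> 0" "op_eval T p v = 0"
  shows "\<exists>c w. w \<in> V \<and> w \<noteq> 0 \<and> T w = c \<cdot> w"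
  using p
proof (induction "degree p" arbitrary: p)
  case 0
  then have "coeff p 0 \<cdot> v = 0" by (simp add: op_eval_def fun_eq_iff)
  moreover have "coeff p 0 \<noteq> 0" using 0 leading_coeff_neq_0 by metis
  ultimately show ?case using v(2) by simp
next
  case (Suc d)
  then obtain c where "poly p c = 0" using alg_closed_imp_poly_has_root[of p] by auto
  then obtain r where r: "p = [:- c, 1:] * r" by (auto simp: poly_eq_0_iff_dvd)
  then have r0: "r \<noteq> 0" using Suc.prems by auto
  have d: "d = degree r"
  proof -
    have "degree p = degree [:- c, 1:] + degree r"
      unfolding r using r0 by (intro degree_mult_eq) auto
    then show ?thesis using Suc.hyps(2) by simp
  qed
  show ?case
  proof (cases "op_eval T r v = 0")
    case True
    then show ?thesis using Suc.hyps(1)[OF d r0] by simp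
  next
    case False
    have "op_eval T r v \<in> V"
      unfolding op_eval_def using linear_onD(1)[OF linear_on_funpow[OF T] v(1)]
      by (auto intro!: fs.subspace_sum[OF V] fs.subspace_scale[OF V])
    moreover have "T (op_eval T r v) = c \<cdot> op_eval T r v"
      using Suc.prems(2) op_eval_linear_factor[OF T V v(1)] by (simp add: r)
    ultimately show ?thesis using False by blast
  qed
qed

text \<open>As G is finite, z has some power z^N = 1, so X^N - 1 annihilates any vector and z has an
  eigenvalue c. Centrality makes the eigenspace a submodule, and simplicity makes it the whole
  module.\<close>

lemma schur_central:
  fixes M :: "('g, 'a, 'k::alg_closed_field) opmod"
  assumes M: "simple_G_module G M" and G: "group G" "finite (carrier G)"
    and z: "z \<in> carrier G" "\<And>h. h \<in> carrier G \<Longrightarrow> z \<otimes>\<^bsub>G\<^esub> h = h \<otimes>\<^bsub>G\<^esub> z"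
  shows "\<exists>c. \<forall>v\<in>mcar M. mact M z v = c \<cdot> v"
proof -
  interpret group G by fact
  have GM: "G_module G M" using M by (simp add: simple_G_module_def)
  note D = G_moduleD[OF GM]
  obtain v where v: "v \<in> mcar M" "v \<noteq> 0"
    using M fs.subspace_0[OF D(2)] by (auto simp: simple_G_module_def)
  have pow: "(mact M z ^^ k) v = mact M (z [^]\<^bsub>G\<^esub> k) v" for k
  proof (induction k)
    case (Suc k)
    have "z [^]\<^bsub>G\<^esub> Suc k = z \<otimes>\<^bsub>G\<^esub> z [^]\<^bsub>G\<^esub> k" by (rule nat_pow_Suc2[OF z(1)])
    then show ?case using Suc z(1) v by (simp add: D del: nat_pow_Suc)
  qed (use v D in simp)
  have "\<not> inj (\<lambda>k::nat. z [^]\<^bsub>G\<^esub> k)"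
    using z(1) finite_subset[OF _ G(2), of "range (\<lambda>k::nat. z [^]\<^bsub>G\<^esub> k)"]
    by (auto dest: finite_imageD)
  then obtain k l :: nat where kl: "z [^]\<^bsub>G\<^esub> k = z [^]\<^bsub>G\<^esub> l" "l < k"
    by (auto simp: inj_def) (metis linorder_neqE_nat)
  let ?N = "k - l"
  have zN: "z [^]\<^bsub>G\<^esub> ?N = \<one>\<^bsub>G\<^esub>" using z(1) kl(1) by (rule pow_eq_div2)
  have N: "?N > 0" using kl(2) by simp
  let ?p = "monom 1 ?N - 1 :: 'k poly"
  have dp: "degree ?p \<le> ?N" by (intro degree_diff_le) (auto simp: degree_monom_le)
  have p0: "?p \<noteq> 0"
  proof
    assume "?p = 0"
    then have "coeff ?p ?N = 0" by simp
    then show False using N by simp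
  qed
  have "op_eval (mact M z) ?p v = (\<Sum>i\<le>?N. coeff ?p i \<cdot> (mact M z ^^ i) v)"
    by (rule op_eval_eq[OF dp])
  also have "\<dots> = (\<Sum>i\<in>{0, ?N}. coeff ?p i \<cdot> (mact M z ^^ i) v)"
    by (rule sum.mono_neutral_right) (auto simp: coeff_1)
  also have "\<dots> = 0"
    using N v z by (simp add: coeff_1 pow zN D)
  finally obtain c w where w: "w \<in> mcar M" "w \<noteq> 0" "mact M z w = c \<cdot> w"
    using eigenvector_of_annihilator[OF D(3)[OF z(1)] D(2) v p0] by blast
  let ?U = "{v \<in> mcar M. mact M z v - c \<cdot> v = 0}"
  have lin: "linear_on (mcar M) (mcar M) (\<lambda>v. mact M z v - c \<cdot> v)"
    by (intro linear_on_minus_fun linear_on_scale linear_on_id D z)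
  have stable: "mact M h u \<in> ?U" if h: "h \<in> carrier G" and u: "u \<in> ?U" for h u
  proof -
    have "mact M z (mact M h u) = mact M h (mact M z u)"
    proof -
      have "u \<in> mcar M" using u by simp
      from D(5)[OF z(1) h this] D(5)[OF h z(1) this] show ?thesis by (simp add: z(2)[OF h])
    qed
    also have "\<dots> = c \<cdot> mact M h u" using u h by (simp add: linear_onD[OF D(3)])
    finally show ?thesis using h u by (simp add: D)
  qed
  have "?U = mcar M"
  proof -
    have "?U \<noteq> {0}" using w by auto
    moreover have "\<forall>h\<in>carrier G. \<forall>u\<in>?U. mact M h u \<in> ?U" using stable by blast
    moreover have "?U \<subseteq> mcar M" by blast
    ultimately show ?thesis
      using M subspace_kernel_on[OF lin D(2)] unfolding simple_G_module_def by meson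
  qed
  then show ?thesis by (intro exI[of _ c]) auto
qed

text \<open>A nonzero vector makes the scalar unique, which the definite description in
  \<open>g_scalar\<close> requires.\<close>

lemma g_scalar_eqI:
  assumes "mcar M \<noteq> {0}" "fs.subspace (mcar M)" "\<forall>v\<in>mcar M. mact M (g [^]\<^bsub>G\<^esub> n) v = c \<cdot> v"
  shows "g_scalar G g n M = c"
  unfolding g_scalar_def
proof (rule the_equality)
  show "\<forall>v\<in>mcar M. mact M (g [^]\<^bsub>G\<^esub> n) v = c \<cdot> v" by fact
next
  fix d assume d: "\<forall>v\<in>mcar M. mact M (g [^]\<^bsub>G\<^esub> n) v = d \<cdot> v"
  obtain v where v: "v \<in> mcar M" "v \<noteq> 0" using assms(1) fs.subspace_0[OF assms(2)] by auto
  then have "d \<cdot> v = c \<cdot> v" using assms(3) d by metis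
  then show "d = c" using v by simp
qed

text \<open>A linear projection onto \<open>S\<close> is averaged over its conjugates under G; the
  order of G is invertible in characteristic zero.\<close>

lemma maschke:
  fixes M :: "('g, 'a, 'k::field_char_0) opmod"
  assumes M: "G_module G M" and G: "group G" "finite (carrier G)"
    and S: "fs.subspace S" "S \<subseteq> mcar M" "\<And>h v. h \<in> carrier G \<Longrightarrow> v \<in> S \<Longrightarrow> mact M h v \<in> S"
  shows "\<exists>p. linear_on (mcar M) S p \<and> (\<forall>v\<in>S. p v = v) \<and>
    (\<forall>h\<in>carrier G. \<forall>v\<in>mcar M. p (mact M h v) = mact M h (p v))"
proof -
  interpret group G by fact
  note D = G_moduleD[OF M]
  interpret pr: vector_space_pair
    "fscale :: 'k \<Rightarrow> ('a \<Rightarrow> 'k) \<Rightarrow> ('a \<Rightarrow> 'k)" "fscale :: 'k \<Rightarrow> ('a \<Rightarrow> 'k) \<Rightarrow> ('a \<Rightarrow> 'k)" ..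
  \<comment> \<open>\<open>q\<close> is a projection of the whole function space onto
    \<open>S\<close>, with no equivariance yet.\<close>
  obtain q where q: "range q \<subseteq> S" "Vector_Spaces.linear fscale fscale q" "\<forall>v\<in>S. q v = v"
    using pr.linear_exists_left_inverse_on[OF fs.linear_id S(1)] by auto
  interpret q: Vector_Spaces.linear fscale fscale q by fact
  have ql: "linear_on (mcar M) S q" using q(1) by (auto simp: linear_on_def q.add q.scale)
  have Sl: "linear_on S S (mact M h)" if "h \<in> carrier G" for h
    using D(3)[OF that] S(2,3) that by (auto simp: linear_on_def subset_iff)
  let ?c = "inverse (of_nat (card (carrier G))) :: 'k"
  have c: "?c * of_nat (card (carrier G)) = 1"
  proof -
    have "card (carrier G) \<noteq> 0" using G(2) one_closed by (metis card_0_eq empty_iff)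
    then show ?thesis by simp
  qed
  define p where "p v = ?c \<cdot> (\<Sum>h\<in>carrier G. mact M h (q (mact M (inv\<^bsub>G\<^esub> h) v)))" for v
  have "linear_on (mcar M) S p"
    unfolding p_def[abs_def]
    by (intro linear_on_scale linear_on_sum_fun linear_on_compose[OF linear_on_compose[OF D(3) ql] Sl] S)
      auto
  moreover have "p v = v" if v: "v \<in> S" for v
  proof -
    have "mact M h (q (mact M (inv\<^bsub>G\<^esub> h) v)) = v" if h: "h \<in> carrier G" for h
    proof -
      have "q (mact M (inv\<^bsub>G\<^esub> h) v) = mact M (inv\<^bsub>G\<^esub> h) v" using q(3) S(3) h v by simp
      moreover have "v \<in> mcar M" using v S(2) by blast
      ultimately show ?thesis using h by (simp add: D(5)[symmetric] D(4))
    qed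
    then have "p v = ?c \<cdot> (\<Sum>h\<in>carrier G. v)" by (simp add: p_def)
    also have "(\<Sum>h\<in>carrier G. v) = of_nat (card (carrier G)) \<cdot> v"
      by (simp add: fs.sum_constant_scale del: sum_constant)
    finally show ?thesis using c by simp
  qed
  moreover have "p (mact M h v) = mact M h (p v)" if h: "h \<in> carrier G" and v: "v \<in> mcar M" for h v
  proof -
    let ?f = "\<lambda>h. mact M h (q (mact M (inv\<^bsub>G\<^esub> h) v))"
    have qS: "q x \<in> mcar M" for x using q(1) S(2) by auto
    \<comment> \<open>Reindexing the average by k \<mapsto> hk moves the action of h from the
      argument to the outside.\<close>
    have bij: "bij_betw (\<lambda>k. h \<otimes>\<^bsub>G\<^esub> k) (carrier G) (carrier G)"
      by (rule bij_betw_byWitness[where f' = "\<lambda>k. inv\<^bsub>G\<^esub> h \<otimes>\<^bsub>G\<^esub> k"])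
        (use h in \<open>auto simp: m_assoc[symmetric]\<close>)
    have "(\<Sum>k\<in>carrier G. mact M k (q (mact M (inv\<^bsub>G\<^esub> k) (mact M h v)))) =
        (\<Sum>k\<in>carrier G. mact M (h \<otimes>\<^bsub>G\<^esub> k) (q (mact M (inv\<^bsub>G\<^esub> (h \<otimes>\<^bsub>G\<^esub> k)) (mact M h v))))"
      by (rule sum.reindex_bij_betw[OF bij, symmetric])
    also have "\<dots> = (\<Sum>k\<in>carrier G. mact M h (?f k))"
    proof (rule sum.cong[OF refl])
      fix k assume k: "k \<in> carrier G"
      have "mact M (inv\<^bsub>G\<^esub> (h \<otimes>\<^bsub>G\<^esub> k)) (mact M h v) = mact M (inv\<^bsub>G\<^esub> k) v"
        using h k v by (simp add: D(5)[symmetric] inv_mult_group m_assoc)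
      then show "mact M (h \<otimes>\<^bsub>G\<^esub> k) (q (mact M (inv\<^bsub>G\<^esub> (h \<otimes>\<^bsub>G\<^esub> k)) (mact M h v))) = mact M h (?f k)"
        using h k by (simp add: D(5) qS)
    qed
    also have "\<dots> = mact M h (\<Sum>k\<in>carrier G. ?f k)"
      by (rule linear_on_sum'[OF D(3)[OF h] D(2), symmetric]) (simp add: D(6) qS)
    finally show ?thesis
      unfolding p_def
      by (simp add: linear_onD(3)[OF D(3)[OF h]] fs.subspace_sum[OF D(2)] D(6) qS)
  qed
  ultimately show ?thesis by blast
qed

text \<open>Completeness of the family of simple modules speaks about subspaces of
  \<open>nat \<Rightarrow> 'k\<close>, so other spaces have to be moved there. A basis is finite by
  comparison with a finite spanning set; it is numbered by \<open>e\<close> and sent to delta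
  functions.\<close>

lemma ex_linear_inj_to_nat:
  fixes V :: "('a \<Rightarrow> 'k::field) set"
  assumes "findim V"
  shows "\<exists>L :: ('a \<Rightarrow> 'k) \<Rightarrow> (nat \<Rightarrow> 'k). linear_on V UNIV L \<and> inj_on L V"
proof -
  from assms have V: "fs.subspace V" by (simp add: findim_def)
  obtain B where B: "B \<subseteq> V" "fs.independent B" "V \<subseteq> fs.span B"
    using fs.maximal_independent_subset by blast
  obtain A where A: "finite A" "fs.span A = V" using assms by (auto simp: findim_def)
  have finB: "finite B" using fs.independent_span_bound[OF A(1) B(2)] B(1) A(2) by simp
  then obtain e :: "_ \<Rightarrow> nat" where e: "inj_on e B" by (metis finite_imp_inj_to_nat_seg)
  interpret pr: vector_space_pair
    "fscale :: 'k \<Rightarrow> ('a \<Rightarrow> 'k) \<Rightarrow> ('a \<Rightarrow> 'k)" "fscale :: 'k \<Rightarrow> (nat \<Rightarrow> 'k) \<Rightarrow> (nat \<Rightarrow> 'k)" ..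
  obtain L :: "('a \<Rightarrow> 'k) \<Rightarrow> (nat \<Rightarrow> 'k)" where L: "Vector_Spaces.linear fscale fscale L"
    "\<forall>b\<in>B. L b = (\<lambda>m. if m = e b then 1 else 0)"
    using pr.linear_independent_extend[OF B(2), of "\<lambda>b m. if m = e b then 1 else 0"] by auto
  interpret L: Vector_Spaces.linear fscale fscale L by fact
  have l: "linear_on V UNIV L" by (simp add: linear_on_def L.add L.scale)
  moreover have "inj_on L V"
  proof (rule inj_on_linear_on[OF l V])
    fix v assume v: "v \<in> V" and Lv: "L v = 0"
    have "v \<in> fs.span B" using v B(3) by blast
    then obtain r where r: "v = (\<Sum>b\<in>B. r b \<cdot> b)" by (auto simp: fs.span_finite[OF finB])
    have "r b = 0" if b: "b \<in> B" for b
    proof -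
      have "0 = L v (e b)" by (simp add: Lv)
      also have "\<dots> = (\<Sum>b'\<in>B. r b' * L b' (e b))"
        by (simp add: r L.sum L.scale sum_fun_apply) (simp add: fscale_def)
      also have "\<dots> = (\<Sum>b'\<in>B. if b' = b then r b' else 0)"
        using L(2) inj_onD[OF e] b by (intro sum.cong) auto
      also have "\<dots> = r b" using finB b by simp
      finally show ?thesis by simp
    qed
    then show "v = 0" by (simp add: r)
  qed
  ultimately show ?thesis by blast
qed

text \<open>The action on M is transported along the embedding \<open>L\<close>, and the
  completeness clause applies to the resulting module \<open>W\<close>.\<close>

lemma complete_simples_iso:
  fixes M :: "('g, 'c, 'k::field) opmod" and V :: "'i \<Rightarrow> ('g, 'a, 'k) opmod"
  assumes V: "complete_simples G \<Omega> V" and M: "simple_G_module G M" and G: "group G"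
  shows "\<exists>i\<in>\<Omega>. mod_iso (carrier G) M (V i)"
proof -
  have GM: "G_module G M" using M by (simp add: simple_G_module_def)
  note D = G_moduleD[OF GM]
  obtain L :: "('c \<Rightarrow> 'k) \<Rightarrow> (nat \<Rightarrow> 'k)" where L: "linear_on (mcar M) UNIV L" "inj_on L (mcar M)"
    using ex_linear_inj_to_nat[OF D(1)] by blast
  define W where "W = \<lparr>mcar = L ` mcar M, mact = \<lambda>h w. L (mact M h (inv_into (mcar M) L w))\<rparr>"
  have MW: "mod_iso (carrier G) M W"
    by (rule mod_isoI[of _ _ L]) (use L in \<open>auto simp: W_def linear_on_def bij_betw_def\<close>)
  then have "simple_G_module G W" by (rule simple_G_module_mod_iso[OF M _ G])
  then obtain i where "i \<in> \<Omega>" "mod_iso (carrier G) W (V i)"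
    using V by (auto simp: complete_simples_def)
  then show ?thesis using mod_iso_trans[OF MW] by blast
qed

text \<open>\<open>p\<close> is an equivariant projection onto \<open>S\<close> with kernel
  \<open>C\<close>, so every v splits as p v + (v - p v). The summands of \<open>C\<close> are
  placed after those of \<open>S\<close>, with indices shifted by \<open>length ss\<close> as in the
  concatenated list.\<close>

lemma mod_iso_dsum_append:
  fixes V :: "'i \<Rightarrow> ('x, 'a, 'k::field) opmod"
  assumes M: "fs.subspace (mcar M)" and SC: "fs.subspace S" "fs.subspace C" "S \<subseteq> mcar M" "C \<subseteq> mcar M"
    and V: "\<And>i. i \<in> set ss \<union> set ts \<Longrightarrow> fs.subspace (mcar (V i))"
    and p: "linear_on (mcar M) S p" "\<And>v. v \<in> S \<Longrightarrow> p v = v" "C = {v \<in> mcar M. p v = 0}"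
    and ph: "\<And>x v. x \<in> X \<Longrightarrow> v \<in> mcar M \<Longrightarrow> p (mact M x v) = mact M x (p v)"
    and act: "\<And>x. x \<in> X \<Longrightarrow> linear_on (mcar M) (mcar M) (mact M x)"
    and isoS: "mod_iso X (M\<lparr>mcar := S\<rparr>) (dsum {..<length ss} (\<lambda>r. V (ss ! r)))"
    and isoC: "mod_iso X (M\<lparr>mcar := C\<rparr>) (dsum {..<length ts} (\<lambda>r. V (ts ! r)))"
  shows "mod_iso X M (dsum {..<length (ss @ ts)} (\<lambda>r. V ((ss @ ts) ! r)))"
proof -
  let ?m = "length ss"
  let ?S = "dsum {..<length ss} (\<lambda>r. V (ss ! r))" and ?C = "dsum {..<length ts} (\<lambda>r. V (ts ! r))"
  let ?D = "dsum {..<length (ss @ ts)} (\<lambda>r. V ((ss @ ts) ! r))"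
  obtain f1 where f1: "linear_on S (mcar ?S) f1" "bij_betw f1 S (mcar ?S)"
    "\<And>x v. x \<in> X \<Longrightarrow> v \<in> S \<Longrightarrow> f1 (mact M x v) = mact ?S x (f1 v)"
    using isoS by (auto simp: mod_iso_def)
  obtain f2 where f2: "linear_on C (mcar ?C) f2" "bij_betw f2 C (mcar ?C)"
    "\<And>x v. x \<in> X \<Longrightarrow> v \<in> C \<Longrightarrow> f2 (mact M x v) = mact ?C x (f2 v)"
    using isoC by (auto simp: mod_iso_def)
  define q where "q v = v - p v" for v
  have pS: "p v \<in> S" if "v \<in> mcar M" for v using linear_onD(1)[OF p(1) that] .
  have q: "linear_on (mcar M) (mcar M) q"
    unfolding q_def[abs_def] by (intro linear_on_minus_fun linear_on_id linear_on_mono[OF p(1)] M SC) simp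
  have qC: "q v \<in> C" if "v \<in> mcar M" for v
  proof -
    have "p v \<in> mcar M" using pS[OF that] SC(3) by blast
    then show ?thesis
      using that pS[OF that] linear_onD(1)[OF q that]
      by (simp add: p(2,3) q_def linear_on_diff[OF p(1) M])
  qed
  have ql: "linear_on (mcar M) C q" using q qC by (simp add: linear_on_def)
  have qh: "q (mact M x v) = mact M x (q v)" if "x \<in> X" "v \<in> mcar M" for x v
    using that pS[OF that(2)] SC(3) by (auto simp: q_def ph linear_on_diff[OF act M])
  define f where "f v = (\<lambda>(r, a). if r < ?m then f1 (p v) (r, a) else f2 (q v) (r - ?m, a))" for v
  have cf: "curry (f v) r = (if r < ?m then curry (f1 (p v)) r else curry (f2 (q v)) (r - ?m))" for v r
    by (auto simp: f_def fun_eq_iff)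
  have l1: "linear_on (mcar M) (mcar ?S) (\<lambda>v. f1 (p v))" by (rule linear_on_compose[OF p(1) f1(1)])
  have l2: "linear_on (mcar M) (mcar ?C) (\<lambda>v. f2 (q v))" by (rule linear_on_compose[OF ql f2(1)])
  have f: "linear_on (mcar M) (mcar ?D) f"
    unfolding linear_on_def
  proof (intro conjI ballI allI)
    fix v assume v: "v \<in> mcar M"
    show "f v \<in> mcar ?D"
      using linear_onD(1)[OF l1 v] linear_onD(1)[OF l2 v]
      by (auto simp: mcar_dsum_iff cf nth_append)
    show "f (c \<cdot> v) = c \<cdot> f v" for c
      by (rule curry_eqI) (simp add: cf curry_simps linear_onD(3)[OF l1 v] linear_onD(3)[OF l2 v])
    show "f (v + u) = f v + f u" if u: "u \<in> mcar M" for u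
      by (rule curry_eqI) (simp add: cf curry_simps linear_onD(2)[OF l1 v u] linear_onD(2)[OF l2 v u])
  qed
  have f10: "p v = 0" if "v \<in> mcar M" "f v = 0" for v
  proof -
    have "f1 (p v) = 0"
    proof (rule curry_eqI)
      fix r
      show "curry (f1 (p v)) r = curry 0 r"
        using linear_onD(1)[OF l1 that(1)] cf[of v r] that(2)
        by (cases "r < ?m") (auto simp: mcar_dsum_iff curry_simps)
    qed
    moreover have "f1 0 = 0" by (rule linear_on_zero[OF f1(1) SC(1)])
    ultimately show ?thesis
      using f1(2) pS[OF that(1)] fs.subspace_0[OF SC(1)] by (auto simp: bij_betw_def inj_on_def)
  qed
  have f20: "q v = 0" if "v \<in> mcar M" "f v = 0" for v
  proof -
    have "f2 (q v) = 0"
    proof (rule curry_eqI)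
      fix r
      show "curry (f2 (q v)) r = curry 0 r"
        using cf[of v "r + ?m"] that(2) by (simp add: curry_simps)
    qed
    moreover have "f2 0 = 0" by (rule linear_on_zero[OF f2(1) SC(2)])
    ultimately show ?thesis
      using f2(2) qC[OF that(1)] fs.subspace_0[OF SC(2)] by (auto simp: bij_betw_def inj_on_def)
  qed
  have inj: "inj_on f (mcar M)"
    by (rule inj_on_linear_on[OF f M]) (use f10 f20 in \<open>force simp: q_def\<close>)
  have "mcar ?D \<subseteq> f ` mcar M"
  proof
    fix d assume d: "d \<in> mcar ?D"
    \<comment> \<open>For surjectivity, \<open>d\<close> is cut at index \<open>?m\<close>; the tail
      is shifted back to start at 0.\<close>
    define d1 where "d1 = (\<lambda>(r, a). if r < ?m then d (r, a) else 0)"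
    define d2 where "d2 = (\<lambda>(r, a). d (r + ?m, a))"
    have c1: "curry d1 r = (if r < ?m then curry d r else 0)" for r by (auto simp: d1_def fun_eq_iff)
    have c2: "curry d2 r = curry d (r + ?m)" for r by (auto simp: d2_def fun_eq_iff)
    have dd: "curry d r \<in> mcar (V ((ss @ ts) ! r))" if "r < length ss + length ts" for r
      using d that by (simp add: mcar_dsum_iff)
    have dd0: "curry d r = 0" if "\<not> r < length ss + length ts" for r
      using d that by (simp add: mcar_dsum_iff)
    have "d1 \<in> mcar ?S"
      unfolding mcar_dsum_iff
    proof (intro conjI ballI allI impI)
      fix r assume "r \<in> {..<length ss}"
      then show "curry d1 r \<in> mcar (V (ss ! r))" using dd[of r] by (simp add: c1 nth_append)
    qed (simp add: c1)
    then obtain s where s: "s \<in> S" "f1 s = d1" using bij_betw_imp_surj_on[OF f1(2)] by (metis imageE)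
    have "d2 \<in> mcar ?C"
      unfolding mcar_dsum_iff
    proof (intro conjI ballI allI impI)
      fix r assume "r \<in> {..<length ts}"
      then show "curry d2 r \<in> mcar (V (ts ! r))" using dd[of "r + ?m"] by (simp add: c2 nth_append)
    qed (simp add: c2 dd0)
    then obtain c where c: "c \<in> C" "f2 c = d2" using bij_betw_imp_surj_on[OF f2(2)] by (metis imageE)
    have sM: "s \<in> mcar M" and cM: "c \<in> mcar M" using s c SC by auto
    have "p (s + c) = s" using c s by (simp add: linear_onD(2)[OF p(1) sM cM] p(2)) (simp add: p(3))
    moreover from this have "q (s + c) = c" by (simp add: q_def)
    ultimately have "f (s + c) = d"
      by (intro curry_eqI) (simp add: cf s c c1 c2)
    then show "d \<in> f ` mcar M" using fs.subspace_add[OF M sM cM] by blast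
  qed
  then have bij: "bij_betw f (mcar M) (mcar ?D)"
    using inj linear_onD(1)[OF f] by (auto simp: bij_betw_def)
  show ?thesis
  proof (rule mod_isoI[OF f bij])
    fix x v assume x: "x \<in> X" and v: "v \<in> mcar M"
    have "curry (f2 (q v)) r = 0" if "\<not> r < length ts" for r
      using linear_onD(1)[OF l2 v] that by (simp add: mcar_dsum_iff)
    then show "f (mact M x v) = mact ?D x (f v)"
      using x v pS[OF v] qC[OF v]
      by (intro curry_eqI) (auto simp: cf ph qh f1(3) f2(3) curry_mact_dsum nth_append)
  qed
qed

lemma G_module_restrict:
  assumes M: "G_module G M" and S: "fs.subspace S" "S \<subseteq> mcar M"
    "\<And>h v. h \<in> carrier G \<Longrightarrow> v \<in> S \<Longrightarrow> mact M h v \<in> S" and f: "findim S"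
  shows "G_module G (M\<lparr>mcar := S\<rparr>)"
  using G_moduleD[OF M] S f unfolding G_module_def linear_on_def by (simp add: subset_iff)

text \<open>\<open>S\<close> is the image of V under \<open>p\<close>, so a finite spanning set of V
  yields one of \<open>S\<close>. This serves both halves of a splitting.\<close>

lemma findim_image_projection:
  assumes "findim V" "linear_on V S p" "S \<subseteq> V" "\<And>v. v \<in> S \<Longrightarrow> p v = v"
  shows "findim S"
proof -
  have "p ` V = S" using assms(2-4) by (force simp: linear_on_def)
  then show ?thesis using findim_image[OF assms(2,1)] by simp
qed

text \<open>Induction on a bound for the dimension: a module that is neither zero nor simple has a
  proper nonzero submodule, whose invariant complement is given by averaging, and both halves have
  smaller dimension.\<close>

lemma semisimple:
  fixes M :: "('g, 'c, 'k::field_char_0) opmod" and V :: "'i \<Rightarrow> ('g, 'a, 'k) opmod"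
  assumes V: "complete_simples G \<Omega> V" and G: "group G" "finite (carrier G)"
    and M: "G_module G M"
  shows "\<exists>ss. set ss \<subseteq> \<Omega> \<and> mod_iso (carrier G) M (dsum {..<length ss} (\<lambda>r. V (ss ! r)))"
proof -
  let ?I = "\<lambda>ss. dsum {..<length ss} (\<lambda>r. V (ss ! r))"
  \<comment> \<open>\<open>?bd m U\<close> expresses dim U \<le> m through independent subsets, a
    form in which the bound is easily lowered on subspaces.\<close>
  let ?bd = "\<lambda>m U. \<forall>B\<subseteq>U. fs.independent B \<longrightarrow> finite B \<and> card B \<le> m"
  have VS: "fs.subspace (mcar (V i))" if "i \<in> \<Omega>" for i
    using V that by (auto simp: complete_simples_def simple_G_module_def dest: G_moduleD)
  \<comment> \<open>An independent subset of a proper subspace stays independent after adding a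
    vector outside that subspace, so the bound drops by one.\<close>
  have step: "?bd m U" if bd: "?bd (Suc m) (mcar M)" and U: "fs.subspace U" "U \<subset> mcar M"
    for m U and M :: "('g, 'c, 'k) opmod"
  proof (intro allI impI)
    fix B assume B: "B \<subseteq> U" "fs.independent B"
    obtain v where v: "v \<in> mcar M" "v \<notin> U" using U(2) by blast
    have vB: "v \<notin> fs.span B" using fs.span_minimal[OF B(1) U(1)] v(2) by blast
    have "fs.independent (insert v B)" using B(2) vB by (simp add: fs.independent_insert)
    then have "finite (insert v B) \<and> card (insert v B) \<le> Suc m"
      using bd[rule_format, of "insert v B"] B(1) U(2) v(1) by auto
    moreover have "v \<notin> B" using vB fs.span_base by blast
    ultimately show "finite B \<and> card B \<le> m" by auto
  qed
  have main: "\<exists>ss. set ss \<subseteq> \<Omega> \<and> mod_iso (carrier G) M (?I ss)"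
    if "G_module G M" "?bd m (mcar M)" for m and M :: "('g, 'c, 'k) opmod"
    using that
  proof (induction m arbitrary: M rule: less_induct)
    case (less m)
    note M = less.prems(1) and bd = less.prems(2)
    note D = G_moduleD[OF M]
    consider (zero) "mcar M = {0}" | (simple) "simple_G_module G M"
      | (split) S where "fs.subspace S" "S \<subseteq> mcar M" "\<And>h v. h \<in> carrier G \<Longrightarrow> v \<in> S \<Longrightarrow> mact M h v \<in> S"
        "S \<noteq> {0}" "S \<noteq> mcar M"
      using M unfolding simple_G_module_def by blast
    then show ?case
    proof cases
      case zero
      have Z: "mcar (?I []) = {0}"
        by (auto simp: mcar_dsum_iff curry_simps intro!: curry_eqI)
      have "mod_iso (carrier G) M (?I [])"
        by (rule mod_isoI[of _ _ "\<lambda>_. 0"])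
          (simp_all add: Z zero linear_on_def bij_betw_def, auto simp: dsum_def fun_eq_iff)
      then show ?thesis by (intro exI[of _ "[]"]) simp
    next
      case simple
      from complete_simples_iso[OF V this G(1)] obtain i where i: "i \<in> \<Omega>" "mod_iso (carrier G) M (V i)"
        by blast
      have "mod_iso (carrier G) (V i) (?I [i])"
      proof (rule mod_isoI[of _ _ "dinj 0"])
        show "linear_on (mcar (V i)) (mcar (?I [i])) (dinj 0)"
          using VS[OF i(1)] by (auto simp: linear_on_def dinj_simps intro!: dinj_in)
        show "bij_betw (dinj 0) (mcar (V i)) (mcar (?I [i]))"
        proof (rule bij_betw_byWitness[where f' = "\<lambda>f. curry f 0"])
          show "\<forall>f\<in>mcar (?I [i]). dinj 0 (curry f 0) = f"
            by (auto intro!: curry_eqI simp: curry_dinj mcar_dsum_iff)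
        qed (use VS[OF i(1)] in \<open>auto simp: curry_dinj mcar_dsum_iff\<close>)
      qed (auto intro!: curry_eqI simp: curry_dinj curry_mact_dsum)
      then show ?thesis using i mod_iso_trans by (intro exI[of _ "[i]"]) auto
    next
      case (split S)
      obtain p where p: "linear_on (mcar M) S p" "\<And>v. v \<in> S \<Longrightarrow> p v = v"
        "\<And>h v. h \<in> carrier G \<Longrightarrow> v \<in> mcar M \<Longrightarrow> p (mact M h v) = mact M h (p v)"
        using maschke[OF M G split(1-3)] by blast
      let ?C = "{v \<in> mcar M. p v = 0}"
      have C: "fs.subspace ?C" by (rule subspace_kernel_on[OF p(1) D(2)])
      have m0: "0 < m"
      proof -
        obtain v where v: "v \<in> S" "v \<noteq> 0" using split(1,4) fs.subspace_0 by blast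
        then have "fs.independent {v}" by (simp add: fs.dependent_single)
        then show ?thesis using bd[rule_format, of "{v}"] v split(2) by auto
      qed
      then obtain m' where m': "m = Suc m'" by (cases m) auto
      have C': "?C \<noteq> mcar M" using split(1,2,4) p(2) fs.subspace_0 by force
      have fS: "findim S" by (rule findim_image_projection[OF D(1) p(1) split(2) p(2)])
      have ql: "linear_on (mcar M) ?C (\<lambda>v. v - p v)"
        using linear_on_minus_fun[OF linear_on_id linear_on_mono[OF p(1) subset_refl split(2)] D(2)]
          linear_onD(1)[OF p(1)] split(2) p(2)
        by (auto simp: linear_on_def linear_on_diff[OF p(1) D(2)] subset_iff)
      have fC: "findim ?C" by (rule findim_image_projection[OF D(1) ql]) auto
      have hC: "mact M h v \<in> ?C" if "h \<in> carrier G" "v \<in> ?C" for h v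
        using that p(3) D linear_on_zero[OF D(3) D(2)] by simp
      have GS: "G_module G (M\<lparr>mcar := S\<rparr>)" by (rule G_module_restrict[OF M split(1-3) fS])
      have GC: "G_module G (M\<lparr>mcar := ?C\<rparr>)" by (rule G_module_restrict[OF M C _ hC fC]) auto
      have bS: "?bd m' S" using step[OF bd[unfolded m'] split(1)] split(2,5) by blast
      have bC: "?bd m' ?C" using step[OF bd[unfolded m'] C] C' by blast
      obtain ss where ss: "set ss \<subseteq> \<Omega>" "mod_iso (carrier G) (M\<lparr>mcar := S\<rparr>) (?I ss)"
        using less.IH[of m', OF _ GS] bS m' by auto
      obtain ts where ts: "set ts \<subseteq> \<Omega>" "mod_iso (carrier G) (M\<lparr>mcar := ?C\<rparr>) (?I ts)"
        using less.IH[of m', OF _ GC] bC m' by auto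
      have "mod_iso (carrier G) M (?I (ss @ ts))"
        by (rule mod_iso_dsum_append[OF D(2) split(1) C split(2) _ _ p(1,2) refl p(3) D(3) ss(2) ts(2)])
          (use ss(1) ts(1) VS in auto)
      then show ?thesis using ss(1) ts(1) by (intro exI[of _ "ss @ ts"]) auto
    qed
  qed
  obtain A where A: "finite A" "fs.span A = mcar M" using G_moduleD(1)[OF M] by (auto simp: findim_def)
  have "?bd (card A) (mcar M)" using fs.independent_span_bound[OF A(1)] A(2) by simp
  then show ?thesis using main[OF M] by blast
qed

section \<open>Tensor products of representations of \<open>G\<close>\<close>

lemma mod_iso_dsum_cong:
  fixes M :: "'r \<Rightarrow> ('x, 'a, 'k::field) opmod" and N :: "'r \<Rightarrow> ('x, 'b, 'k) opmod"
  assumes "\<And>r. r \<in> I \<Longrightarrow> mod_iso X (M r) (N r)"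
  shows "mod_iso X (dsum I M) (dsum I N)"
proof -
  have "\<forall>r\<in>I. \<exists>f. linear_on (mcar (M r)) (mcar (N r)) f \<and> bij_betw f (mcar (M r)) (mcar (N r)) \<and>
      (\<forall>x\<in>X. \<forall>v\<in>mcar (M r). f (mact (M r) x v) = mact (N r) x (f v))"
    using assms unfolding mod_iso_def by blast
  then obtain f where f: "\<And>r. r \<in> I \<Longrightarrow> linear_on (mcar (M r)) (mcar (N r)) (f r)"
    "\<And>r. r \<in> I \<Longrightarrow> bij_betw (f r) (mcar (M r)) (mcar (N r))"
    "\<And>r x v. r \<in> I \<Longrightarrow> x \<in> X \<Longrightarrow> v \<in> mcar (M r) \<Longrightarrow> f r (mact (M r) x v) = mact (N r) x (f r v)"
    by metis
  define F where "F f u = (\<lambda>(r, a). if r \<in> I then f r (curry u r) a else 0)"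
    for f :: "'r \<Rightarrow> ('a \<Rightarrow> 'k) \<Rightarrow> ('b \<Rightarrow> 'k)" and u
  \<comment> \<open>The construction of \<open>F\<close> repeated with the two types exchanged, as
    the inverse is built from maps in the other direction.\<close>
  define F' where "F' f u = (\<lambda>(r, a). if r \<in> I then f r (curry u r) a else 0)"
    for f :: "'r \<Rightarrow> ('b \<Rightarrow> 'k) \<Rightarrow> ('a \<Rightarrow> 'k)" and u
  have cF: "curry (F f u) r = (if r \<in> I then f r (curry u r) else 0)" for f u r
    by (auto simp: F_def fun_eq_iff)
  have cF': "curry (F' f u) r = (if r \<in> I then f r (curry u r) else 0)" for f u r
    by (auto simp: F'_def fun_eq_iff)
  show ?thesis
  proof (rule mod_isoI)
    show "linear_on (mcar (dsum I M)) (mcar (dsum I N)) (F f)"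
      using linear_onD[OF f(1)] unfolding linear_on_def
      by (auto simp: mcar_dsum_iff cF curry_simps intro!: curry_eqI)
    show "bij_betw (F f) (mcar (dsum I M)) (mcar (dsum I N))"
    proof (rule bij_betw_byWitness[where f' = "F' (\<lambda>r. inv_into (mcar (M r)) (f r))"])
      show "\<forall>u\<in>mcar (dsum I M). F' (\<lambda>r. inv_into (mcar (M r)) (f r)) (F f u) = u"
        by (auto simp: cF cF' mcar_dsum_iff bij_betw_inv_into_left[OF f(2)] intro!: curry_eqI)
      show "\<forall>u\<in>mcar (dsum I N). F f (F' (\<lambda>r. inv_into (mcar (M r)) (f r)) u) = u"
        by (auto simp: cF cF' mcar_dsum_iff bij_betw_inv_into_right[OF f(2)] intro!: curry_eqI)
      show "F f ` mcar (dsum I M) \<subseteq> mcar (dsum I N)"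
        using bij_betw_apply[OF f(2)] by (auto simp: cF mcar_dsum_iff)
      show "F' (\<lambda>r. inv_into (mcar (M r)) (f r)) ` mcar (dsum I N) \<subseteq> mcar (dsum I M)"
        using bij_betw_apply[OF bij_betw_inv_into[OF f(2)]] by (auto simp: cF' mcar_dsum_iff)
    qed
    show "F f (mact (dsum I M) x v) = mact (dsum I N) x (F f v)"
      if "x \<in> X" "v \<in> mcar (dsum I M)" for x v
      using that by (auto simp: cF curry_mact_dsum mcar_dsum_iff f(3) intro!: curry_eqI)
  qed
qed

text \<open>Only the index is reassociated, (t, (r, a)) to ((t, r), a). The carriers correspond
  because a component vanishes exactly when all its own components do.\<close>

lemma mod_iso_dsum_dsum:
  fixes M :: "'t \<times> 'r \<Rightarrow> ('x, 'a, 'k::field) opmod"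
  shows "mod_iso X (dsum I (\<lambda>t. dsum J (\<lambda>r. M (t, r)))) (dsum (I \<times> J) M)"
proof -
  let ?f = "\<lambda>u. \<lambda>((t, r), a). u (t, (r, a))" and ?g = "\<lambda>u. \<lambda>(t, (r, a)). u ((t, r), a)"
  have cf: "curry (?f u) (t, r) = curry (curry u t) r" for u :: "'t \<times> 'r \<times> 'a \<Rightarrow> 'k" and t r
    by (auto simp: fun_eq_iff)
  have cg: "curry (curry (?g u) t) r = curry u (t, r)" for u :: "('t \<times> 'r) \<times> 'a \<Rightarrow> 'k" and t r
    by (auto simp: fun_eq_iff)
  have eq0: "v = 0 \<longleftrightarrow> (\<forall>r. curry v r = 0)" for v :: "'r \<times> 'a \<Rightarrow> 'k"
    by (auto simp: curry_simps intro: curry_eqI)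
  have fin: "?f u \<in> mcar (dsum (I \<times> J) M)" if u: "u \<in> mcar (dsum I (\<lambda>t. dsum J (\<lambda>r. M (t, r))))" for u
  proof -
    have "curry (?f u) (t, r) \<in> mcar (M (t, r))" if "t \<in> I" "r \<in> J" for t r
      using u that unfolding cf by (simp add: mcar_dsum_iff)
    moreover have "curry (?f u) (t, r) = 0" if "t \<notin> I \<or> r \<notin> J" for t r
      using u that unfolding cf by (cases "t \<in> I") (auto simp: mcar_dsum_iff curry_simps)
    ultimately show ?thesis unfolding mcar_dsum_iff by (metis mem_Times_iff prod.collapse)
  qed
  have gin: "?g u \<in> mcar (dsum I (\<lambda>t. dsum J (\<lambda>r. M (t, r))))" if u: "u \<in> mcar (dsum (I \<times> J) M)" for u
    unfolding mcar_dsum_iff eq0 cg using u by (auto simp: mcar_dsum_iff)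
  show ?thesis
  proof (rule mod_isoI[of _ _ ?f])
    show "linear_on (mcar (dsum I (\<lambda>t. dsum J (\<lambda>r. M (t, r))))) (mcar (dsum (I \<times> J) M)) ?f"
      unfolding linear_on_def using fin by (auto simp: fun_eq_iff fscale_def)
    show "bij_betw ?f (mcar (dsum I (\<lambda>t. dsum J (\<lambda>r. M (t, r))))) (mcar (dsum (I \<times> J) M))"
      by (rule bij_betw_byWitness[where f' = ?g]) (use fin gin in \<open>auto simp: fun_eq_iff\<close>)
    show "?f (mact (dsum I (\<lambda>t. dsum J (\<lambda>r. M (t, r)))) x v) = mact (dsum (I \<times> J) M) x (?f v)" for x v
    proof (rule curry_eqI)
      fix p :: "'t \<times> 'r"
      obtain t r where "p = (t, r)" by fastforce
      then show "curry (?f (mact (dsum I (\<lambda>t. dsum J (\<lambda>r. M (t, r)))) x v)) p =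
          curry (mact (dsum (I \<times> J) M) x (?f v)) p"
        by (simp only: cf curry_mact_dsum) (auto simp: cf curry_mact_dsum curry_simps)
    qed
  qed
qed

lemma mcar_G_tensor: "mcar (G_tensor M N) = tensor_space (mcar M) (mcar N)"
  by (simp add: G_tensor_def)

lemma mact_G_tensor_vtensor:
  assumes "G_module G M" "G_module G N" "h \<in> carrier G" "u \<in> mcar M" "v \<in> mcar N"
  shows "mact (G_tensor M N) h (u \<boxtimes> v) = mact M h u \<boxtimes> mact N h v"
  using assms by (simp add: G_tensor_def tmap_vtensor[OF _ _ G_moduleD(3) G_moduleD(3)] G_moduleD(2))

lemma G_module_G_tensor:
  assumes G: "group G" and M: "G_module G M" and N: "G_module G N"
  shows "G_module G (G_tensor M N)"
proof -
  interpret group G by fact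
  note DM = G_moduleD[OF M] and DN = G_moduleD[OF N] and a = mact_G_tensor_vtensor[OF M N]
  let ?T = "tensor_space (mcar M) (mcar N)"
  have l: "linear_on ?T ?T (mact (G_tensor M N) h)" if "h \<in> carrier G" for h
    using that by (simp add: G_tensor_def linear_on_tmap[OF DM(2) DN(2) DM(3) DN(3)])
  have one: "mact (G_tensor M N) \<one>\<^bsub>G\<^esub> w = w" if "w \<in> ?T" for w
    by (rule tensor_ext[OF l linear_on_id _ that]) (auto simp: a DM DN)
  have mult: "mact (G_tensor M N) (h \<otimes>\<^bsub>G\<^esub> h') w = mact (G_tensor M N) h (mact (G_tensor M N) h' w)"
    if "h \<in> carrier G" "h' \<in> carrier G" "w \<in> ?T" for h h' w
    by (rule tensor_ext[OF l linear_on_compose[OF l l] _ that(3)])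
      (use that in \<open>auto simp: a DM DN\<close>)
  show ?thesis
    unfolding G_module_def mcar_G_tensor
    by (simp add: findim_tensor_space[OF DM(1) DN(1)] l one mult)
qed

section \<open>Twists by powers of the character\<close>

lemma mcar_x_twist [simp]: "mcar (x_twist \<chi> M k) = mcar M"
  and mact_x_twist: "mact (x_twist \<chi> M k) h v = inverse (\<chi> h) ^ k \<cdot> mact M h v"
  by (simp_all add: x_twist_def)

lemma mod_iso_x_twist:
  assumes "mod_iso (carrier G) M N" "G_module G M"
  shows "mod_iso (carrier G) (x_twist \<chi> M k) (x_twist \<chi> N k)"
proof -
  obtain f where f: "linear_on (mcar M) (mcar N) f" "bij_betw f (mcar M) (mcar N)"
    "\<And>h v. h \<in> carrier G \<Longrightarrow> v \<in> mcar M \<Longrightarrow> f (mact M h v) = mact N h (f v)"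
    using assms(1) by (auto simp: mod_iso_def)
  show ?thesis
    by (rule mod_isoI[of _ _ f])
      (use f G_moduleD(6)[OF assms(2)] in \<open>auto simp: mact_x_twist linear_onD(3)[OF f(1)]\<close>)
qed

lemma mod_iso_identity:
  assumes "mcar M = mcar N" "\<And>x v. x \<in> X \<Longrightarrow> v \<in> mcar M \<Longrightarrow> mact M x v = mact N x v"
  shows "mod_iso X M N"
  by (rule mod_isoI[of _ _ "\<lambda>v. v"]) (use assms in \<open>auto simp: linear_on_id bij_betw_def\<close>)

lemma curry_x_shift:
  "curry (x_shift k c f) s =
    (if s = 0 then c \<cdot> curry f (k - 1) else if s < k then curry f (s - 1) else 0)"
  by (auto simp: x_shift_def fun_eq_iff fscale_def)

text \<open>With at most k shifts an entry wraps around at most once, so the constant c occurs at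
  most to the first power.\<close>

lemma x_shift_pow:
  assumes "m \<le> k" "0 < k"
  shows "(x_shift k c ^^ m) f (s, a) =
    (if s < k then if m \<le> s then f (s - m, a) else c * f (k + s - m, a)
     else if m = 0 then f (s, a) else 0)"
  using assms(1)
proof (induction m arbitrary: s)
  case (Suc m)
  then show ?case
    using assms(2) by (auto simp: x_shift_def Suc_diff_Suc)
qed auto

text \<open>After exactly k shifts every entry has wrapped once and is back in its place.\<close>

lemma curry_x_shift_pow:
  assumes "0 < k"
  shows "curry ((x_shift k c ^^ k) f) s = (if s < k then c \<cdot> curry f s else 0)"
  using assms by (auto simp: fun_eq_iff x_shift_pow fscale_def)

section \<open>Twisted modules and the cyclic H-modules built from them\<close>

context datum
begin

lemma G_module_x_twist:
  assumes M: "G_module G M"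
  shows "G_module G (x_twist \<chi> M k)"
  unfolding G_module_def
proof (intro conjI ballI)
  note D = G_moduleD[OF M]
  show "findim (mcar (x_twist \<chi> M k))" using D(1) by simp
  show "linear_on (mcar (x_twist \<chi> M k)) (mcar (x_twist \<chi> M k)) (mact (x_twist \<chi> M k) h)"
    if "h \<in> carrier G" for h
    using linear_on_scale[OF D(3)[OF that] D(2)] by (simp add: x_twist_def)
qed (simp_all add: mact_x_twist \<chi>_one \<chi>_mult G_moduleD[OF M] linear_onD(3)[OF G_moduleD(3)[OF M]]
    power_mult_distrib mult.commute)

text \<open>The twist multiplies each operator by a nonzero scalar, so the invariant subspaces are
  the same.\<close>

lemma simple_x_twist:
  assumes M: "simple_G_module G M"
  shows "simple_G_module G (x_twist \<chi> M k)"
proof -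
  have GM: "G_module G M" using M by (simp add: simple_G_module_def)
  have "U = {0} \<or> U = mcar M"
    if U: "fs.subspace U" "U \<subseteq> mcar M" "\<forall>h\<in>carrier G. \<forall>u\<in>U. mact (x_twist \<chi> M k) h u \<in> U" for U
  proof -
    have "mact M h u \<in> U" if "h \<in> carrier G" "u \<in> U" for h u
    proof -
      have "mact M h u = \<chi> h ^ k \<cdot> mact (x_twist \<chi> M k) h u"
        using \<chi>_nonzero[OF that(1)] by (simp add: mact_x_twist power_inverse)
      then show ?thesis using U that by (simp add: fs.subspace_scale)
    qed
    then show ?thesis using M U by (auto simp: simple_G_module_def)
  qed
  then show ?thesis
    using M G_module_x_twist[OF GM] by (auto simp: simple_G_module_def)
qed

lemma G_module_chi_inv: "G_module G (chi_inv_module \<chi>)"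
proof -
  have "f \<in> fs.span {\<lambda>_. 1}" for f :: "unit \<Rightarrow> 'k"
  proof -
    have "f = f () \<cdot> (\<lambda>_. 1)" by (auto simp: fscale_def fun_eq_iff)
    then show ?thesis by (metis fs.span_base fs.span_scale insertI1)
  qed
  then have "fs.span {\<lambda>_. 1} = (UNIV :: (unit \<Rightarrow> 'k) set)" by blast
  then have "findim (UNIV :: (unit \<Rightarrow> 'k) set)" unfolding findim_def
    by (intro conjI exI[of _ "{\<lambda>_. 1}"]) auto
  then show ?thesis
    by (auto simp: G_module_def chi_inv_module_def linear_on_def \<chi>_one \<chi>_mult
        fs.scale_right_distrib mult.commute)
qed

text \<open>The link between x-twists and \<tau>: with \<open>?e\<close> the basis vector of the
  one-dimensional module, v \<mapsto> e \<otimes> v absorbs the scalars of the first factor into the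
  second.\<close>

lemma mod_iso_chi_tensor:
  assumes M: "G_module G M"
  shows "mod_iso (carrier G) (x_twist \<chi> M 1) (G_tensor (chi_inv_module \<chi>) M)"
proof -
  let ?T = "G_tensor (chi_inv_module \<chi>) M" and ?e = "\<lambda>_::unit. 1 :: 'k"
  note D = G_moduleD[OF M]
  have car: "mcar (chi_inv_module \<chi>) = UNIV" by (simp add: chi_inv_module_def)
  have l: "linear_on (mcar M) (mcar ?T) (\<lambda>v. ?e \<boxtimes> v)"
    by (auto simp: linear_on_def mcar_G_tensor car vtensor_in vtensor_add_right vtensor_scale_right)
  have sub: "fs.subspace ((\<lambda>v. ?e \<boxtimes> v) ` mcar M)" by (rule subspace_image_on[OF l D(2)])
  have "mcar ?T \<subseteq> (\<lambda>v. ?e \<boxtimes> v) ` mcar M"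
    unfolding mcar_G_tensor
  proof (rule tensor_space_subset[OF sub])
    fix u :: "unit \<Rightarrow> 'k" and v assume "v \<in> mcar M"
    moreover have "u \<boxtimes> v = ?e \<boxtimes> (u () \<cdot> v)"
      by (auto simp: vtensor_def fscale_def fun_eq_iff)
    ultimately show "u \<boxtimes> v \<in> (\<lambda>v. ?e \<boxtimes> v) ` mcar M"
      using fs.subspace_scale[OF D(2)] by blast
  qed
  moreover have "inj_on (\<lambda>v. ?e \<boxtimes> v) (mcar M)"
    by (auto simp: inj_on_def vtensor_def fun_eq_iff)
  ultimately have bij: "bij_betw (\<lambda>v. ?e \<boxtimes> v) (mcar M) (mcar ?T)"
    using linear_onD(1)[OF l] by (auto simp: bij_betw_def)
  show ?thesis
  proof (rule mod_isoI[of _ _ "\<lambda>v. ?e \<boxtimes> v"])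
    fix h v assume h: "h \<in> carrier G" and v: "v \<in> mcar (x_twist \<chi> M 1)"
    have "mact ?T h (?e \<boxtimes> v) = (inverse (\<chi> h) \<cdot> ?e) \<boxtimes> mact M h v"
      using v by (simp add: mact_G_tensor_vtensor[OF G_module_chi_inv M h] car) (simp add: chi_inv_module_def)
    then show "?e \<boxtimes> mact (x_twist \<chi> M 1) h v = mact ?T h (?e \<boxtimes> v)"
      by (simp add: mact_x_twist vtensor_scale_left vtensor_scale_right)
  qed (use l bij in simp_all)
qed

lemma \<chi>_pow: "h \<in> carrier G \<Longrightarrow> \<chi> (h [^] (k::nat)) = \<chi> h ^ k"
  by (induction k) (auto simp: \<chi>_one \<chi>_mult mult.commute)

lemma gn_in [simp]: "g [^] n \<in> carrier G"
  by simp

text \<open>Hence g^n acts on M and on all of its twists in the same way.\<close>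

lemma \<chi>_gn: "\<chi> (g [^] n) = 1"
  by (simp add: \<chi>_pow \<chi>_pow_n)

lemma gn_central: "h \<in> carrier G \<Longrightarrow> g [^] n \<otimes> h = h \<otimes> g [^] n"
  by (intro group_commutes_pow g_central) simp_all

text \<open>\<open>shift_module (V s) c\<close> is \<open>P\<^sub>s\<close> for \<open>c = \<lambda>\<^sub>s\<close> and \<open>M(n,s)\<close> for \<open>c = \<lambda>\<^sub>s = 1\<close>.\<close>

definition shift_module :: "('g, 'a, 'k) opmod \<Rightarrow> 'k \<Rightarrow> ('b \<Rightarrow> 'k, nat \<times> 'a, 'k) opmod"
  where "shift_module M c = H_module_of G H \<iota> y (dsum {..<n} (x_twist \<chi> M)) (x_shift n (c - 1))"

text \<open>The shift operator has to satisfy the two relations that involve y, the commutation with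
  G and the value of y^n; then the existence result for H-modules applies.\<close>

lemma shift_module_props:
  assumes M: "G_module G M" and gn: "\<forall>v\<in>mcar M. mact M (g [^] n) v = c \<cdot> v"
  defines "N \<equiv> dsum {..<n} (x_twist \<chi> M)"
  shows H_module_shift_module: "H_module H (shift_module M c)"
    and mcar_shift_module: "mcar (shift_module M c) = mcar N"
    and \<iota>_shift_module: "\<And>h v. h \<in> carrier G \<Longrightarrow> v \<in> mcar N \<Longrightarrow> mact (shift_module M c) (\<iota> h) v = mact N h v"
    and y_shift_module: "\<And>v. v \<in> mcar N \<Longrightarrow> mact (shift_module M c) y v = x_shift n (c - 1) v"
proof -
  note D = G_moduleD[OF M]
  have n0: "0 < n" using n_gt_1 by simp
  have N: "G_module G N" unfolding N_def by (intro G_module_dsum G_module_x_twist M) simp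
  have sub: "fs.subspace (mcar N)" using N by (rule G_moduleD)
  have l: "linear_on (mcar N) (mcar N) (x_shift n (c - 1))"
    unfolding linear_on_def N_def
    using n0 by (auto simp: mcar_dsum_iff curry_x_shift curry_simps fs.subspace_scale[OF D(2)]
        fs.scale_right_distrib intro!: curry_eqI)
  have cN: "curry (mact N h v) s = (if s < n then inverse (\<chi> h) ^ s \<cdot> mact M h (curry v s) else 0)" for h v s
    by (simp add: N_def curry_mact_dsum mact_x_twist)
  have sc: "x_shift n (c - 1) (mact N h v) = \<chi> h \<cdot> mact N h (x_shift n (c - 1) v)"
    if h: "h \<in> carrier G" and v: "v \<in> mcar N" for h v
  proof (rule curry_eqI)
    fix s
    have cv: "curry v s \<in> mcar M" if "s < n" for s using v that by (simp add: N_def mcar_dsum_iff)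
    note lh = linear_onD(3)[OF D(3)[OF h] cv]
    have "\<chi> h * inverse (\<chi> h) ^ s = inverse (\<chi> h) ^ (s - 1)" if "0 < s"
      using that \<chi>_nonzero[OF h] by (cases s) auto
    \<comment> \<open>Needed at the wrap from x^{n-1}M to M, where the twist drops from n - 1 to 0;
      this is where \<chi>^n = 1 is used for all of G.\<close>
    moreover have "inverse (\<chi> h) ^ (n - 1) = \<chi> h"
    proof -
      have "\<chi> h * inverse (\<chi> h) ^ (n - 1) = \<chi> h * (\<chi> h * inverse (\<chi> h) ^ n)"
        using n0 \<chi>_nonzero[OF h] by (cases n) auto
      also have "inverse (\<chi> h) ^ n = 1" by (simp add: power_inverse \<chi>_pow_n[OF h])
      finally show ?thesis using \<chi>_nonzero[OF h] by simp
    qed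
    ultimately show "curry (x_shift n (c - 1) (mact N h v)) s =
        curry (\<chi> h \<cdot> mact N h (x_shift n (c - 1) v)) s"
      using n0 by (auto simp: curry_x_shift curry_simps cN lh mult.commute)
  qed
  \<comment> \<open>After n shifts every component has the factor c - 1, while g^n acts by c on each
    x^sM because \<chi>(g^n) = 1.\<close>
  have pw: "(x_shift n (c - 1) ^^ n) v = mact N (g [^] n) v - v" if v: "v \<in> mcar N" for v
  proof -
    have "(x_shift n (c - 1) ^^ n) v + v = mact N (g [^] n) v"
    proof (rule curry_eqI)
      fix s
      have "curry v s \<in> mcar M" if "s < n" using v that by (simp add: N_def mcar_dsum_iff)
      moreover have "curry v s = 0" if "\<not> s < n" using v that by (simp add: N_def mcar_dsum_iff)
      ultimately show "curry ((x_shift n (c - 1) ^^ n) v + v) s = curry (mact N (g [^] n) v) s"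
        using n0 by (simp add: curry_simps curry_x_shift_pow cN \<chi>_gn gn fs.scale_left_diff_distrib)
    qed
    then show ?thesis by (simp add: eq_diff_eq)
  qed
  note * = H_module_of_props[OF N l sc pw, folded shift_module_def, unfolded N_def, folded shift_module_def]
  show "H_module H (shift_module M c)" "mcar (shift_module M c) = mcar N"
    "\<And>h v. h \<in> carrier G \<Longrightarrow> v \<in> mcar N \<Longrightarrow> mact (shift_module M c) (\<iota> h) v = mact N h v"
    "\<And>v. v \<in> mcar N \<Longrightarrow> mact (shift_module M c) y v = x_shift n (c - 1) v"
    using * by (simp_all add: N_def)
qed

end

section \<open>The permutation \<tau> of the simple modules and the scalars of g^n\<close>

locale datum_simples = datum G \<chi> g n H \<iota> y
  for G :: "('g, 'z) monoid_scheme" (structure)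
    and \<chi> :: "'g \<Rightarrow> 'k::{alg_closed_field, field_char_0}" and g :: 'g and n :: nat
    and H :: "('b, 'k) hopf" and \<iota> :: "'g \<Rightarrow> 'b \<Rightarrow> 'k" and y :: "'b \<Rightarrow> 'k" +
  fixes \<Omega> :: "'i set" and V :: "'i \<Rightarrow> ('g, 'a, 'k) opmod"
  assumes simples: "complete_simples G \<Omega> V"
begin

abbreviation lam :: "'i \<Rightarrow> 'k" where "lam s \<equiv> g_scalar G g n (V s)"

abbreviation \<tau> :: "'i \<Rightarrow> 'i" where "\<tau> \<equiv> tau G \<chi> \<Omega> V"

lemma simple_V: "s \<in> \<Omega> \<Longrightarrow> simple_G_module G (V s)"
  using simples by (simp add: complete_simples_def)

lemma G_module_V: "s \<in> \<Omega> \<Longrightarrow> G_module G (V s)"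
  using simple_V by (simp add: simple_G_module_def)

lemma V_nonzero: "s \<in> \<Omega> \<Longrightarrow> mcar (V s) \<noteq> {0}"
  using simple_V by (simp add: simple_G_module_def)

lemma gn_V: "s \<in> \<Omega> \<Longrightarrow> v \<in> mcar (V s) \<Longrightarrow> mact (V s) (g [^] n) v = lam s \<cdot> v"
proof -
  assume s: "s \<in> \<Omega>" and v: "v \<in> mcar (V s)"
  obtain c where c: "\<forall>v\<in>mcar (V s). mact (V s) (g [^] n) v = c \<cdot> v"
    using schur_central[OF simple_V[OF s] is_group fin gn_in gn_central] by blast
  have "lam s = c" by (rule g_scalar_eqI[OF V_nonzero[OF s] G_moduleD(2)[OF G_module_V[OF s]] c])
  then show ?thesis using c v by simp
qed

text \<open>The twist of a simple module is simple, so completeness supplies an index and the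
  absence of repetitions makes it unique. Both are needed for the definite description in
  \<open>tau\<close>.\<close>

lemma tau_props:
  assumes s: "s \<in> \<Omega>"
  shows tau_in: "\<tau> s \<in> \<Omega>"
    and mod_iso_tau: "mod_iso (carrier G) (x_twist \<chi> (V s) 1) (V (\<tau> s))"
proof -
  let ?T = "G_tensor (chi_inv_module \<chi>) (V s)"
  note iso = mod_iso_chi_tensor[OF G_module_V[OF s]]
  have T: "simple_G_module G ?T"
    by (rule simple_G_module_mod_iso[OF simple_x_twist[OF simple_V[OF s]] iso is_group])
  then have GT: "G_module G ?T" by (simp add: simple_G_module_def)
  obtain t where t: "t \<in> \<Omega>" "mod_iso (carrier G) ?T (V t)"
    using complete_simples_iso[OF simples T is_group] by (elim bexE)
  have inj: "\<forall>i\<in>\<Omega>. \<forall>j\<in>\<Omega>. mod_iso (carrier G) (V i) (V j) \<longrightarrow> i = j"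
    using simples unfolding complete_simples_def by (elim conjE)
  have "t' = t" if "t' \<in> \<Omega>" "mod_iso (carrier G) ?T (V t')" for t'
    using inj that(1) t(1) mod_iso_trans[OF G_module_mod_iso_sym[OF that(2) GT] t(2)] by blast
  then have eq: "\<tau> s = t" unfolding tau_def by (intro the_equality conjI t) (elim conjE)
  show "\<tau> s \<in> \<Omega>" unfolding eq by (rule t(1))
  show "mod_iso (carrier G) (x_twist \<chi> (V s) 1) (V (\<tau> s))"
    unfolding eq by (rule mod_iso_trans[OF iso t(2)])
qed

lemma tau_pow_props:
  assumes s: "s \<in> \<Omega>"
  shows tau_pow_in: "(\<tau> ^^ t) s \<in> \<Omega>"
    and mod_iso_tau_pow: "mod_iso (carrier G) (x_twist \<chi> (V s) t) (V ((\<tau> ^^ t) s))"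
proof (induction t)
  case 0
  show "(\<tau> ^^ 0) s \<in> \<Omega>" using s by simp
  show "mod_iso (carrier G) (x_twist \<chi> (V s) 0) (V ((\<tau> ^^ 0) s))"
    by (rule mod_iso_identity) (auto simp: mact_x_twist)
next
  case (Suc t)
  show "(\<tau> ^^ Suc t) s \<in> \<Omega>" using tau_in[OF Suc(1)] by simp
  have "mod_iso (carrier G) (x_twist \<chi> (V s) (Suc t)) (x_twist \<chi> (x_twist \<chi> (V s) t) 1)"
    by (rule mod_iso_identity) (auto simp: mact_x_twist)
  also note mod_iso_x_twist[OF Suc(2) G_module_x_twist[OF G_module_V[OF s]]]
  also (mod_iso_trans) note mod_iso_tau[OF Suc(1)]
  finally (mod_iso_trans) show "mod_iso (carrier G) (x_twist \<chi> (V s) (Suc t)) (V ((\<tau> ^^ Suc t) s))"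
    by simp
qed

text \<open>The t-fold twist multiplies the action of g^n by \<chi>(g^n)^{-t} = 1.\<close>

lemma lam_tau_pow:
  assumes s: "s \<in> \<Omega>"
  shows "lam ((\<tau> ^^ t) s) = lam s"
proof -
  let ?s = "(\<tau> ^^ t) s"
  have s': "?s \<in> \<Omega>" by (rule tau_pow_in[OF s])
  obtain f where f: "linear_on (mcar (V s)) (mcar (V ?s)) f" "bij_betw f (mcar (V s)) (mcar (V ?s))"
    "\<forall>h\<in>carrier G. \<forall>v\<in>mcar (V s). f (mact (x_twist \<chi> (V s) t) h v) = mact (V ?s) h (f v)"
    using mod_iso_tau_pow[OF s, of t] unfolding mod_iso_def mcar_x_twist by (elim exE conjE)
  show ?thesis
  proof (rule g_scalar_eqI[OF V_nonzero[OF s'] G_moduleD(2)[OF G_module_V[OF s']]], rule ballI)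
    fix w assume "w \<in> mcar (V ?s)"
    then have "w \<in> f ` mcar (V s)" by (simp only: bij_betw_imp_surj_on[OF f(2)])
    then obtain v where v: "w = f v" "v \<in> mcar (V s)" by (rule imageE)
    have "mact (x_twist \<chi> (V s) t) (g [^] n) v = lam s \<cdot> v"
      unfolding mact_x_twist \<chi>_gn gn_V[OF s v(2)] by simp
    then show "mact (V ?s) (g [^] n) w = lam s \<cdot> w"
      unfolding v(1) f(3)[rule_format, OF gn_in v(2), symmetric]
      by (simp only: linear_onD(3)[OF f(1) v(2)])
  qed
qed

lemma gn_G_tensor:
  assumes "i \<in> \<Omega>" "j \<in> \<Omega>" "w \<in> mcar (G_tensor (V i) (V j))"
  shows "mact (G_tensor (V i) (V j)) (g [^] n) w = (lam i * lam j) \<cdot> w"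
proof -
  note GV = G_module_V[OF assms(1)] G_module_V[OF assms(2)]
  let ?T = "tensor_space (mcar (V i)) (mcar (V j))"
  have l: "linear_on ?T ?T (mact (G_tensor (V i) (V j)) (g [^] n))"
    using G_moduleD(3)[OF G_module_G_tensor[OF is_group GV] gn_in] by (simp add: mcar_G_tensor)
  have l': "linear_on ?T UNIV (\<lambda>w. (lam i * lam j) \<cdot> w)"
    by (auto simp: linear_on_def fs.scale_right_distrib)
  show ?thesis
    by (rule tensor_ext[OF l l' _ assms(3)[unfolded mcar_G_tensor]])
      (use assms in \<open>auto simp: mact_G_tensor_vtensor[OF GV] gn_V vtensor_scale_left
        vtensor_scale_right mult.commute\<close>)
qed

text \<open>g^n acts on V_i \<otimes> V_j by \<lambda>_i\<lambda>_j, and every summand of any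
  decomposition inherits this scalar. It decides between \<Omega>_0 and \<Omega>_1 for all summands
  at once.\<close>

lemma lam_summand:
  assumes ij: "i \<in> \<Omega>" "j \<in> \<Omega>" and ss: "set ss \<subseteq> \<Omega>"
    and iso: "mod_iso (carrier G) (G_tensor (V i) (V j)) (dsum {..<length ss} (\<lambda>r. V (ss ! r)))"
    and r: "r < length ss"
  shows "lam (ss ! r) = lam i * lam j"
proof -
  let ?D = "dsum {..<length ss} (\<lambda>r. V (ss ! r))"
  have s: "ss ! r \<in> \<Omega>" if "r < length ss" for r using ss that by auto
  obtain f where f: "linear_on (mcar (G_tensor (V i) (V j))) (mcar ?D) f"
    "bij_betw f (mcar (G_tensor (V i) (V j))) (mcar ?D)"
    "\<forall>h\<in>carrier G. \<forall>v\<in>mcar (G_tensor (V i) (V j)).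
      f (mact (G_tensor (V i) (V j)) h v) = mact ?D h (f v)"
    using iso unfolding mod_iso_def by (elim exE conjE)
  note s = s[OF r]
  show ?thesis
  proof (rule g_scalar_eqI[OF V_nonzero[OF s] G_moduleD(2)[OF G_module_V[OF s]]], rule ballI)
    fix v assume v: "v \<in> mcar (V (ss ! r))"
    \<comment> \<open>A vector of the r-th summand is placed in the direct sum and pulled back to
      V_i \<otimes> V_j, where the scalar is known.\<close>
    have "dinj r v \<in> mcar ?D"
      using r ss by (intro dinj_in v G_moduleD(2)[OF G_module_V]) auto
    then have "dinj r v \<in> f ` mcar (G_tensor (V i) (V j))"
      by (simp only: bij_betw_imp_surj_on[OF f(2)])
    then obtain w where w: "dinj r v = f w" "w \<in> mcar (G_tensor (V i) (V j))" by (rule imageE)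
    have "mact ?D (g [^] n) (dinj r v) = (lam i * lam j) \<cdot> dinj r v"
      unfolding w(1) f(3)[rule_format, OF gn_in w(2), symmetric]
      by (simp only: gn_G_tensor[OF ij w(2)] linear_onD(3)[OF f(1) w(2)])
    then have "curry (mact ?D (g [^] n) (dinj r v)) r = curry ((lam i * lam j) \<cdot> dinj r v) r"
      by (rule arg_cong)
    then show "mact (V (ss ! r)) (g [^] n) v = (lam i * lam j) \<cdot> v"
      using r by (simp only: curry_mact_dsum curry_simps curry_dinj lessThan_iff if_True simp_thms)
  qed
qed

end

section \<open>Tensor products of the modules \<open>P\<^sub>i\<close>\<close>

text \<open>The maps col m \<circ> T k form a block unitriangular matrix, and by \<open>sep\<close>
  the columns determine w. So the sum of the images of the T k is direct and fills W.\<close>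

lemma triangular:
  fixes T :: "nat \<Rightarrow> ('r \<Rightarrow> 'k::field) \<Rightarrow> ('w \<Rightarrow> 'k)" and col :: "nat \<Rightarrow> ('w \<Rightarrow> 'k) \<Rightarrow> ('r \<Rightarrow> 'k)"
  assumes R: "fs.subspace R" and W: "fs.subspace W"
    and T: "\<And>k. k < n \<Longrightarrow> linear_on R W (T k)" and col: "\<And>k. k < n \<Longrightarrow> linear_on W R (col k)"
    and above: "\<And>k m r. k < m \<Longrightarrow> m < n \<Longrightarrow> r \<in> R \<Longrightarrow> col m (T k r) = 0"
    and diag: "\<And>k r. k < n \<Longrightarrow> r \<in> R \<Longrightarrow> col k (T k r) = r"
    and sep: "\<And>w. w \<in> W \<Longrightarrow> (\<And>k. k < n \<Longrightarrow> col k w = 0) \<Longrightarrow> w = 0"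
  shows triangular_inj:
      "(\<And>k. k < n \<Longrightarrow> u k \<in> R) \<Longrightarrow> (\<Sum>k<n. T k (u k)) = 0 \<Longrightarrow> k < n \<Longrightarrow> u k = 0"
    and triangular_surj: "w \<in> W \<Longrightarrow> \<exists>u. (\<forall>k. u k \<in> R) \<and> w = (\<Sum>k<n. T k (u k))"
proof -
  assume u: "\<And>k. k < n \<Longrightarrow> u k \<in> R" and sum: "(\<Sum>k<n. T k (u k)) = 0" and k: "k < n"
  have TW: "T k (u k) \<in> W" if "k < n" for k using linear_onD(1)[OF T[OF that] u[OF that]] .
  \<comment> \<open>The highest coefficient goes first: \<open>col m\<close> annihilates all terms
    of lower index and returns \<open>u m\<close>.\<close>
  have "\<forall>k<m. u k = 0" if "m \<le> n" "(\<Sum>k<m. T k (u k)) = 0" for m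
    using that
  proof (induction m)
    case (Suc m)
    have mn: "m < n" using Suc.prems(1) by simp
    have sum0: "(\<Sum>k<Suc m. T k (u k)) = 0" using Suc.prems(2) by (simp only: zero_fun_def)
    have "0 = col m (\<Sum>k<Suc m. T k (u k))"
      by (simp only: sum0 linear_on_zero[OF col[OF mn] W])
    also have "\<dots> = (\<Sum>k<Suc m. col m (T k (u k)))"
      by (rule linear_on_sum'[OF col[OF mn] W]) (use Suc.prems(1) TW in auto)
    also have "\<dots> = u m"
      using above[OF _ mn u] diag[OF mn u[OF mn]] mn by simp
    finally have um: "u m = 0" by simp
    have "(\<Sum>k<m. T k (u k)) = 0"
      using sum0 by (simp add: um linear_on_zero[OF T[OF mn] R])
    then show ?case using Suc.IH mn um by (auto simp: less_Suc_eq)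
  qed simp
  from this[OF order_refl sum] k show "u k = 0" by blast
next
  assume "w \<in> W"
  \<comment> \<open>Elimination from the top column downwards: subtracting
    \<open>T m (col m w)\<close> clears column m and leaves the columns above it zero.\<close>
  have "\<forall>w\<in>W. (\<forall>k. m \<le> k \<and> k < n \<longrightarrow> col k w = 0) \<longrightarrow>
      (\<exists>u. (\<forall>k. u k \<in> R) \<and> w = (\<Sum>k<m. T k (u k)))"
    if "m \<le> n" for m
    using that
  proof (induction m)
    case 0
    show ?case
    proof (intro ballI impI)
      fix w assume "w \<in> W" "\<forall>k. 0 \<le> k \<and> k < n \<longrightarrow> col k w = 0"
      then have "w = 0" using sep by blast
      then show "\<exists>u. (\<forall>k. u k \<in> R) \<and> w = (\<Sum>k<0. T k (u k))"
        by (intro exI[of _ "\<lambda>_. 0"] conjI allI fs.subspace_0[OF R]) simp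
    qed
  next
    case (Suc m)
    then have mn: "m < n" by simp
    show ?case
    proof (intro ballI impI)
      fix w assume w: "w \<in> W" and 0: "\<forall>k. Suc m \<le> k \<and> k < n \<longrightarrow> col k w = 0"
      let ?r = "col m w"
      have r: "?r \<in> R" by (rule linear_onD(1)[OF col[OF mn] w])
      have Tr: "T m ?r \<in> W" by (rule linear_onD(1)[OF T[OF mn] r])
      have "col k (w - T m ?r) = 0" if k: "m \<le> k" "k < n" for k
      proof (cases "k = m")
        case True
        then show ?thesis
          using diag[OF mn r] by (simp add: linear_on_diff[OF col[OF mn] W w Tr])
      next
        case False
        then have "m < k" using k by simp
        then show ?thesis
          using above[OF \<open>m < k\<close> k(2) r] 0 k(2) by (simp add: linear_on_diff[OF col[OF k(2)] W w Tr])
      qed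
      then obtain u where u: "\<forall>k. u k \<in> R" "w - T m ?r = (\<Sum>k<m. T k (u k))"
        using Suc.IH fs.subspace_diff[OF W w Tr] mn by (meson less_imp_le)
      have "w = (\<Sum>k<Suc m. T k ((u(m := ?r)) k))"
        using u(2) by (simp add: diff_eq_eq)
      then show "\<exists>u. (\<forall>k. u k \<in> R) \<and> w = (\<Sum>k<Suc m. T k (u k))"
        using u(1) r by (intro exI[of _ "u(m := ?r)"]) auto
    qed
  qed
  moreover have "\<forall>k. n \<le> k \<and> k < n \<longrightarrow> col k w = 0" by auto
  ultimately show "\<exists>u. (\<forall>k. u k \<in> R) \<and> w = (\<Sum>k<n. T k (u k))"
    using \<open>w \<in> W\<close> by blast
qed

text \<open>Distributivity is again a reassociation of indices, \<open>?f\<close> with inverse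
  \<open>?g\<close>. The content lies in showing that both respect the tensor spaces, which are
  spans of pure tensors.\<close>

lemma mod_iso_G_tensor_dsum:
  fixes M :: "'t \<Rightarrow> ('g, 'a, 'k::field) opmod" and N :: "('g, 'c, 'k) opmod"
  assumes G: "group G" and I: "finite I" and M: "\<And>t. t \<in> I \<Longrightarrow> G_module G (M t)" and N: "G_module G N"
  shows "mod_iso (carrier G) (G_tensor (dsum I M) N) (dsum I (\<lambda>t. G_tensor (M t) N))"
proof -
  let ?S = "G_tensor (dsum I M) N" and ?D = "dsum I (\<lambda>t. G_tensor (M t) N)"
  let ?T = "tensor_space (mcar (dsum I M)) (mcar N)"
  let ?f = "\<lambda>r. \<lambda>(t, (a, b)). r ((t, a), b)" and ?g = "\<lambda>z. \<lambda>((t, a), b). z (t, (a, b))"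
  have GD: "G_module G (dsum I M)" by (rule G_module_dsum[OF I M])
  have GT: "G_module G (G_tensor (M t) N)" if "t \<in> I" for t by (rule G_module_G_tensor[OF G M[OF that] N])
  have GS: "G_module G ?S" by (rule G_module_G_tensor[OF G GD N])
  have GD': "G_module G ?D" by (rule G_module_dsum[OF I GT])
  have subD: "fs.subspace (mcar ?D)" by (rule G_moduleD(2)[OF GD'])
  have cf: "curry (?f (u \<boxtimes> v)) t = curry u t \<boxtimes> v" for u :: "'t \<times> 'a \<Rightarrow> 'k" and v :: "'c \<Rightarrow> 'k" and t
    by (auto simp: fun_eq_iff vtensor_def)
  have z: "(0 :: 'a \<Rightarrow> 'k) \<boxtimes> v = 0" for v :: "'c \<Rightarrow> 'k" by (auto simp: fun_eq_iff vtensor_def)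
  have f: "linear_on ?T (mcar ?D) ?f"
  proof (rule tensor_map_in[OF _ subD])
    show "linear_on ?T UNIV ?f" by (auto simp: linear_on_def fun_eq_iff fscale_def)
    fix u v assume u: "u \<in> mcar (dsum I M)" and v: "v \<in> mcar N"
    show "?f (u \<boxtimes> v) \<in> mcar ?D"
      unfolding mcar_dsum_iff cf mcar_G_tensor
      using u v by (auto simp: mcar_dsum_iff z intro!: vtensor_in)
  qed
  \<comment> \<open>Elements of \<open>?D\<close> are split into their components, since
    \<open>?g\<close> is controlled by pure tensors inside a single summand.\<close>
  have g: "?g z \<in> ?T" if zD: "z \<in> mcar ?D" for z
  proof -
    have gd: "?g (dinj t w) \<in> ?T" if t: "t \<in> I" and w: "w \<in> tensor_space (mcar (M t)) (mcar N)" for t w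
    proof -
      have "linear_on (tensor_space (mcar (M t)) (mcar N)) ?T (\<lambda>w. ?g (dinj t w))"
      proof (rule tensor_map_in[OF _ subspace_tensor_space])
        show "linear_on (tensor_space (mcar (M t)) (mcar N)) UNIV (\<lambda>w. ?g (dinj t w))"
          by (auto simp: linear_on_def fun_eq_iff fscale_def dinj_def)
        fix u v assume u: "u \<in> mcar (M t)" and v: "v \<in> mcar N"
        have "?g (dinj t (u \<boxtimes> v)) = dinj t u \<boxtimes> v"
          by (auto simp: fun_eq_iff dinj_def vtensor_def)
        then show "?g (dinj t (u \<boxtimes> v)) \<in> ?T"
          using vtensor_in[OF dinj_in[where M = M, OF t u] v] G_moduleD(2)[OF M] by simp
      qed
      then show ?thesis using w by (rule linear_onD(1))
    qed
    have "?g z = ?g (\<Sum>t\<in>I. dinj t (curry z t))"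
      by (rule arg_cong[where f = ?g, OF dsum_decompose[OF I zD]])
    also have "\<dots> = (\<Sum>t\<in>I. ?g (dinj t (curry z t)))"
      by (auto simp: fun_eq_iff sum_fun_apply)
    also have "\<dots> \<in> ?T"
      by (rule fs.subspace_sum[OF subspace_tensor_space], rule gd)
        (use zD in \<open>auto simp: mcar_dsum_iff mcar_G_tensor\<close>)
    finally show ?thesis .
  qed
  have bij: "bij_betw ?f ?T (mcar ?D)"
    by (rule bij_betw_byWitness[where f' = ?g])
      (use g linear_onD(1)[OF f] in \<open>auto simp: fun_eq_iff\<close>)
  show ?thesis
  proof (rule mod_isoI[of _ _ ?f])
    show "linear_on (mcar ?S) (mcar ?D) ?f" using f by (simp add: mcar_G_tensor)
    show "bij_betw ?f (mcar ?S) (mcar ?D)" using bij by (simp add: mcar_G_tensor)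
    fix h r assume h: "h \<in> carrier G" and r: "r \<in> mcar ?S"
    have lS: "linear_on ?T ?T (mact ?S h)" using G_moduleD(3)[OF GS h] by (simp add: mcar_G_tensor)
    show "?f (mact ?S h r) = mact ?D h (?f r)"
    proof (rule tensor_ext[OF linear_on_compose[OF lS f] linear_on_compose[OF f G_moduleD(3)[OF GD' h]]])
      fix u v assume u: "u \<in> mcar (dsum I M)" and v: "v \<in> mcar N"
      show "?f (mact ?S h (u \<boxtimes> v)) = mact ?D h (?f (u \<boxtimes> v))"
      proof (rule curry_eqI)
        fix t
        have "curry (mact ?D h (?f (u \<boxtimes> v))) t =
            (if t \<in> I then mact (G_tensor (M t) N) h (curry u t \<boxtimes> v) else 0)"
          by (simp only: curry_mact_dsum cf)
        also have "\<dots> = curry (mact (dsum I M) h u) t \<boxtimes> mact N h v"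
          using mact_G_tensor_vtensor[OF M N h mcar_dsum_curry[OF u] v]
          by (simp only: curry_mact_dsum z split: if_split) simp
        also have "\<dots> = curry (?f (mact ?S h (u \<boxtimes> v))) t"
          by (simp only: mact_G_tensor_vtensor[OF GD N h u v] cf)
        finally show "curry (?f (mact ?S h (u \<boxtimes> v))) t = curry (mact ?D h (?f (u \<boxtimes> v))) t" ..
      qed
    qed (use r in \<open>simp add: mcar_G_tensor\<close>)
  qed
qed

section \<open>The action of y and G on tensor products of H-modules\<close>

context datum
begin

lemma mod_iso_G_tensor_x_twist:
  assumes M: "G_module G M" and N: "G_module G N"
  shows "mod_iso (carrier G) (G_tensor (x_twist \<chi> M k) N) (x_twist \<chi> (G_tensor M N) k)"
proof (rule mod_iso_identity)
  note GM = G_module_x_twist[OF M]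
  show "mcar (G_tensor (x_twist \<chi> M k) N) = mcar (x_twist \<chi> (G_tensor M N) k)"
    by (simp add: mcar_G_tensor)
  fix h w assume h: "h \<in> carrier G" and w: "w \<in> mcar (G_tensor (x_twist \<chi> M k) N)"
  let ?T = "tensor_space (mcar M) (mcar N)"
  have 1: "linear_on ?T ?T (mact (G_tensor (x_twist \<chi> M k) N) h)"
    using G_moduleD(3)[OF G_module_G_tensor[OF is_group GM N] h] by (simp add: mcar_G_tensor)
  have 2: "linear_on ?T ?T (mact (x_twist \<chi> (G_tensor M N) k) h)"
    using G_moduleD(3)[OF G_module_x_twist[OF G_module_G_tensor[OF is_group M N]] h]
    by (simp add: mcar_G_tensor)
  show "mact (G_tensor (x_twist \<chi> M k) N) h w = mact (x_twist \<chi> (G_tensor M N) k) h w"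
  proof (rule tensor_ext[OF 1 2])
    fix u v assume "u \<in> mcar M" "v \<in> mcar N"
    then show "mact (G_tensor (x_twist \<chi> M k) N) h (u \<boxtimes> v) =
        mact (x_twist \<chi> (G_tensor M N) k) h (u \<boxtimes> v)"
      by (simp add: mact_x_twist mact_G_tensor_vtensor[OF GM N h] mact_G_tensor_vtensor[OF M N h]
          vtensor_scale_left)
  qed (use w in \<open>simp add: mcar_G_tensor\<close>)
qed

lemma H_tensor_vtensor:
  assumes M: "alg_module H M" and N: "alg_module H N" and u: "u \<in> mcar M" and v: "v \<in> mcar N"
  shows \<iota>_H_tensor_vtensor: "h \<in> carrier G \<Longrightarrow>
      mact (H_tensor H M N) (\<iota> h) (u \<boxtimes> v) = mact M (\<iota> h) u \<boxtimes> mact N (\<iota> h) v"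
    and y_H_tensor_vtensor:
      "mact (H_tensor H M N) y (u \<boxtimes> v) = mact M y u \<boxtimes> mact N (\<iota> g) v + u \<boxtimes> mact N y v"
proof -
  note uv = vtensor_in[OF u v]
  note a = tensor_act_vtensor[OF alg M N _ _ uv] and t = module_tmap_vtensor[OF alg M N _ _ u v]
  show "mact (H_tensor H M N) (\<iota> h) (u \<boxtimes> v) = mact M (\<iota> h) u \<boxtimes> mact N (\<iota> h) v"
    if h: "h \<in> carrier G"
    by (simp add: mact_H_tensor comul_\<iota>[OF h] a t h)
  have "mact (H_tensor H M N) y (u \<boxtimes> v) =
      tensor_act H M N (y \<boxtimes> \<iota> g) (u \<boxtimes> v) + tensor_act H M N (hone H \<boxtimes> y) (u \<boxtimes> v)"
    unfolding mact_H_tensor comul_y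
    by (rule linear_onD(2)[OF linear_on_tensor_act[OF alg M N uv]])
      (simp_all add: vtensor_in algebraD[OF alg])
  then show "mact (H_tensor H M N) y (u \<boxtimes> v) = mact M y u \<boxtimes> mact N (\<iota> g) v + u \<boxtimes> mact N y v"
    by (simp add: a t algebraD[OF alg] alg_moduleD(4)[OF M u])
qed

lemma hpow_y_gn:
  assumes M: "alg_module H M" and v: "v \<in> mcar M"
  shows "mact M (hpow H y n) v = mact M (\<iota> (g [^] n)) v - v"
  unfolding y_pow_n
  using linear_on_diff[OF alg_moduleD(3)[OF M v] algebraD(1)[OF alg] \<iota>_in[OF gn_in] algebraD(2)[OF alg]]
  by (simp add: alg_moduleD(4)[OF M v])

lemma \<iota>_hpow_y_module:
  assumes M: "alg_module H M" and v: "v \<in> mcar M" and h: "h \<in> carrier G"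
  shows "mact M (\<iota> h) (mact M (hpow H y k) v) =
    inverse (\<chi> h) ^ k \<cdot> mact M (hpow H y k) (mact M (\<iota> h) v)"
proof -
  have "mact M (\<iota> h) (mact M (hpow H y k) v) = mact M (hmul H (\<iota> h) (hpow H y k)) v"
    using h v by (simp add: alg_moduleD(5)[OF M])
  also have "\<dots> = inverse (\<chi> h) ^ k \<cdot> mact M (hmul H (hpow H y k) (\<iota> h)) v"
    unfolding \<iota>_hpow_y[OF h] using h
    by (intro linear_onD(3)[OF alg_moduleD(3)[OF M v]] algebraD(5)[OF alg]) simp_all
  finally show ?thesis using h v by (simp add: alg_moduleD(5)[OF M])
qed

end

text \<open>
  For \<open>S = V \<oplus> xV \<oplus> x\<^sup>2V \<oplus> \<dots>\<close>, \<open>tensor_col l\<close> is the projection of \<open>M \<otimes> S\<close> to \<open>M \<otimes> x\<^sup>lV\<close> and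
  \<open>tensor_ins\<close> is the inclusion of \<open>M \<otimes> x\<^sup>0V\<close>.
\<close>

definition tensor_col :: "nat \<Rightarrow> ('c \<times> (nat \<times> 'a) \<Rightarrow> 'k::field) \<Rightarrow> ('c \<times> 'a \<Rightarrow> 'k)"
  where "tensor_col l f = (\<lambda>(p, b). f (p, (l, b)))"

definition tensor_ins :: "('c \<times> 'a \<Rightarrow> 'k::field) \<Rightarrow> ('c \<times> (nat \<times> 'a) \<Rightarrow> 'k)"
  where "tensor_ins r = (\<lambda>(p, (l, b)). if l = 0 then r (p, b) else 0)"

lemma tensor_col_vtensor: "tensor_col l (u \<boxtimes> v) = u \<boxtimes> curry v l"
  by (auto simp: tensor_col_def vtensor_def fun_eq_iff)

lemma tensor_ins_vtensor: "tensor_ins (u \<boxtimes> v) = u \<boxtimes> dinj 0 v"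
  by (auto simp: tensor_ins_def dinj_def vtensor_def fun_eq_iff)

lemma tensor_col_ins: "tensor_col l (tensor_ins r) = (if l = 0 then r else 0)"
  by (auto simp: tensor_col_def tensor_ins_def fun_eq_iff)

lemma tensor_col_linear: "linear_on V UNIV (tensor_col l)"
  by (auto simp: linear_on_def tensor_col_def fun_eq_iff fscale_def)

lemma tensor_ins_linear: "linear_on V UNIV tensor_ins"
  by (auto simp: linear_on_def tensor_ins_def fun_eq_iff fscale_def)

lemma vtensor_0_right: "u \<boxtimes> 0 = 0"
  by (auto simp: vtensor_def fun_eq_iff)

context datum
begin

text \<open>Only the second factor has to be a shift module. In
  \<open>y \<boxtimes> \<iota> g + hone H \<boxtimes> y\<close> the first term keeps each column and
  the second moves it up by one. In a column of index at least 1 the wrap with factor c - 1 does not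
  occur, so if the target column of w is zero, only the moved copy of the column below
  remains.\<close>

lemma tensor_shift_props:
  fixes M :: "('b \<Rightarrow> 'k, 'c, 'k) opmod" and N :: "('g, 'c, 'k) opmod" and S :: "('g, 'a, 'k) opmod"
  assumes M: "alg_module H M" and N: "G_module G N" and MN: "mcar M = mcar N"
    and \<iota>M: "\<forall>h\<in>carrier G. \<forall>v\<in>mcar N. mact M (\<iota> h) v = mact N h v"
    and S: "G_module G S" and gS: "\<forall>v\<in>mcar S. mact S (g [^] n) v = c \<cdot> v"
  defines "W \<equiv> H_tensor H M (shift_module S c)" and "R \<equiv> G_tensor N S"
  shows alg_module_tensor_shift: "alg_module H W"
    and linear_on_tensor_ins: "linear_on (mcar R) (mcar W) tensor_ins"
    and \<iota>_tensor_ins: "h \<in> carrier G \<Longrightarrow> r \<in> mcar R \<Longrightarrow>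
      mact W (\<iota> h) (tensor_ins r) = tensor_ins (mact R h r)"
    and linear_on_tensor_col: "l < n \<Longrightarrow> linear_on (mcar W) (mcar R) (tensor_col l)"
    and tensor_col_separates: "w \<in> mcar W \<Longrightarrow> (\<And>l. l < n \<Longrightarrow> tensor_col l w = 0) \<Longrightarrow> w = 0"
    and tensor_col_y: "w \<in> mcar W \<Longrightarrow> Suc l < n \<Longrightarrow> tensor_col (Suc l) w = 0 \<Longrightarrow>
      tensor_col (Suc l) (mact W y w) = tensor_col l w"
proof -
  let ?S = "shift_module S c" and ?D = "dsum {..<n} (x_twist \<chi> S)"
  note DS = G_moduleD[OF S]
  note PS = shift_module_props[OF S gS]
  have n0: "0 < n" using n_gt_1 by simp
  have A: "alg_module H ?S" using PS(1) by (simp add: H_module_iff)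
  have carW: "mcar W = tensor_space (mcar N) (mcar ?D)"
    by (simp add: W_def mcar_H_tensor MN PS(2))
  have carR: "mcar R = tensor_space (mcar N) (mcar S)" by (simp add: R_def mcar_G_tensor)
  show W: "alg_module H W" unfolding W_def by (rule alg_module_H_tensor[OF hopf M A])
  note DW = alg_moduleD[OF W]
  have GR: "G_module G R" unfolding R_def by (rule G_module_G_tensor[OF is_group N S])
  have subR: "fs.subspace (mcar R)" by (rule G_moduleD(2)[OF GR])
  have d0: "dinj 0 v \<in> mcar ?D" if "v \<in> mcar S" for v
    using n0 that by (intro dinj_in) (simp_all add: DS(2))
  show ins: "linear_on (mcar R) (mcar W) tensor_ins"
    unfolding carR
    by (rule tensor_map_in[OF tensor_ins_linear DW(1)])
      (simp add: tensor_ins_vtensor carW vtensor_in d0)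
  show "mact W (\<iota> h) (tensor_ins r) = tensor_ins (mact R h r)"
    if h: "h \<in> carrier G" and r: "r \<in> mcar R" for h r
  proof -
    have r': "r \<in> tensor_space (mcar N) (mcar S)" using r by (simp only: carR)
    have 1: "linear_on (tensor_space (mcar N) (mcar S)) (mcar W) (\<lambda>r. mact W (\<iota> h) (tensor_ins r))"
      using linear_on_compose[OF ins DW(2)[OF \<iota>_in[OF h]]] by (simp only: carR)
    have 2: "linear_on (tensor_space (mcar N) (mcar S)) (mcar W) (\<lambda>r. tensor_ins (mact R h r))"
      using linear_on_compose[OF G_moduleD(3)[OF GR h] ins] by (simp only: carR)
    show ?thesis
    proof (rule tensor_ext[OF 1 2 _ r'])
    fix u v assume u: "u \<in> mcar N" and v: "v \<in> mcar S"
    have "mact ?S (\<iota> h) (dinj 0 v) = dinj 0 (mact S h v)"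
    proof (rule curry_eqI)
      fix l
      have "mact S h 0 = 0" by (rule linear_on_zero[OF DS(3)[OF h] DS(2)])
      then show "curry (mact ?S (\<iota> h) (dinj 0 v)) l = curry (dinj 0 (mact S h v)) l"
        using n0 by (simp add: PS(3)[OF h d0[OF v]] curry_mact_dsum curry_dinj mact_x_twist)
    qed
    then show "mact W (\<iota> h) (tensor_ins (u \<boxtimes> v)) = tensor_ins (mact R h (u \<boxtimes> v))"
      unfolding W_def R_def tensor_ins_vtensor mact_G_tensor_vtensor[OF N S h u v]
      using \<iota>_H_tensor_vtensor[OF M A _ _ h, of u "dinj 0 v"] u d0[OF v]
      by (simp add: MN PS(2) \<iota>M[rule_format, OF h u])
    qed
  qed
  have c: "curry v l \<in> mcar S" if "v \<in> mcar ?D" "l < n" for v l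
    using that by (simp add: mcar_dsum_iff)
  show col: "linear_on (mcar W) (mcar R) (tensor_col l)" if l: "l < n" for l
    unfolding carW
    by (rule tensor_map_in[OF tensor_col_linear subR])
      (simp add: tensor_col_vtensor carR vtensor_in c l)
  show "w = 0" if w: "w \<in> mcar W" and 0: "\<And>l. l < n \<Longrightarrow> tensor_col l w = 0" for w
  proof -
    \<comment> \<open>Columns of index n and beyond vanish on all of \<open>W\<close>, so the
      assumption on the first n columns covers every entry of w.\<close>
    have "tensor_col l w = 0" if "\<not> l < n" for l
    proof -
      have "linear_on (mcar W) {0} (tensor_col l)"
        unfolding carW
      proof (rule tensor_map_in[OF tensor_col_linear])
        fix u v assume "v \<in> mcar ?D"
        then have "curry v l = 0" using that by (simp add: mcar_dsum_iff)
        then show "tensor_col l (u \<boxtimes> v) \<in> {0}" by (simp only: tensor_col_vtensor vtensor_0_right singleton_iff)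
      qed simp
      from linear_onD(1)[OF this w] show ?thesis by (simp only: singleton_iff)
    qed
    then have "tensor_col l w = 0" for l using 0[of l] by blast
    then show "w = 0" by (auto simp: fun_eq_iff tensor_col_def)
  qed
  show "tensor_col (Suc l) (mact W y w) = tensor_col l w"
    if w: "w \<in> mcar W" and l: "Suc l < n" and w0: "tensor_col (Suc l) w = 0" for w l
  proof -
    \<comment> \<open>\<open>?B\<close> is the action of g on x^{l+1}S, and \<open>?C\<close> is the
      effect of \<open>y \<boxtimes> \<iota> g\<close> on column l + 1.\<close>
    let ?B = "\<lambda>v. inverse (\<chi> g) ^ Suc l \<cdot> mact S g v"
    let ?C = "tmap (mcar M) (mcar S) (mact M y) ?B"
    have B: "linear_on (mcar S) (mcar S) ?B" by (intro linear_on_scale DS(2) DS(3) g_in)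
    note tm = tmap_props[OF alg_moduleD(1)[OF M] DS(2) alg_moduleD(2)[OF M y_in] B]
    have C: "linear_on (mcar R) (mcar R) ?C" using tm(1) by (simp add: carR MN)
    have "tensor_col (Suc l) (mact W y w) = tensor_col l w + ?C (tensor_col (Suc l) w)"
    proof -
      have w': "w \<in> tensor_space (mcar N) (mcar ?D)" using w by (simp only: carW)
      have 1: "linear_on (tensor_space (mcar N) (mcar ?D)) (mcar R) (\<lambda>w. tensor_col (Suc l) (mact W y w))"
        using linear_on_compose[OF DW(2)[OF y_in] col[OF l]] by (simp only: carW)
      have "linear_on (mcar W) (mcar R) (\<lambda>w. tensor_col l w + ?C (tensor_col (Suc l) w))"
        using l by (intro linear_on_add col linear_on_compose[OF col C] subR) simp_all
      then have 2: "linear_on (tensor_space (mcar N) (mcar ?D)) (mcar R)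
          (\<lambda>w. tensor_col l w + ?C (tensor_col (Suc l) w))" by (simp only: carW)
      show ?thesis
      proof (rule tensor_ext[OF 1 2 _ w'])
      fix u v assume u: "u \<in> mcar N" and v: "v \<in> mcar ?D"
      have "curry (mact ?S (\<iota> g) v) (Suc l) = ?B (curry v (Suc l))"
        using l by (simp add: PS(3)[OF g_in v] curry_mact_dsum mact_x_twist)
      moreover have "curry (mact ?S y v) (Suc l) = curry v l"
        using l by (simp add: PS(4)[OF v] curry_x_shift)
      moreover have "mact W y (u \<boxtimes> v) = mact M y u \<boxtimes> mact ?S (\<iota> g) v + u \<boxtimes> mact ?S y v"
        unfolding W_def using u v by (intro y_H_tensor_vtensor[OF M A]) (simp_all add: MN PS(2))
      ultimately have "tensor_col (Suc l) (mact W y (u \<boxtimes> v)) =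
          mact M y u \<boxtimes> ?B (curry v (Suc l)) + u \<boxtimes> curry v l"
        by (simp only: linear_onD(2)[OF tensor_col_linear UNIV_I UNIV_I] tensor_col_vtensor)
      then show "tensor_col (Suc l) (mact W y (u \<boxtimes> v)) =
          tensor_col l (u \<boxtimes> v) + ?C (tensor_col (Suc l) (u \<boxtimes> v))"
        using tm(2)[of u "curry v (Suc l)"] u c[OF v l]
        by (simp only: tensor_col_vtensor MN add.commute)
      qed
    qed
    then show ?thesis using linear_on_zero[OF C subR] by (simp only: w0 add_0_right)
  qed
qed

end

text \<open>The coefficient of \<open>x\<^sup>k\<close> in an element of \<open>\<Oplus>\<^sub>r (Q\<^sub>r \<oplus> xQ\<^sub>r \<oplus> x\<^sup>2Q\<^sub>r \<oplus> \<dots>)\<close>.\<close>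

definition level :: "nat \<Rightarrow> ('r \<times> (nat \<times> 'a) \<Rightarrow> 'k::field) \<Rightarrow> ('r \<times> 'a \<Rightarrow> 'k)"
  where "level k f = (\<lambda>(r, a). f (r, (k, a)))"

lemma curry_level: "curry (level k f) r = curry (curry f r) k"
  by (auto simp: level_def fun_eq_iff)

lemma level_add: "level k (f + f') = level k f + level k f'"
  and level_scale: "level k (c \<cdot> f) = c \<cdot> level k f"
  by (auto simp: level_def fun_eq_iff fscale_def)

section \<open>Tensor products with a shift module decompose into shift modules\<close>

context datum
begin

text \<open>An isomorphism \<phi> of G-modules from the sum of the \<open>Q r\<close> to
  \<open>G_tensor N S\<close> is extended by x^k q \<mapsto> y^k \<phi>(q). Triangularity makes this
  bijective; equivariance needs only the generators, with the common scalar \<mu> of g^n making the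
  wraps on both sides agree. The map starts at the sum of shift modules because it has an explicit
  formula there.\<close>

lemma mod_iso_tensor_shift_module:
  fixes M :: "('b \<Rightarrow> 'k, 'c, 'k) opmod" and N :: "('g, 'c, 'k) opmod" and S :: "('g, 'a, 'k) opmod"
    and Q :: "'r \<Rightarrow> ('g, 'd, 'k) opmod"
  assumes M: "alg_module H M" and N: "G_module G N" and MN: "mcar M = mcar N"
    and \<iota>M: "\<forall>h\<in>carrier G. \<forall>v\<in>mcar N. mact M (\<iota> h) v = mact N h v"
    and S: "G_module G S" and gS: "\<forall>v\<in>mcar S. mact S (g [^] n) v = c \<cdot> v"
    and I: "finite I" and Q: "\<And>r. r \<in> I \<Longrightarrow> G_module G (Q r)"
    and gQ: "\<And>r. r \<in> I \<Longrightarrow> \<forall>v\<in>mcar (Q r). mact (Q r) (g [^] n) v = \<mu> \<cdot> v"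
    and gW: "\<forall>w\<in>mcar (H_tensor H M (shift_module S c)).
      mact (H_tensor H M (shift_module S c)) (\<iota> (g [^] n)) w = \<mu> \<cdot> w"
    and iso: "mod_iso (carrier G) (dsum I Q) (G_tensor N S)"
  shows "mod_iso (hcar H) (dsum I (\<lambda>r. shift_module (Q r) \<mu>)) (H_tensor H M (shift_module S c))"
proof -
  let ?W = "H_tensor H M (shift_module S c)" and ?R = "G_tensor N S"
  let ?D = "dsum I (\<lambda>r. shift_module (Q r) \<mu>)" and ?Q = "dsum I Q"
  note free = tensor_shift_props[OF M N MN \<iota>M S gS]
  have W: "alg_module H ?W" by (rule free(1))
  note DW = alg_moduleD[OF W]
  have subR: "fs.subspace (mcar ?R)" by (rule G_moduleD(2)[OF G_module_G_tensor[OF is_group N S]])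
  have GQ: "G_module G ?Q" by (rule G_module_dsum[OF I Q])
  have PQ: "H_module H (shift_module (Q r) \<mu>)"
    "mcar (shift_module (Q r) \<mu>) = mcar (dsum {..<n} (x_twist \<chi> (Q r)))"
    "\<And>h v. h \<in> carrier G \<Longrightarrow> v \<in> mcar (dsum {..<n} (x_twist \<chi> (Q r))) \<Longrightarrow>
      mact (shift_module (Q r) \<mu>) (\<iota> h) v = mact (dsum {..<n} (x_twist \<chi> (Q r))) h v"
    "\<And>v. v \<in> mcar (dsum {..<n} (x_twist \<chi> (Q r))) \<Longrightarrow>
      mact (shift_module (Q r) \<mu>) y v = x_shift n (\<mu> - 1) v" if r: "r \<in> I" for r
    by (rule shift_module_props[OF Q[OF r] gQ[OF r]]; assumption)+
  have D: "alg_module H ?D"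
    by (rule alg_module_dsum[OF alg]) (use PQ(1) in \<open>simp add: H_module_iff\<close>)
  have subD: "fs.subspace (mcar ?D)" by (rule alg_moduleD(1)[OF D])
  have Dr: "curry f r \<in> mcar (dsum {..<n} (x_twist \<chi> (Q r)))" if "f \<in> mcar ?D" "r \<in> I" for f r
    using mcar_dsum_curry[OF that] unfolding PQ(2)[OF that(2)] .
  have Dr0: "curry f r = 0" if "f \<in> mcar ?D" "r \<notin> I" for f r
    using that by (simp add: mcar_dsum_iff)
  obtain \<phi> where \<phi>: "linear_on (mcar ?Q) (mcar ?R) \<phi>" "bij_betw \<phi> (mcar ?Q) (mcar ?R)"
    "\<forall>h\<in>carrier G. \<forall>v\<in>mcar ?Q. \<phi> (mact ?Q h v) = mact ?R h (\<phi> v)"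
    using iso unfolding mod_iso_def by (elim exE conjE)

  \<comment> \<open>An element of \<open>?D\<close> is handled as the n-tuple of its levels, each an
    element of \<open>?Q\<close>; the facts that follow express the actions and the reconstruction
    in these terms.\<close>
  have lev: "level k f \<in> mcar ?Q" if f: "f \<in> mcar ?D" and k: "k < n" for k f
    unfolding mcar_dsum_iff curry_level
  proof (intro conjI ballI allI impI)
    show "curry (curry f r) k \<in> mcar (Q r)" if "r \<in> I" for r
      using Dr[OF f that] k by (simp add: mcar_dsum_iff)
    show "curry (curry f r) k = 0" if "r \<notin> I" for r
      using Dr0[OF f that] by (simp add: curry_simps)
  qed
  have lev0: "f = 0" if f: "f \<in> mcar ?D" and 0: "\<And>k. k < n \<Longrightarrow> level k f = 0" for f
  proof (intro curry_eqI)
    fix r k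
    show "curry (curry f r) k = curry (curry 0 r) k"
    proof (cases "r \<in> I \<and> \<not> k < n")
      case True
      then show ?thesis using Dr[OF f, of r] by (simp add: mcar_dsum_iff curry_simps)
    next
      case False
      then consider "r \<notin> I" | "k < n" by blast
      then show ?thesis
      proof cases
        case 1
        then have "curry f r = 0" by (rule Dr0[OF f])
        then show ?thesis by (simp only: curry_simps)
      next
        case 2
        then show ?thesis
          using curry_level[of k f r] by (simp only: 0 curry_simps)
      qed
    qed
  qed
  have lev\<iota>: "level k (mact ?D (\<iota> h) f) = inverse (\<chi> h) ^ k \<cdot> mact ?Q h (level k f)"
    if f: "f \<in> mcar ?D" and h: "h \<in> carrier G" and k: "k < n" for f h k
  proof (rule curry_eqI)
    fix r
    show "curry (level k (mact ?D (\<iota> h) f)) r = curry (inverse (\<chi> h) ^ k \<cdot> mact ?Q h (level k f)) r"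
    proof (cases "r \<in> I")
      case True
      have "curry (curry (mact ?D (\<iota> h) f) r) k = inverse (\<chi> h) ^ k \<cdot> mact (Q r) h (curry (curry f r) k)"
        using True k by (simp only: curry_mact_dsum PQ(3)[OF True h Dr[OF f True]] mact_x_twist lessThan_iff if_True)
      then show ?thesis using True by (simp only: curry_level curry_simps curry_mact_dsum if_True)
    next
      case False
      then show ?thesis by (simp only: curry_level curry_simps curry_mact_dsum if_False fs.scale_zero_right)
    qed
  qed
  have levy: "level k (mact ?D y f) = (if k = 0 then (\<mu> - 1) \<cdot> level (n - 1) f else level (k - 1) f)"
    if f: "f \<in> mcar ?D" and k: "k < n" for f k
  proof (rule curry_eqI)
    fix r
    show "curry (level k (mact ?D y f)) r =
        curry (if k = 0 then (\<mu> - 1) \<cdot> level (n - 1) f else level (k - 1) f) r"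
    proof (cases "r \<in> I")
      case True
      have "curry (curry (mact ?D y f) r) k = (if k = 0 then (\<mu> - 1) \<cdot> curry (curry f r) (n - 1)
          else curry (curry f r) (k - 1))"
        using True k by (simp only: curry_mact_dsum PQ(4)[OF True Dr[OF f True]] curry_x_shift if_True)
      then show ?thesis by (cases "k = 0") (simp_all only: curry_level curry_simps if_True if_False simp_thms)
    next
      case False
      then show ?thesis using Dr0[OF f False]
        by (cases "k = 0")
          (simp_all only: curry_level curry_simps curry_mact_dsum if_True if_False fs.scale_zero_right simp_thms)
    qed
  qed
  have lev_ex: "\<exists>f\<in>mcar ?D. \<forall>k<n. level k f = u k" if u: "\<And>k. u k \<in> mcar ?Q" for u :: "nat \<Rightarrow> 'r \<times> 'd \<Rightarrow> 'k"
  proof -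
    define f where "f = (\<lambda>(r, (k, a)). if k < n then u k (r, a) else 0)"
    have cf: "curry (curry f r) k = (if k < n then curry (u k) r else 0)" for r k
      by (auto simp: f_def fun_eq_iff)
    have "curry f r \<in> mcar (shift_module (Q r) \<mu>)" if "r \<in> I" for r
      unfolding PQ(2)[OF that] mcar_dsum_iff cf using that mcar_dsum_curry[OF u] by simp
    moreover have "curry f r = 0" if "r \<notin> I" for r
    proof (rule curry_eqI)
      fix k
      have "curry (u k) r = 0" using u[of k] that by (simp add: mcar_dsum_iff)
      then show "curry (curry f r) k = curry 0 k" by (simp only: cf curry_simps if_cancel)
    qed
    ultimately have "f \<in> mcar ?D" unfolding mcar_dsum_iff by blast
    moreover have "level k f = u k" if "k < n" for k
      by (rule curry_eqI) (simp only: curry_level cf that if_True)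
    ultimately show ?thesis by blast
  qed

  \<comment> \<open>\<open>T k\<close> has image y^kU, where U is the image of
    \<open>tensor_ins\<close>.\<close>
  define T where "T k r = mact ?W (hpow H y k) (tensor_ins r)" for k r
  have Tlin: "linear_on (mcar ?R) (mcar ?W) (T k)" for k
    unfolding T_def[abs_def] by (rule linear_on_compose[OF free(2) DW(2)]) simp
  note TW = linear_onD(1)[OF Tlin]
  have TSuc: "T (Suc k) r = mact ?W y (T k r)" if "r \<in> mcar ?R" for k r
    unfolding T_def hpow_Suc using linear_onD(1)[OF free(2) that] by (intro DW(5)) simp_all
  \<comment> \<open>The wrap in W: y^n = g^n - 1 in H, and g^n acts by \<mu>.\<close>
  have Tn: "T n r = (\<mu> - 1) \<cdot> T 0 r" if r: "r \<in> mcar ?R" for r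
  proof -
    have "tensor_ins r \<in> mcar ?W" by (rule linear_onD(1)[OF free(2) r])
    then show ?thesis
      unfolding T_def hpow_y_gn[OF W \<open>tensor_ins r \<in> mcar ?W\<close>]
      by (simp add: gW hpow_0 DW(4) fs.scale_left_diff_distrib)
  qed
  have T\<iota>: "mact ?W (\<iota> h) (T k r) = inverse (\<chi> h) ^ k \<cdot> T k (mact ?R h r)"
    if "h \<in> carrier G" "r \<in> mcar ?R" for h k r
    unfolding T_def using linear_onD(1)[OF free(2) that(2)]
    by (simp only: \<iota>_hpow_y_module[OF W _ that(1)] free(3)[OF that])
  \<comment> \<open>By induction on k: for m \<ge> k, column m + 1 of y^k r is zero, so one more y
    simply moves column m into it.\<close>
  have shape: "(\<forall>m. k < m \<and> m < n \<longrightarrow> tensor_col m (T k r) = 0) \<and> (k < n \<longrightarrow> tensor_col k (T k r) = r)"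
    if r: "r \<in> mcar ?R" for k r
  proof (induction k)
    case 0
    have "T 0 r = tensor_ins r" unfolding T_def hpow_0 by (rule DW(4)[OF linear_onD(1)[OF free(2) r]])
    then show ?case by (simp add: tensor_col_ins)
  next
    case (Suc k)
    then have IH: "k < m \<Longrightarrow> m < n \<Longrightarrow> tensor_col m (T k r) = 0" "k < n \<Longrightarrow> tensor_col k (T k r) = r" for m
      by (simp_all add: zero_fun_def)
    have "tensor_col (Suc m) (T (Suc k) r) = tensor_col m (T k r)"
      if "k \<le> m" "Suc m < n" for m
      unfolding TSuc[OF r] using IH(1)[of "Suc m"] that by (intro free(6)[OF TW[OF r]]) auto
    note * = this
    have "tensor_col m (T (Suc k) r) = 0" if m: "Suc k < m" "m < n" for m
      using *[of "m - 1"] IH(1)[of "m - 1"] m by simp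
    moreover have "tensor_col (Suc k) (T (Suc k) r) = r" if "Suc k < n"
      using *[OF order_refl that] IH(2) that by simp
    ultimately show ?case by blast
  qed
  have above: "tensor_col m (T k r) = 0" if "k < m" "m < n" "r \<in> mcar ?R" for k m r
    using shape[OF that(3)] that(1,2) by blast
  have diag: "tensor_col k (T k r) = r" if "k < n" "r \<in> mcar ?R" for k r
    using shape[OF that(2)] that(1) by blast
  have tri_inj: "u k = 0" if "\<forall>k<n. u k \<in> mcar ?R" "(\<Sum>k<n. T k (u k)) = 0" "k < n" for u k
    by (rule triangular_inj[where T = T and col = tensor_col and n = n and u = u,
          OF subR DW(1) Tlin free(4) above diag free(5)])
      (use that in blast)+
  have tri_surj: "\<exists>u. (\<forall>k. u k \<in> mcar ?R) \<and> w = (\<Sum>k<n. T k (u k))" if "w \<in> mcar ?W" for w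
    by (rule triangular_surj[where T = T and col = tensor_col and n = n,
          OF subR DW(1) Tlin free(4) above diag free(5)])
      (use that in blast)+

  \<comment> \<open>The extension of \<phi>: level k, the coefficient of x^k, is sent into
    y^kU.\<close>
  define F where "F f = (\<Sum>k<n. T k (\<phi> (level k f)))" for f
  have level_lin: "linear_on (mcar ?D) (mcar ?Q) (level k)" if "k < n" for k
    using lev[OF _ that] by (simp add: linear_on_def level_add level_scale)
  have F: "linear_on (mcar ?D) (mcar ?W) F"
    unfolding F_def[abs_def]
    by (intro linear_on_sum_fun DW(1) linear_on_compose[OF level_lin linear_on_compose[OF \<phi>(1) Tlin]]) simp
  have \<phi>lev: "\<phi> (level k f) \<in> mcar ?R" if "f \<in> mcar ?D" "k < n" for k f
    using linear_onD(1)[OF \<phi>(1) lev[OF that]] .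
  have "inj_on F (mcar ?D)"
  proof (rule inj_on_linear_on[OF F subD])
    fix f assume f: "f \<in> mcar ?D" and F0: "F f = 0"
    show "f = 0"
    proof (rule lev0[OF f])
      fix k assume k: "k < n"
      have "\<phi> (level k f) = 0"
        using tri_inj[of "\<lambda>k. \<phi> (level k f)", OF _ _ k] F0 \<phi>lev[OF f] unfolding F_def by blast
      then have "\<phi> (level k f) = \<phi> 0" by (simp only: linear_on_zero[OF \<phi>(1) G_moduleD(2)[OF GQ]])
      then show "level k f = 0"
        using inj_onD[OF bij_betw_imp_inj_on[OF \<phi>(2)]] lev[OF f k] fs.subspace_0[OF G_moduleD(2)[OF GQ]]
        by blast
    qed
  qed
  moreover have "mcar ?W \<subseteq> F ` mcar ?D"
  proof
    fix w assume "w \<in> mcar ?W"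
    then obtain u where u: "\<forall>k. u k \<in> mcar ?R" "w = (\<Sum>k<n. T k (u k))"
      using tri_surj by blast
    let ?u = "\<lambda>k. inv_into (mcar ?Q) \<phi> (u k)"
    have "?u k \<in> mcar ?Q" for k
      using bij_betw_apply[OF bij_betw_inv_into[OF \<phi>(2)]] u(1) by blast
    from lev_ex[of ?u, OF this] obtain f where f: "f \<in> mcar ?D" "\<forall>k<n. level k f = ?u k" ..
    have "F f = w"
      unfolding F_def u(2)
      using f(2) u(1) bij_betw_inv_into_right[OF \<phi>(2)] by (intro sum.cong) auto
    then show "w \<in> F ` mcar ?D" using f(1) by blast
  qed
  ultimately have bij: "bij_betw F (mcar ?D) (mcar ?W)"
    using linear_onD(1)[OF F] by (auto simp: bij_betw_def)
  show ?thesis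
  proof (rule mod_iso_generators[OF D W F bij])
    fix h f assume h: "h \<in> carrier G" and f: "f \<in> mcar ?D"
    have "mact ?W (\<iota> h) (F f) = (\<Sum>k<n. mact ?W (\<iota> h) (T k (\<phi> (level k f))))"
      unfolding F_def by (rule linear_on_sum'[OF DW(2) DW(1)]) (use h f TW \<phi>lev in auto)
    also have "\<dots> = (\<Sum>k<n. T k (\<phi> (level k (mact ?D (\<iota> h) f))))"
    proof (rule sum.cong[OF refl])
      fix k assume "k \<in> {..<n}"
      then have k: "k < n" by simp
      note l = lev[OF f k]
      have hl: "mact ?Q h (level k f) \<in> mcar ?Q" by (rule G_moduleD(6)[OF GQ h l])
      have "T k (\<phi> (level k (mact ?D (\<iota> h) f))) = inverse (\<chi> h) ^ k \<cdot> T k (\<phi> (mact ?Q h (level k f)))"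
        by (simp only: lev\<iota>[OF f h k] linear_onD(3)[OF \<phi>(1) hl]
            linear_onD(3)[OF Tlin linear_onD(1)[OF \<phi>(1) hl]])
      then show "mact ?W (\<iota> h) (T k (\<phi> (level k f))) = T k (\<phi> (level k (mact ?D (\<iota> h) f)))"
        by (simp only: T\<iota>[OF h \<phi>lev[OF f k]] \<phi>(3)[rule_format, OF h l])
    qed
    finally show "F (mact ?D (\<iota> h) f) = mact ?W (\<iota> h) (F f)" by (simp only: F_def)
  next
    fix f assume f: "f \<in> mcar ?D"
    obtain m where m: "n = Suc m" using n_gt_1 by (cases n) auto
    have mn: "m < n" using m by simp
    have "F (mact ?D y f) = T 0 (\<phi> (level 0 (mact ?D y f))) +
        (\<Sum>k<m. T (Suc k) (\<phi> (level (Suc k) (mact ?D y f))))"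
      unfolding F_def m by (rule sum.lessThan_Suc_shift)
    \<comment> \<open>Level 0 of y f is \<mu> - 1 times the top level m = n - 1 of f, and the same
      factor turns \<open>T 0\<close> into \<open>T n\<close>. The other levels shift by
      one.\<close>
    also have "T 0 (\<phi> (level 0 (mact ?D y f))) = T n (\<phi> (level m f))"
    proof -
      have "level 0 (mact ?D y f) = (\<mu> - 1) \<cdot> level m f" using levy[OF f, of 0] m by simp
      then show ?thesis
        by (simp only: Tn[OF \<phi>lev[OF f mn]] linear_onD(3)[OF \<phi>(1) lev[OF f mn]]
            linear_onD(3)[OF Tlin \<phi>lev[OF f mn]])
    qed
    also have "(\<Sum>k<m. T (Suc k) (\<phi> (level (Suc k) (mact ?D y f)))) =
        (\<Sum>k<m. T (Suc k) (\<phi> (level k f)))"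
      by (rule sum.cong[OF refl]) (use levy[OF f] m in simp)
    also have "T n (\<phi> (level m f)) + (\<Sum>k<m. T (Suc k) (\<phi> (level k f))) =
        (\<Sum>k<n. T (Suc k) (\<phi> (level k f)))"
      unfolding m by (simp only: sum.lessThan_Suc add.commute)
    also have "\<dots> = (\<Sum>k<n. mact ?W y (T k (\<phi> (level k f))))"
      by (rule sum.cong[OF refl]) (use TSuc \<phi>lev[OF f] in simp)
    also have "\<dots> = mact ?W y (F f)"
      unfolding F_def by (rule linear_on_sum'[OF DW(2) DW(1), symmetric]) (use f TW \<phi>lev in auto)
    finally show "F (mact ?D y f) = mact ?W y (F f)" .
  qed
qed

end

section \<open>The tensor product of P_i and P_j for an arbitrary decomposition of V_i \<otimes>
  V_j\<close>

context datum_simples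
begin

text \<open>The preceding result with M = P_i, N its underlying G-module, S = V_j and
  \<open>Q (t, r)\<close> the simple module with index \<tau>^t(s_r). The family \<open>ss\<close>
  may be any decomposition of V_i \<otimes> V_j, as the theorem quantifies over all of them.\<close>

lemma mod_iso_tensor_shift_modules:
  assumes i: "i \<in> \<Omega>" and j: "j \<in> \<Omega>" and ss: "set ss \<subseteq> \<Omega>"
    and iso: "mod_iso (carrier G) (G_tensor (V i) (V j)) (dsum {..<length ss} (\<lambda>r. V (ss ! r)))"
  shows "mod_iso (hcar H) (H_tensor H (shift_module (V i) (lam i)) (shift_module (V j) (lam j)))
    (dsum ({..<n} \<times> {..<length ss})
      (\<lambda>(t, r). shift_module (V ((\<tau> ^^ t) (ss ! r))) (lam i * lam j)))"
proof -
  let ?Pi = "shift_module (V i) (lam i)" and ?Pj = "shift_module (V j) (lam j)"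
  let ?N = "dsum {..<n} (x_twist \<chi> (V i))" and ?Nj = "dsum {..<n} (x_twist \<chi> (V j))"
  let ?W = "H_tensor H ?Pi ?Pj" and ?T = "G_tensor (V i) (V j)" and ?L = "{..<length ss}"
  define Q where "Q = (\<lambda>(t, r). V ((\<tau> ^^ t) (ss ! r)))"
  note Vi = G_module_V[OF i] and Vj = G_module_V[OF j]
  have s: "ss ! r \<in> \<Omega>" if "r < length ss" for r using ss that by auto
  have N: "G_module G ?N" by (intro G_module_dsum G_module_x_twist Vi) simp
  have T: "G_module G ?T" by (rule G_module_G_tensor[OF is_group Vi Vj])
  have gn: "\<forall>v\<in>mcar (V s). mact (V s) (g [^] n) v = lam s \<cdot> v" if "s \<in> \<Omega>" for s
    using gn_V[OF that] by blast
  note Pi = shift_module_props[OF Vi gn[OF i]] and Pj = shift_module_props[OF Vj gn[OF j]]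
  have Ai: "alg_module H ?Pi" and Aj: "alg_module H ?Pj"
    using Pi(1) Pj(1) by (simp_all add: H_module_iff)
  have gN: "mact (dsum {..<n} (x_twist \<chi> (V k))) (g [^] n) v = lam k \<cdot> v"
    if k: "k \<in> \<Omega>" and v: "v \<in> mcar (dsum {..<n} (x_twist \<chi> (V k)))" for k v
  proof (rule curry_eqI)
    fix m
    have "curry v m \<in> mcar (V k)" if "m < n" using v that by (simp add: mcar_dsum_iff)
    moreover have "curry v m = 0" if "\<not> m < n" using v that by (simp add: mcar_dsum_iff)
    ultimately show "curry (mact (dsum {..<n} (x_twist \<chi> (V k))) (g [^] n) v) m = curry (lam k \<cdot> v) m"
      by (cases "m < n") (simp_all add: curry_mact_dsum curry_simps mact_x_twist \<chi>_gn gn_V[OF k])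
  qed
  have carW: "mcar ?W = tensor_space (mcar ?N) (mcar ?Nj)" by (simp only: mcar_H_tensor Pi(2) Pj(2))
  have W: "alg_module H ?W" by (rule alg_module_H_tensor[OF hopf Ai Aj])
  have gW: "mact ?W (\<iota> (g [^] n)) w = (lam i * lam j) \<cdot> w" if w: "w \<in> mcar ?W" for w
  proof -
    have 1: "linear_on (tensor_space (mcar ?N) (mcar ?Nj)) (mcar ?W) (mact ?W (\<iota> (g [^] n)))"
      using alg_moduleD(2)[OF W \<iota>_in[OF gn_in]] by (simp only: carW)
    have 2: "linear_on (tensor_space (mcar ?N) (mcar ?Nj)) UNIV (\<lambda>w. (lam i * lam j) \<cdot> w)"
      by (auto simp: linear_on_def fs.scale_right_distrib)
    show ?thesis
    proof (rule tensor_ext[OF 1 2 _ w[unfolded carW]])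
      fix u v assume u: "u \<in> mcar ?N" and v: "v \<in> mcar ?Nj"
      have "mact ?W (\<iota> (g [^] n)) (u \<boxtimes> v) = mact ?Pi (\<iota> (g [^] n)) u \<boxtimes> mact ?Pj (\<iota> (g [^] n)) v"
        using u v by (intro \<iota>_H_tensor_vtensor[OF Ai Aj]) (simp_all only: Pi(2) Pj(2) gn_in)
      then show "mact ?W (\<iota> (g [^] n)) (u \<boxtimes> v) = (lam i * lam j) \<cdot> (u \<boxtimes> v)"
        by (simp only: Pi(3)[OF gn_in u] Pj(3)[OF gn_in v] gN[OF i u] gN[OF j v]
            vtensor_scale_left vtensor_scale_right fs.scale_scale mult.commute)
    qed
  qed
  \<comment> \<open>The twists of the first factor are distributed over the tensor product, pulled
    out of each term, passed to the summands of V_i \<otimes> V_j and absorbed into powers of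
    \<tau>.\<close>
  have "mod_iso (carrier G) (G_tensor ?N (V j)) (dsum {..<n} (\<lambda>t. G_tensor (x_twist \<chi> (V i) t) (V j)))"
    by (rule mod_iso_G_tensor_dsum[OF is_group finite_lessThan G_module_x_twist[OF Vi] Vj])
  moreover have "mod_iso (carrier G) (dsum {..<n} (\<lambda>t. G_tensor (x_twist \<chi> (V i) t) (V j)))
      (dsum {..<n} (\<lambda>t. dsum ?L (\<lambda>r. Q (t, r))))"
  proof (rule mod_iso_dsum_cong)
    fix t
    have "mod_iso (carrier G) (G_tensor (x_twist \<chi> (V i) t) (V j)) (x_twist \<chi> ?T t)"
      by (rule mod_iso_G_tensor_x_twist[OF Vi Vj])
    moreover have "mod_iso (carrier G) (x_twist \<chi> ?T t) (x_twist \<chi> (dsum ?L (\<lambda>r. V (ss ! r))) t)"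
      by (rule mod_iso_x_twist[OF iso T])
    moreover have "mod_iso (carrier G) (x_twist \<chi> (dsum ?L (\<lambda>r. V (ss ! r))) t)
        (dsum ?L (\<lambda>r. x_twist \<chi> (V (ss ! r)) t))"
    proof (rule mod_iso_identity)
      show "mcar (x_twist \<chi> (dsum ?L (\<lambda>r. V (ss ! r))) t) = mcar (dsum ?L (\<lambda>r. x_twist \<chi> (V (ss ! r)) t))"
        by (auto simp: mcar_dsum_iff)
    qed (auto simp: mact_x_twist curry_mact_dsum curry_simps intro!: curry_eqI)
    moreover have "mod_iso (carrier G) (dsum ?L (\<lambda>r. x_twist \<chi> (V (ss ! r)) t)) (dsum ?L (\<lambda>r. Q (t, r)))"
      unfolding Q_def prod.case by (rule mod_iso_dsum_cong) (rule mod_iso_tau_pow, rule s, simp)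
    ultimately show "mod_iso (carrier G) (G_tensor (x_twist \<chi> (V i) t) (V j)) (dsum ?L (\<lambda>r. Q (t, r)))"
      by (blast intro: mod_iso_trans)
  qed
  moreover note mod_iso_dsum_dsum[of "carrier G" "{..<n}" ?L Q]
  ultimately have "mod_iso (carrier G) (G_tensor ?N (V j)) (dsum ({..<n} \<times> ?L) Q)"
    by (blast intro: mod_iso_trans)
  then have R: "mod_iso (carrier G) (dsum ({..<n} \<times> ?L) Q) (G_tensor ?N (V j))"
    by (rule G_module_mod_iso_sym) (rule G_module_G_tensor[OF is_group N Vj])
  have Q: "G_module G (Q p)" "\<forall>v\<in>mcar (Q p). mact (Q p) (g [^] n) v = (lam i * lam j) \<cdot> v"
    if mem: "p \<in> {..<n} \<times> ?L" for p
  proof -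
    obtain t r where p: "p = (t, r)" "r < length ss" using mem by auto
    have lam: "lam ((\<tau> ^^ t) (ss ! r)) = lam i * lam j"
      by (simp only: lam_tau_pow[OF s[OF p(2)]] lam_summand[OF i j ss iso p(2)])
    note in\<Omega> = tau_pow_in[OF s[OF p(2)], of t]
    show "G_module G (Q p)" unfolding p Q_def prod.case by (rule G_module_V[OF in\<Omega>])
    show "\<forall>v\<in>mcar (Q p). mact (Q p) (g [^] n) v = (lam i * lam j) \<cdot> v"
      using gn[OF in\<Omega>] unfolding p(1) Q_def prod.case lam .
  qed
  have "mod_iso (hcar H) (dsum ({..<n} \<times> ?L) (\<lambda>p. shift_module (Q p) (lam i * lam j))) ?W"
  proof (rule mod_iso_tensor_shift_module[OF Ai N Pi(2) _ Vj gn[OF j] _ Q _ R])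
    show "\<forall>h\<in>carrier G. \<forall>v\<in>mcar ?N. mact ?Pi (\<iota> h) v = mact ?N h v" using Pi(3) by blast
    show "\<forall>w\<in>mcar ?W. mact ?W (\<iota> (g [^] n)) w = (lam i * lam j) \<cdot> w" using gW by blast
  qed simp_all
  then have "mod_iso (hcar H) ?W (dsum ({..<n} \<times> ?L) (\<lambda>p. shift_module (Q p) (lam i * lam j)))"
  proof (rule mod_iso_sym)
    have "alg_module H (dsum ({..<n} \<times> ?L) (\<lambda>p. shift_module (Q p) (lam i * lam j)))"
      by (rule alg_module_dsum[OF alg]) (use H_module_shift_module[OF Q] in \<open>simp add: H_module_iff\<close>)
    from alg_moduleD(1,6)[OF this]
    show "fs.subspace (mcar (dsum ({..<n} \<times> ?L) (\<lambda>p. shift_module (Q p) (lam i * lam j))))"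
      "\<And>a v. a \<in> hcar H \<Longrightarrow> v \<in> mcar (dsum ({..<n} \<times> ?L) (\<lambda>p. shift_module (Q p) (lam i * lam j))) \<Longrightarrow>
        mact (dsum ({..<n} \<times> ?L) (\<lambda>p. shift_module (Q p) (lam i * lam j))) a v \<in>
        mcar (dsum ({..<n} \<times> ?L) (\<lambda>p. shift_module (Q p) (lam i * lam j)))" .
  qed
  moreover have "(\<lambda>p. shift_module (Q p) (lam i * lam j)) =
      (\<lambda>(t, r). shift_module (V ((\<tau> ^^ t) (ss ! r))) (lam i * lam j))"
    by (auto simp: Q_def fun_eq_iff)
  ultimately show ?thesis by (simp only:)
qed

end

text \<open>Components outside \<open>I\<close> never enter a direct sum. This allows the scalar in
  each shift module to be rewritten for the indices that occur.\<close>

lemma dsum_cong: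
  assumes "\<And>r. r \<in> I \<Longrightarrow> M r = N r"
  shows "dsum I M = dsum I N"
proof -
  have "(if r \<in> I then mcar (M r) else {0}) = (if r \<in> I then mcar (N r) else {0})" for r
    using assms by simp
  moreover have "(\<lambda>x f (r, a). if r \<in> I then mact (M r) x (curry f r) a else 0) =
      (\<lambda>x f (r, a). if r \<in> I then mact (N r) x (curry f r) a else 0)"
    using assms by (auto simp: fun_eq_iff)
  ultimately show ?thesis unfolding dsum_def by (simp only:)
qed

theorem proposition3p3:
  fixes G :: "('g, 'z) monoid_scheme"
    and \<chi> :: "'g \<Rightarrow> 'k::{alg_closed_field, field_char_0}"
    and g :: 'g and n :: nat
    and H :: "('b, 'k) hopf" and \<iota> :: "'g \<Rightarrow> 'b \<Rightarrow> 'k" and y :: "'b \<Rightarrow> 'k"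
    and \<Omega> :: "'i set" and V :: "'i \<Rightarrow> ('g, 'a, 'k) opmod"
    and i j :: 'i
  defines "\<Omega>\<^sub>0 \<equiv> Omega0 G g n \<Omega> V" and "\<Omega>\<^sub>1 \<equiv> Omega1 G g n \<Omega> V"
    and "lam \<equiv> (\<lambda>s. g_scalar G g n (V s))"
    and "\<tau> \<equiv> tau G \<chi> \<Omega> V"
    and "M \<equiv> (\<lambda>k s. M_module G \<chi> H \<iota> y k (V s))"
    and "P \<equiv> (\<lambda>s. P_module G \<chi> g n H \<iota> y (V s))"
  assumes "nonnilpotent_datum G \<chi> g n"
    and "datum_hopf_algebra G \<chi> g n H \<iota> y"
    and "complete_simples G \<Omega> V"
    and "i \<in> \<Omega>\<^sub>1" and "j \<in> \<Omega>\<^sub>1"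
  shows "(lam i * lam j = 1 \<longrightarrow>
      (\<exists>ss. set ss \<subseteq> \<Omega>\<^sub>0 \<and>
        mod_iso (carrier G) (G_tensor (V i) (V j)) (dsum {..<length ss} (\<lambda>r. V (ss ! r)))) \<and>
      (\<forall>ss. set ss \<subseteq> \<Omega>\<^sub>0 \<and>
        mod_iso (carrier G) (G_tensor (V i) (V j)) (dsum {..<length ss} (\<lambda>r. V (ss ! r))) \<longrightarrow>
        mod_iso (hcar H) (H_tensor H (P i) (P j))
          (dsum ({..<n} \<times> {..<length ss}) (\<lambda>(t, r). M n ((\<tau> ^^ t) (ss ! r)))))) \<and>
    (lam i * lam j \<noteq> 1 \<longrightarrow>
      (\<exists>ss. set ss \<subseteq> \<Omega>\<^sub>1 \<and>
        mod_iso (carrier G) (G_tensor (V i) (V j)) (dsum {..<length ss} (\<lambda>r. V (ss ! r)))) \<and>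
      (\<forall>ss. set ss \<subseteq> \<Omega>\<^sub>1 \<and>
        mod_iso (carrier G) (G_tensor (V i) (V j)) (dsum {..<length ss} (\<lambda>r. V (ss ! r))) \<longrightarrow>
        mod_iso (hcar H) (H_tensor H (P i) (P j))
          (dsum ({..<n} \<times> {..<length ss}) (\<lambda>(t, r). P ((\<tau> ^^ t) (ss ! r))))))"
proof -
  interpret datum_simples G \<chi> g n H \<iota> y \<Omega> V
    using assms(7-9) by (intro datum_simples.intro datum.intro datum_simples_axioms.intro)
  let ?iso = "\<lambda>ss. mod_iso (carrier G) (G_tensor (V i) (V j)) (dsum {..<length ss} (\<lambda>r. V (ss ! r)))"
  have ij: "i \<in> \<Omega>" "j \<in> \<Omega>" using assms(10,11) by (auto simp: \<Omega>\<^sub>1_def Omega1_def)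
  have sub: "\<Omega>\<^sub>0 \<subseteq> \<Omega>" "\<Omega>\<^sub>1 \<subseteq> \<Omega>" by (auto simp: \<Omega>\<^sub>0_def \<Omega>\<^sub>1_def Omega0_def Omega1_def)
  have P: "P s = shift_module (V s) (lam s)" for s
    by (simp add: P_def P_module_def shift_module_def lam_def)
  \<comment> \<open>The top of M(n,s) is annihilated by y, which is the shift constant 1 - 1 =
    0.\<close>
  have M: "M n s = shift_module (V s) 1" for s
    by (simp add: M_def M_module_def shift_module_def)
  have lam: "lam (ss ! r) = lam i * lam j" if "set ss \<subseteq> \<Omega>" "?iso ss" "r < length ss" for ss r
    unfolding lam_def by (rule lam_summand[OF ij that])
  have main: "mod_iso (hcar H) (H_tensor H (P i) (P j))
      (dsum ({..<n} \<times> {..<length ss}) (\<lambda>(t, r). shift_module (V ((\<tau> ^^ t) (ss ! r))) (lam i * lam j)))"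
    if "set ss \<subseteq> \<Omega>" "?iso ss" for ss
    unfolding P lam_def \<tau>_def by (rule mod_iso_tensor_shift_modules[OF ij that])
  \<comment> \<open>Complete reducibility gives one decomposition, and its common scalar places it
    in \<Omega>_0 or \<Omega>_1. The claims about all decompositions rest on \<open>main\<close>
    instead.\<close>
  obtain ss where ss: "set ss \<subseteq> \<Omega>" "?iso ss"
    using semisimple[OF simples is_group fin G_module_G_tensor[OF is_group G_module_V[OF ij(1)] G_module_V[OF ij(2)]]]
    by (elim exE conjE)
  have scalars: "lam s = lam i * lam j" if "s \<in> set ss" for s
    using lam[OF ss] that by (metis in_set_conv_nth)
  have "set ss \<subseteq> \<Omega>\<^sub>0" if "lam i * lam j = 1"
    using scalars ss(1) that by (auto simp: \<Omega>\<^sub>0_def Omega0_def lam_def)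
  moreover have "set ss \<subseteq> \<Omega>\<^sub>1" if "lam i * lam j \<noteq> 1"
    using scalars ss(1) that by (auto simp: \<Omega>\<^sub>1_def Omega1_def lam_def)
  moreover have "mod_iso (hcar H) (H_tensor H (P i) (P j))
      (dsum ({..<n} \<times> {..<length ss}) (\<lambda>(t, r). M n ((\<tau> ^^ t) (ss ! r))))"
    if "lam i * lam j = 1" "set ss \<subseteq> \<Omega>\<^sub>0" "?iso ss" for ss
    using main[OF order_trans[OF that(2) sub(1)] that(3)] by (simp only: M that(1))
  moreover have "mod_iso (hcar H) (H_tensor H (P i) (P j))
      (dsum ({..<n} \<times> {..<length ss}) (\<lambda>(t, r). P ((\<tau> ^^ t) (ss ! r))))"
    if "set ss \<subseteq> \<Omega>\<^sub>1" "?iso ss" for ss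
  proof -
    have ss: "set ss \<subseteq> \<Omega>" using that(1) sub(2) by (rule order_trans)
    \<comment> \<open>\<open>P\<close> closes up with the scalar of its own index, whereas
      \<open>main\<close> uses \<lambda>_i\<lambda>_j; the two agree on every summand.\<close>
    have "lam ((\<tau> ^^ t) (ss ! r)) = lam i * lam j" if r: "r < length ss" for t r
    proof -
      have "ss ! r \<in> \<Omega>" using ss nth_mem[OF r] by (rule subsetD)
      from lam_tau_pow[OF this, of t] lam[OF ss \<open>?iso ss\<close> r] show ?thesis
        by (simp only: lam_def \<tau>_def)
    qed
    then have "dsum ({..<n} \<times> {..<length ss}) (\<lambda>(t, r). P ((\<tau> ^^ t) (ss ! r))) =
        dsum ({..<n} \<times> {..<length ss}) (\<lambda>(t, r). shift_module (V ((\<tau> ^^ t) (ss ! r))) (lam i * lam j))"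
      by (intro dsum_cong) (auto simp: P)
    with main[OF ss that(2)] show ?thesis by (simp only:)
  qed
  ultimately show ?thesis using ss(2) by blast
qed

end
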